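(* There exists $h_0>0$ such that for every $h\in(0,h_0)$ the eigenvalue $\lambda_{5,h}(S)$ is not Courant-sharp. In particular, setting $$\theta_1^*(h)=\arctan\left(-\frac{\cos(\alpha_0(h)/2)}{\cos(\alpha_2(h)/2)}\right),\qquad \theta_2^*(h)=\frac{\pi}{2}-\theta_1^*(h),\qquad \theta_3^*=\frac{3\pi}{4},$$ which are three critical values in $[0,\pi)$, the function $\Phi_{h,\theta,0,2}$ has, in $S$: (i) $3$ nodal domains for $\theta\in[0,\theta_1^*(h)]$; (ii) $2$ nodal domains for $\theta\in(\theta_1^*(h),\theta_2^*(h))$; (iii) $3$ nodal domains for $\theta\in[\theta_2^*(h),\theta_3^* )$; (iv) $4$ nodal domains for $\theta=\theta_3^*$; (v) $3$ nodal domains for $\theta\in(\theta_3^*,\pi)$.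
   Context: $S=(-\frac{\pi}{2},\frac{\pi}{2})^2\subset\mathbb{R}^2$. For $h\ge 0$, $\lambda_{1,h}(S)\le\lambda_{2,h}(S)\le\cdots$ denote the eigenvalues, counted with multiplicity, of the Robin problem $-\Delta u=\lambda u$ in $S$, $\frac{\partial u}{\partial\nu}+hu=0$ on $\partial S$ ($\nu$ the outward unit normal). The nodal domains of a function $u$ on $S$ are the connected components of $\{z\in S:u(z)\ne 0\}$. $\lambda_{k,h}(S)$ is Courant-sharp if some associated eigenfunction has exactly $k$ nodal domains. For $n$ even, $\alpha_n(h)$ is the unique solution in $[n\pi,(n+1)\pi)$ of $\alpha\tan\frac{\alpha}{2}=h\pi$. Finally, $$\Phi_{h,\theta,0,2}(x,y)=\cos\theta\,\cos\!\left(\tfrac{\alpha_0(h)x}{\pi}\right)\cos\!\left(\tfrac{\alpha_2(h)y}{\pi}\right)+\sin\theta\,\cos\!\left(\tfrac{\alpha_2(h)x}{\pi}\right)\cos\!\left(\tfrac{\alpha_0(h)y}{\pi}\right),$$ which is an eigenfunction of the Robin problem with parameter $h$. *)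

theory Defs
  imports "HOL-Analysis.Analysis" "HOL-Library.Function_Algebras"
begin

definition Sq :: "(real \<times> real) set"
  where "Sq = {-pi/2<..<pi/2} \<times> {-pi/2<..<pi/2}"

text \<open>The outward unit normal \<open>\<nu>\<close> at \<open>z\<close>; it is defined on the four open sides, not at the corners.\<close>

definition Sq_normal :: "real \<times> real \<Rightarrow> real \<times> real \<Rightarrow> bool"
  where "Sq_normal z \<nu> \<longleftrightarrow>
    (\<exists>t\<in>{-pi/2<..<pi/2}.
      (z = (pi/2, t) \<and> \<nu> = (1, 0)) \<or> (z = (-pi/2, t) \<and> \<nu> = (-1, 0)) \<or>
      (z = (t, pi/2) \<and> \<nu> = (0, 1)) \<or> (z = (t, -pi/2) \<and> \<nu> = (0, -1)))"

text \<open>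
  Classical solutions \<open>u \<in> C\<^sup>1(closure Sq) \<inter> C\<^sup>2(Sq)\<close> of \<open>-\<Delta>u = \<lambda>u\<close> in \<open>Sq\<close>,
  \<open>\<partial>u/\<partial>\<nu> + h u = 0\<close> on the boundary. Here \<open>g\<close> is the gradient (one-sided on the boundary) and \<open>H\<close>
  the derivative of \<open>g\<close>, i.e. the Hessian, whose trace is the Laplacian.
\<close>

definition robin_solution :: "real \<Rightarrow> real \<Rightarrow> (real \<times> real \<Rightarrow> real) \<Rightarrow> bool"
  where "robin_solution h lam u \<longleftrightarrow>
    (\<exists>(g :: real \<times> real \<Rightarrow> real \<times> real) (H :: real \<times> real \<Rightarrow> (real \<times> real) \<Rightarrow>\<^sub>L (real \<times> real)).
      continuous_on (closure Sq) g \<and>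
      (\<forall>z\<in>closure Sq. (u has_derivative (\<lambda>v. g z \<bullet> v)) (at z within closure Sq)) \<and>
      continuous_on Sq H \<and>
      (\<forall>z\<in>Sq. (g has_derivative blinfun_apply (H z)) (at z)) \<and>
      (\<forall>z\<in>Sq. - (\<Sum>b\<in>Basis. blinfun_apply (H z) b \<bullet> b) = lam * u z) \<and>
      (\<forall>z \<nu>. Sq_normal z \<nu> \<longrightarrow> g z \<bullet> \<nu> + h * u z = 0))"

text \<open>
  Functions on the closed square are represented by their extension by zero to the plane, so that
  equality and linear independence depend only on the values on the square.
\<close>

definition robin_eigenspace :: "real \<Rightarrow> real \<Rightarrow> (real \<times> real \<Rightarrow> real) set"
  where "robin_eigenspace h lam = {u. robin_solution h lam u \<and> (\<forall>z. z \<notin> closure Sq \<longrightarrow> u z = 0)}"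

definition robin_eigenfunction :: "real \<Rightarrow> real \<Rightarrow> (real \<times> real \<Rightarrow> real) \<Rightarrow> bool"
  where "robin_eigenfunction h lam u \<longleftrightarrow> u \<in> robin_eigenspace h lam \<and> (\<exists>z. u z \<noteq> 0)"

definition is_robin_eigenvalue :: "real \<Rightarrow> real \<Rightarrow> bool"
  where "is_robin_eigenvalue h lam \<longleftrightarrow> (\<exists>u. robin_eigenfunction h lam u)"

definition fun_scale :: "real \<Rightarrow> (real \<times> real \<Rightarrow> real) \<Rightarrow> (real \<times> real \<Rightarrow> real)"
  where "fun_scale c u = (\<lambda>z. c * u z)"

lemma vector_space_fun_scale: "vector_space fun_scale"
  by unfold_locales (auto simp: fun_scale_def fun_eq_iff algebra_simps)

text \<open>\<open>dim\<close> would be \<open>0\<close> for an infinite-dimensional space; the Robin eigenspaces are finite-dimensional.\<close>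

definition robin_multiplicity :: "real \<Rightarrow> real \<Rightarrow> nat"
  where "robin_multiplicity h lam = vector_space.dim fun_scale (robin_eigenspace h lam)"

text \<open>
  The \<open>k\<close>-th eigenvalue (\<open>k \<ge> 1\<close>), counted with multiplicity: fewer than \<open>k\<close> eigenvalues lie
  strictly below it, and at least \<open>k\<close> do not exceed it.
\<close>

definition robin_eigenvalue :: "real \<Rightarrow> nat \<Rightarrow> real"
  where "robin_eigenvalue h k = (THE lam.
    is_robin_eigenvalue h lam \<and>
    finite {\<mu>. is_robin_eigenvalue h \<mu> \<and> \<mu> \<le> lam} \<and>
    (\<Sum>\<mu> | is_robin_eigenvalue h \<mu> \<and> \<mu> < lam. robin_multiplicity h \<mu>) < k \<and>
    k \<le> (\<Sum>\<mu> | is_robin_eigenvalue h \<mu> \<and> \<mu> \<le> lam. robin_multiplicity h \<mu>))"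

definition nodal_domains :: "(real \<times> real \<Rightarrow> real) \<Rightarrow> (real \<times> real) set set"
  where "nodal_domains u = components {z \<in> Sq. u z \<noteq> 0}"

definition has_nodal_count :: "(real \<times> real \<Rightarrow> real) \<Rightarrow> nat \<Rightarrow> bool"
  where "has_nodal_count u k \<longleftrightarrow> finite (nodal_domains u) \<and> card (nodal_domains u) = k"

definition courant_sharp :: "real \<Rightarrow> nat \<Rightarrow> bool"
  where "courant_sharp h k \<longleftrightarrow>
    (\<exists>u. robin_eigenfunction h (robin_eigenvalue h k) u \<and> has_nodal_count u k)"

text \<open>Only used for even \<open>n\<close>, where \<open>tan (\<alpha>/2)\<close> has no pole on the interval.\<close>

definition robin_alpha :: "nat \<Rightarrow> real \<Rightarrow> real"
  where "robin_alpha n h =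
    (THE \<alpha>. real n * pi \<le> \<alpha> \<and> \<alpha> < (real n + 1) * pi \<and> \<alpha> * tan (\<alpha> / 2) = h * pi)"

definition Phi02 :: "real \<Rightarrow> real \<Rightarrow> real \<times> real \<Rightarrow> real"
  where "Phi02 h \<theta> = (\<lambda>(x, y).
    cos \<theta> * cos (robin_alpha 0 h * x / pi) * cos (robin_alpha 2 h * y / pi) +
    sin \<theta> * cos (robin_alpha 2 h * x / pi) * cos (robin_alpha 0 h * y / pi))"

definition theta1 :: "real \<Rightarrow> real"
  where "theta1 h = arctan (- (cos (robin_alpha 0 h / 2) / cos (robin_alpha 2 h / 2)))"

definition theta2 :: "real \<Rightarrow> real"
  where "theta2 h = pi / 2 - theta1 h"

definition theta3 :: real
  where "theta3 = 3 * pi / 4"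

end

theory Submission
  imports Defs
begin

text \<open>
  The Robin problem on the square separates. With the frequencies \<open>\<omega>\<^sub>n\<close> of the one-dimensional
  problem, the products of one-dimensional modes are eigenfunctions with eigenvalue
  \<open>\<omega>\<^sub>i\<^sup>2 + \<omega>\<^sub>j\<^sup>2\<close>. For small \<open>h\<close> the frequency \<open>\<omega>\<^sub>n\<close> is only slightly larger than \<open>n\<close>, so the
  eigenvalues, with multiplicity, start near \<open>0, 1, 1, 2, 4, 4\<close>, and the fifth one belongs to the
  index pairs \<open>(0, 2)\<close> and \<open>(2, 0)\<close>. Its eigenspace therefore consists of the multiples of the
  functions \<open>\<Phi>\<^sub>\<theta>\<close>, and the proposition reduces to counting the nodal domains of the superpositions
  \<open>c \<phi>\<^sub>0 \<phi>\<^sub>2 + s \<phi>\<^sub>2 \<phi>\<^sub>0\<close>: there are never more than four.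

  The delicate point of the first half is that there is no other eigenvalue in this range. Products
  of modes with indices \<open>0, 1, 2\<close> suffice to see it. A function on the interval which is orthogonal to
  these three modes has Rayleigh quotient at least \<open>25/4\<close> (\<open>poincare_orthogonal\<close>): adding a
  combination of the three modes only lowers the quadratic form \<open>E - 25/4 \<parallel>\<cdot>\<parallel>\<^sup>2\<close>, where \<open>E\<close> is the
  Robin energy, and a suitable combination makes the function vanish at \<open>0\<close> and \<open>\<plusminus>\<pi>/3\<close>, where
  Picone's identity shows that the form is nonnegative. Green's identity
  (\<open>robin_solution_weak\<close>), tested against \<open>\<phi>\<^sub>i(x) k(y)\<close>, shows that each mode coefficient of an
  eigenfunction with eigenvalue \<open>\<lambda> < 25/4\<close> weakly solves a one-dimensional Robin problem, and so is
  a combination of modes; the part of the eigenfunction that is orthogonal to the modes vanishes by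
  the Rayleigh bound. Hence every such eigenfunction is a combination of products of modes
  (\<open>robin_solution_expansion\<close>), which gives all multiplicities and identifies the fifth eigenvalue
  (\<open>robin_eigenvalue_5\<close>).

  For the second half divide the superposition by the positive function \<open>\<phi>\<^sub>0(x) \<phi>\<^sub>0(y)\<close>. The sign is
  then that of \<open>c q(y) + s q(x)\<close>, where \<open>q = cos(\<omega>\<^sub>2 t) / cos(\<omega>\<^sub>0 t)\<close>. The two cosines satisfy the same
  Robin condition, so their Wronskian vanishes at \<open>0\<close> and at \<open>\<pi>/2\<close> and is negative in between. Thus
  \<open>q\<close> is even and strictly decreasing on \<open>[0, \<pi>/2]\<close>, from \<open>1\<close> to some \<open>-m\<close> with \<open>m > 1\<close>. Everything
  else depends only on these properties: every point of a nodal domain can be moved monotonically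
  towards or away from the coordinate axes without a change of sign, so the nodal domains are counted
  by the corners which they reach and the axes which they cross. The number changes exactly when \<open>s/c\<close>
  passes \<open>1/m\<close>, \<open>m\<close> or \<open>-1\<close>, which are the tangents of the three critical angles.
\<close>

section \<open>Frequencies of the one-dimensional Robin problem\<close>

text \<open>
  Writing the frequency as \<open>\<omega> = n + s\<close>, the boundary condition for \<open>cos (\<omega> x)\<close> with \<open>n\<close> even and the one
  for \<open>sin (\<omega> x)\<close> with \<open>n\<close> odd become the same equation for \<open>s\<close>. This form of it has no poles, so the
  intermediate value theorem applies directly.
\<close>

definition phase :: "nat \<Rightarrow> real \<Rightarrow> real"
  where "phase n h = (SOME s. 0 < s \<and> s < 1 \<and> (n + s) * sin (s * pi / 2) = h * cos (s * pi / 2))"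

definition freq :: "nat \<Rightarrow> real \<Rightarrow> real"
  where "freq n h = n + phase n h"

lemma phase_exists:
  assumes "0 < h" "0 < \<epsilon>" "\<epsilon> \<le> 1" "h * cos (\<epsilon> * pi / 2) < (n + \<epsilon>) * sin (\<epsilon> * pi / 2)"
  shows "\<exists>s. 0 < s \<and> s < \<epsilon> \<and> (real n + s) * sin (s * pi / 2) = h * cos (s * pi / 2)"
proof -
  let ?f = "\<lambda>s. (real n + s) * sin (s * pi / 2) - h * cos (s * pi / 2)"
  have "\<exists>s\<ge>0. s \<le> \<epsilon> \<and> ?f s = 0"
    using assms by (intro IVT') (auto intro!: continuous_intros)
  then obtain s where s: "s \<ge> 0" "s \<le> \<epsilon>" "?f s = 0" by blast
  moreover have "?f 0 \<noteq> 0" "?f \<epsilon> \<noteq> 0" using assms by auto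
  ultimately have "s \<noteq> 0" "s \<noteq> \<epsilon>" by metis+
  with s show ?thesis by (intro exI[of _ s]) auto
qed

lemma phase_equation_mono:
  assumes "0 \<le> s" "s < t" "t < 1"
  shows "(real n + s) * tan (s * pi / 2) < (real n + t) * tan (t * pi / 2)"
proof (rule mult_strict_mono')
  show "tan (s * pi / 2) < tan (t * pi / 2)"
    using assms by (intro tan_monotone) (auto intro: less_le_trans[of _ 0])
  show "0 \<le> tan (s * pi / 2)"
    using assms by (cases "s = 0") (auto intro!: less_imp_le[OF tan_gt_zero])
qed (use assms in auto)

lemma phase_equation_tan:
  assumes "0 \<le> s" "s < 1"
  shows "(real n + s) * sin (s * pi / 2) = h * cos (s * pi / 2) \<longleftrightarrow> (real n + s) * tan (s * pi / 2) = h"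
proof -
  have "cos (s * pi / 2) > 0"
    using assms by (intro cos_gt_zero_pi) (auto intro: less_le_trans[of _ 0])
  then show ?thesis by (auto simp: tan_def field_simps)
qed

lemma phase_props:
  assumes "0 < h"
  shows "0 < phase n h" "phase n h < 1"
    "(n + phase n h) * sin (phase n h * pi / 2) = h * cos (phase n h * pi / 2)"
    "(n + phase n h) * tan (phase n h * pi / 2) = h"
proof -
  have "0 < phase n h \<and> phase n h < 1 \<and>
    (n + phase n h) * sin (phase n h * pi / 2) = h * cos (phase n h * pi / 2)"
    unfolding phase_def by (rule someI_ex, rule phase_exists) (use assms in auto)
  then show *: "0 < phase n h" "phase n h < 1"
    "(n + phase n h) * sin (phase n h * pi / 2) = h * cos (phase n h * pi / 2)"
    by blast+
  show "(n + phase n h) * tan (phase n h * pi / 2) = h"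
    using * phase_equation_tan[of "phase n h" n h] less_imp_le by blast
qed

lemma phase_unique:
  assumes "0 < h" "0 \<le> s" "s < 1" "(real n + s) * tan (s * pi / 2) = h"
  shows "s = phase n h"
proof (rule ccontr)
  note p = phase_props[OF assms(1), of n]
  assume "s \<noteq> phase n h"
  then consider "s < phase n h" | "phase n h < s" by linarith
  then show False
    using phase_equation_mono[of s "phase n h" n] phase_equation_mono[of "phase n h" s n] p(1,2,4) assms(2-4)
    by cases linarith+
qed

text \<open>
  At a fixed phase the left-hand side of \<open>(n + s) tan (s \<pi> / 2) = h\<close> grows with \<open>n\<close>, so its solution
  \<open>s\<close> must get smaller. This is what makes \<open>m > 1\<close>, and hence separates the first two critical angles.
\<close>

lemma phase_decreasing:
  assumes "0 < h" "m < n"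
  shows "phase n h < phase m h"
proof (rule ccontr)
  assume "\<not> ?thesis"
  then have le: "phase m h \<le> phase n h" by simp
  note pn = phase_props[OF assms(1), of n] and pm = phase_props[OF assms(1), of m]
  have "h = (m + phase m h) * tan (phase m h * pi / 2)" using pm(4) ..
  also have "\<dots> \<le> (m + phase n h) * tan (phase n h * pi / 2)"
    using phase_equation_mono[of "phase m h" "phase n h" m] le pn(2) pm(1)
    by (cases "phase m h = phase n h") auto
  also have "\<dots> < (n + phase n h) * tan (phase n h * pi / 2)"
    using pn(1,2) assms(2) by (intro mult_strict_right_mono tan_gt_zero) auto
  finally show False using pn(4) by linarith
qed

text \<open>
  The bound on \<open>h\<close> makes the equation change sign before \<open>s = 1/6\<close>, uniformly in \<open>n\<close>. Phases below
  \<open>1/6\<close> keep the frequencies \<open>0, 1, 2\<close> so close to their Neumann values that the lowest eigenvalues of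
  the square are ordered as for \<open>h = 0\<close>.
\<close>

lemma phase_small:
  assumes "0 < h" "h < sin (pi / 12) / 6"
  shows "phase n h < 1 / 6"
proof -
  have s: "0 < sin (pi / 12)" by (intro sin_gt_zero) auto
  have "h * cos (1 / 6 * pi / 2) \<le> h * 1" using assms by (intro mult_left_mono) auto
  also have "\<dots> < (n + 1 / 6) * sin (1 / 6 * pi / 2)"
  proof -
    have "0 \<le> real n * sin (pi/12)" using s by simp
    then have "sin (pi / 12) / 6 \<le> (real n + 1 / 6) * sin (pi / 12)"
      by (simp add: distrib_right)
    then have "h < (real n + 1 / 6) * sin (pi / 12)" using assms by linarith
    then show ?thesis by simp
  qed
  finally obtain t where t: "0 < t" "t < 1 / 6" "(real n + t) * sin (t * pi / 2) = h * cos (t * pi / 2)"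
    using phase_exists[of h "1/6" n] assms by auto
  have "t = phase n h" using t assms phase_equation_tan[of t n h] by (intro phase_unique) auto
  with t show ?thesis by simp
qed

lemma tan_plus_even_half_pi:
  assumes "even n"
  shows "tan (real n * pi / 2 + x) = tan x"
proof -
  obtain k where "n = 2 * k" using assms by blast
  then have "real n * pi / 2 + x = x + real k * pi" by simp
  then show ?thesis by (simp add: tan_def sin_add cos_add)
qed

lemma robin_alpha_eq:
  assumes h: "0 < h" and n: "even n"
  shows "robin_alpha n h = pi * freq n h"
  unfolding robin_alpha_def
proof (rule the_equality)
  have eq: "(pi * (real n + s)) * tan (pi * (real n + s) / 2) = h * pi \<longleftrightarrow> (real n + s) * tan (s * pi / 2) = h" for s
  proof -
    have "pi * (real n + s) / 2 = real n * pi / 2 + s * pi / 2" by (simp add: field_simps)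
    then have t: "tan (pi * (real n + s) / 2) = tan (s * pi / 2)"
      by (simp only: tan_plus_even_half_pi[OF n])
    have "pi * (real n + s) * tan (s * pi / 2) = h * pi \<longleftrightarrow>
        pi * ((real n + s) * tan (s * pi / 2)) = pi * h"
      by (simp only: mult_ac)
    then show ?thesis unfolding t by simp
  qed
  show "real n * pi \<le> pi * freq n h \<and> pi * freq n h < (real n + 1) * pi \<and>
    pi * freq n h * tan (pi * freq n h / 2) = h * pi"
    using phase_props[OF h, of n] unfolding freq_def eq by (simp add: mult.commute[of _ pi])
  fix \<alpha>
  assume \<alpha>: "real n * pi \<le> \<alpha> \<and> \<alpha> < (real n + 1) * pi \<and> \<alpha> * tan (\<alpha> / 2) = h * pi"
  define s where "s = \<alpha> / pi - n"
  have \<alpha>s: "\<alpha> = pi * (real n + s)" by (simp add: s_def)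
  have "0 \<le> s" "s < 1"
    using \<alpha> by (simp_all add: s_def pos_le_divide_eq pos_divide_less_eq diff_less_eq add.commute)
  moreover have "(real n + s) * tan (s * pi / 2) = h" using \<alpha> unfolding \<alpha>s eq by simp
  ultimately show "\<alpha> = pi * freq n h" using phase_unique[OF h] \<alpha>s by (simp add: freq_def)
qed

section \<open>One-dimensional Robin modes and a Poincare inequality\<close>

abbreviation side :: "real set"
  where "side \<equiv> {-(pi/2)..pi/2}"

text \<open>
  The shift by \<open>n \<pi> / 2\<close> turns the cosine into \<open>cos\<close>, \<open>sin\<close>, \<open>-cos\<close> for \<open>n = 0, 1, 2\<close>, so that
  even and odd modes are treated by the same formulas.
\<close>

definition mode :: "nat \<Rightarrow> real \<Rightarrow> real \<Rightarrow> real"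
  where "mode n h x = cos (freq n h * x - n * pi / 2)"

definition dmode :: "nat \<Rightarrow> real \<Rightarrow> real \<Rightarrow> real"
  where "dmode n h x = - freq n h * sin (freq n h * x - n * pi / 2)"

text \<open>
  Functions are accompanied by their derivative as a separate argument, because it is one-sided at the
  end points of the interval.
\<close>

definition C1 :: "(real \<Rightarrow> real) \<Rightarrow> (real \<Rightarrow> real) \<Rightarrow> bool"
  where "C1 f f' \<longleftrightarrow> continuous_on side f' \<and> (\<forall>x\<in>side. (f has_real_derivative f' x) (at x within side))"

definition L2 :: "(real \<Rightarrow> real) \<Rightarrow> (real \<Rightarrow> real) \<Rightarrow> real"
  where "L2 f g = integral side (\<lambda>x. f x * g x)"

text \<open>
  The symmetric form whose Euler-Lagrange equation is the one-dimensional Robin problem; the boundary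
  condition is natural for it and does not restrict the test functions.
\<close>

definition robin_form ::
    "real \<Rightarrow> (real \<Rightarrow> real) \<Rightarrow> (real \<Rightarrow> real) \<Rightarrow> (real \<Rightarrow> real) \<Rightarrow> (real \<Rightarrow> real) \<Rightarrow> real"
  where "robin_form h f f' g g' = L2 f' g' + h * (f (pi/2) * g (pi/2) + f (-(pi/2)) * g (-(pi/2)))"

lemma C1_continuous: "C1 f f' \<Longrightarrow> continuous_on side f"
  unfolding C1_def continuous_on_eq_continuous_within
  by (meson has_field_derivative_def has_derivative_continuous)

lemma C1_continuous_deriv: "C1 f f' \<Longrightarrow> continuous_on side f'"
  by (simp add: C1_def)

lemma mode_has_derivative: "(mode n h has_real_derivative dmode n h x) (at x within S)"
  unfolding mode_def[abs_def] dmode_def by (auto intro!: derivative_eq_intros)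

lemma dmode_has_derivative:
  "(dmode n h has_real_derivative - (freq n h)\<^sup>2 * mode n h x) (at x within S)"
  unfolding mode_def dmode_def[abs_def]
  by (auto intro!: derivative_eq_intros simp: power2_eq_square)

lemma continuous_on_dmode [continuous_intros]: "continuous_on S (dmode n h)"
  using dmode_has_derivative by (meson DERIV_continuous_on)

lemma continuous_on_mode [continuous_intros]: "continuous_on S (mode n h)"
  using mode_has_derivative by (meson DERIV_continuous_on)

lemma C1_mode: "C1 (mode n h) (dmode n h)"
  by (simp add: C1_def mode_has_derivative continuous_on_dmode)

lemma mode_boundary:
  assumes "0 < h"
  shows "dmode n h (pi/2) = - h * mode n h (pi/2)" "dmode n h (-(pi/2)) = h * mode n h (-(pi/2))"
proof -
  have r: "freq n h * (pi/2) - n * pi / 2 = phase n h * pi / 2"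
    by (simp add: freq_def algebra_simps)
  have l: "freq n h * (-(pi/2)) - n * pi / 2 = - (phase n h * pi / 2 + n * pi)"
    by (simp add: freq_def field_simps)
  have eq: "freq n h * sin (phase n h * pi / 2) = h * cos (phase n h * pi / 2)"
    using phase_props(3)[OF assms, of n] by (simp add: freq_def)
  show "dmode n h (pi/2) = - h * mode n h (pi/2)"
    unfolding dmode_def mode_def r using eq by simp
  have "freq n h * (sin (phase n h * pi / 2) * (-1) ^ n) = h * (cos (phase n h * pi / 2) * (-1) ^ n)"
    unfolding mult.assoc[symmetric] eq ..
  then show "dmode n h (-(pi/2)) = h * mode n h (-(pi/2))"
    unfolding dmode_def mode_def l sin_minus cos_minus sin_add cos_add sin_npi cos_npi by simp
qed

lemma freq_bounds: "0 < h \<Longrightarrow> n < freq n h \<and> freq n h < n + 1"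
  using phase_props(1,2)[of h n] by (simp add: freq_def)

lemma freq_mono: "0 < h \<Longrightarrow> m < n \<Longrightarrow> freq m h < freq n h"
  using freq_bounds[of h m] freq_bounds[of h n] by (smt (verit) Suc_leI of_nat_Suc of_nat_le_iff)

lemma L2_commute: "L2 f g = L2 g f"
  by (simp add: L2_def mult.commute)

lemma L2_combination:
  assumes "continuous_on side f" "continuous_on side g" "continuous_on side k"
  shows "L2 (\<lambda>x. f x + a * g x) k = L2 f k + a * L2 g k"
proof -
  have "L2 (\<lambda>x. f x + a * g x) k = integral side (\<lambda>x. f x * k x + a * (g x * k x))"
    unfolding L2_def by (intro integral_cong) (simp add: algebra_simps)
  also have "\<dots> = integral side (\<lambda>x. f x * k x) + integral side (\<lambda>x. a * (g x * k x))"
    using assms by (intro integral_add integrable_continuous_real continuous_intros)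
  finally show ?thesis by (simp add: L2_def)
qed

lemma C1_combination:
  assumes "C1 f f'" "C1 g g'"
  shows "C1 (\<lambda>x. f x + a * g x) (\<lambda>x. f' x + a * g' x)"
  using assms unfolding C1_def by (auto intro!: continuous_intros derivative_eq_intros)

lemma robin_form_combination:
  assumes "C1 f f'" "C1 g g'" "C1 k k'"
  shows "robin_form h (\<lambda>x. f x + a * g x) (\<lambda>x. f' x + a * g' x) k k' =
    robin_form h f f' k k' + a * robin_form h g g' k k'"
  using L2_combination[of f' g' k' a] assms
  by (simp add: robin_form_def C1_continuous_deriv algebra_simps)

lemma robin_form_commute: "robin_form h f f' g g' = robin_form h g g' f f'"
  by (simp add: robin_form_def L2_commute mult.commute)

lemma L2_self_nonneg: "0 \<le> L2 f f"
  unfolding L2_def by (cases "(\<lambda>x. f x * f x) integrable_on side")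
    (auto intro: integral_nonneg simp: not_integrable_integral)

lemma L2_self_eq_0:
  assumes "continuous_on side f" "L2 f f \<le> 0" "x \<in> side"
  shows "f x = 0"
proof -
  have "integral side (\<lambda>x. f x * f x) = 0" using assms(2) L2_self_nonneg[of f] by (simp add: L2_def)
  moreover have "continuous_on side (\<lambda>x. f x * f x)" using assms by (intro continuous_intros)
  ultimately have "f x * f x = 0" using assms(3) integral_eq_0_iff[of "-(pi/2)" "pi/2" "\<lambda>x. f x * f x"] by simp
  then show ?thesis by simp
qed

text \<open>
  Integration by parts: the boundary terms of \<open>\<integral> f' \<phi>'\<close> cancel those of the form because the mode
  satisfies the Robin condition.
\<close>

lemma robin_form_mode:
  assumes "0 < h" "C1 f f'"
  shows "robin_form h f f' (mode n h) (dmode n h) = (freq n h)\<^sup>2 * L2 f (mode n h)"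
proof -
  let ?p = "mode n h" and ?d = "dmode n h" and ?\<mu> = "(freq n h)\<^sup>2"
  have "((\<lambda>x. f' x * ?d x - ?\<mu> * (f x * ?p x)) has_integral f (pi/2) * ?d (pi/2) - f (-(pi/2)) * ?d (-(pi/2))) side"
  proof (rule fundamental_theorem_of_calculus)
    fix x assume x: "x \<in> side"
    have "((\<lambda>x. f x * ?d x) has_real_derivative f' x * ?d x + - ?\<mu> * ?p x * f x) (at x within side)"
      using assms(2) x by (intro DERIV_mult dmode_has_derivative) (auto simp: C1_def)
    then show "((\<lambda>x. f x * ?d x) has_vector_derivative f' x * ?d x - ?\<mu> * (f x * ?p x)) (at x within side)"
      by (simp add: has_real_derivative_iff_has_vector_derivative mult_ac)
  qed simp
  moreover have "((\<lambda>x. f' x * ?d x - ?\<mu> * (f x * ?p x)) has_integral L2 f' ?d - ?\<mu> * L2 f ?p) side"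
    unfolding L2_def using C1_continuous[OF assms(2)] C1_continuous_deriv[OF assms(2)]
    by (intro has_integral_diff has_integral_mult_right integrable_integral integrable_continuous_real
        continuous_intros)
  ultimately have "L2 f' ?d - ?\<mu> * L2 f ?p = f (pi/2) * ?d (pi/2) - f (-(pi/2)) * ?d (-(pi/2))"
    using has_integral_unique by blast
  then show ?thesis by (simp add: robin_form_def mode_boundary[OF assms(1)] algebra_simps)
qed

text \<open>
  The form is symmetric, and the modes are its eigenvectors with distinct eigenvalues.
\<close>

lemma mode_orthogonal:
  assumes "0 < h" "i \<noteq> j"
  shows "L2 (mode i h) (mode j h) = 0"
proof -
  have "(freq i h)\<^sup>2 \<noteq> (freq j h)\<^sup>2"
    using assms freq_mono[of h i j] freq_mono[of h j i] freq_bounds[of h i] freq_bounds[of h j]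
    by (cases i j rule: linorder_cases) (auto simp: power2_eq_iff)
  moreover have "(freq i h)\<^sup>2 * L2 (mode i h) (mode j h) = (freq j h)\<^sup>2 * L2 (mode i h) (mode j h)"
    using robin_form_mode[OF assms(1) C1_mode[of i h], of j] robin_form_mode[OF assms(1) C1_mode[of j h], of i]
      robin_form_commute[of h "mode i h"] L2_commute[of "mode i h"] by simp
  ultimately show ?thesis by simp
qed

lemma mode_right_end_pos:
  assumes "0 < h"
  shows "0 < mode n h (pi/2)"
proof -
  have r: "freq n h * (pi/2) - n * pi / 2 = phase n h * pi / 2"
    by (simp add: freq_def algebra_simps)
  show ?thesis unfolding mode_def r
    using phase_props(1,2)[OF assms, of n] by (intro cos_gt_zero) auto
qed

lemma mode_norm_pos:
  assumes "0 < h"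
  shows "0 < L2 (mode n h) (mode n h)"
  using L2_self_eq_0[of "mode n h" "pi/2"] mode_right_end_pos[OF assms, of n]
  by (force simp: continuous_on_mode not_le[symmetric])

definition add_modes :: "real \<Rightarrow> (real \<Rightarrow> real) \<Rightarrow> (nat \<Rightarrow> real) \<Rightarrow> nat \<Rightarrow> real \<Rightarrow> real"
  where "add_modes h f a n x = f x + (\<Sum>j<n. a j * mode j h x)"

definition add_dmodes :: "real \<Rightarrow> (real \<Rightarrow> real) \<Rightarrow> (nat \<Rightarrow> real) \<Rightarrow> nat \<Rightarrow> real \<Rightarrow> real"
  where "add_dmodes h f a n x = f x + (\<Sum>j<n. a j * dmode j h x)"

lemma add_modes_0: "add_modes h f a 0 = f" "add_dmodes h f a 0 = f"
  by (simp_all add: add_modes_def[abs_def] add_dmodes_def[abs_def])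

lemma add_modes_Suc:
  "add_modes h f a (Suc n) = (\<lambda>x. add_modes h f a n x + a n * mode n h x)"
  "add_dmodes h f a (Suc n) = (\<lambda>x. add_dmodes h f a n x + a n * dmode n h x)"
  by (simp_all add: add_modes_def[abs_def] add_dmodes_def[abs_def] add.assoc)

lemma C1_add_modes:
  assumes "C1 f f'"
  shows "C1 (add_modes h f a n) (add_dmodes h f' a n)"
  by (induction n) (simp_all only: add_modes_0 add_modes_Suc assms C1_combination C1_mode)

lemma L2_add_modes:
  assumes "C1 f f'" "continuous_on side g"
  shows "L2 (add_modes h f a n) g = L2 f g + (\<Sum>j<n. a j * L2 (mode j h) g)"
  by (induction n)
    (simp_all add: add_modes_0 add_modes_Suc L2_combination C1_continuous[OF C1_add_modes[OF assms(1)]]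
      continuous_on_mode assms)

lemma L2_add_modes_mode:
  assumes "0 < h" "C1 f f'" 
  shows "L2 (add_modes h f a n) (mode i h) =
    L2 f (mode i h) + (if i < n then a i * L2 (mode i h) (mode i h) else 0)"
proof -
  have "(\<Sum>j<n. a j * L2 (mode j h) (mode i h)) = (\<Sum>j<n. if j = i then a i * L2 (mode i h) (mode i h) else 0)"
    using mode_orthogonal[OF assms(1)] by (intro sum.cong) auto
  then show ?thesis using L2_add_modes[OF assms(2) continuous_on_mode] by simp
qed

text \<open>
  Picone's identity: \<open>T = k tan (k (x - e))\<close> solves \<open>T' = k\<^sup>2 + T\<^sup>2\<close>, hence
  \<open>v'\<^sup>2 - k\<^sup>2 v\<^sup>2 = (v' + T v)\<^sup>2 - (T v\<^sup>2)'\<close>. The boundary terms disappear where \<open>v\<close> vanishes, and at \<open>e\<close>,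
  where \<open>T\<close> vanishes.
\<close>

lemma picone_inequality:
  fixes a b k e :: real
  assumes "a \<le> b"
    and v: "\<And>x. x \<in> {a..b} \<Longrightarrow> (v has_real_derivative v' x) (at x within {a..b})"
    and cont: "continuous_on {a..b} v'"
    and e: "\<And>x. x \<in> {a..b} \<Longrightarrow> \<bar>k * (x - e)\<bar> < pi / 2"
    and "v a = 0 \<or> a = e" "v b = 0 \<or> b = e"
  shows "0 \<le> integral {a..b} (\<lambda>x. (v' x)\<^sup>2 - k\<^sup>2 * (v x)\<^sup>2)"
proof -
  let ?T = "\<lambda>x. k * tan (k * (x - e))" and ?J = "\<lambda>x. (v' x)\<^sup>2 - k\<^sup>2 * (v x)\<^sup>2"
  have "((\<lambda>x. (v' x + ?T x * v x)\<^sup>2 - ?J x) has_integral ?T b * (v b)\<^sup>2 - ?T a * (v a)\<^sup>2) {a..b}"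
  proof (rule fundamental_theorem_of_calculus)
    fix x assume x: "x \<in> {a..b}"
    have c: "cos (k * (x - e)) \<noteq> 0"
      using e[OF x] by (intro less_imp_neq[symmetric] cos_gt_zero_pi) (auto simp: abs_less_iff)
    have "((\<lambda>x. tan (k * (x - e))) has_real_derivative inverse ((cos (k * (x - e)))\<^sup>2) * k) (at x within {a..b})"
      using c by (auto intro!: derivative_eq_intros)
    also have "inverse ((cos (k * (x - e)))\<^sup>2) = 1 + (tan (k * (x - e)))\<^sup>2"
      using tan_sec[OF c] by (simp add: power_inverse)
    finally have T: "(?T has_real_derivative k * ((1 + (tan (k * (x - e)))\<^sup>2) * k)) (at x within {a..b})"
      by (rule DERIV_cmult)
    have "((\<lambda>x. (v x)\<^sup>2) has_real_derivative 2 * v x * v' x) (at x within {a..b})"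
      using v[OF x] by (auto intro!: derivative_eq_intros)
    from DERIV_mult[OF T this]
    have "((\<lambda>x. ?T x * (v x)\<^sup>2) has_real_derivative
        k * ((1 + (tan (k * (x - e)))\<^sup>2) * k) * (v x)\<^sup>2 + 2 * v x * v' x * ?T x) (at x within {a..b})" .
    moreover have "k * ((1 + (tan (k * (x - e)))\<^sup>2) * k) * (v x)\<^sup>2 + 2 * v x * v' x * ?T x =
        (v' x + ?T x * v x)\<^sup>2 - ?J x"
      by (simp add: power2_eq_square algebra_simps)
    ultimately show "((\<lambda>x. ?T x * (v x)\<^sup>2) has_vector_derivative (v' x + ?T x * v x)\<^sup>2 - ?J x) (at x within {a..b})"
      by (simp add: has_real_derivative_iff_has_vector_derivative)
  qed fact
  moreover have "?T b * (v b)\<^sup>2 - ?T a * (v a)\<^sup>2 = 0" using assms(5,6) by auto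
  ultimately have z: "((\<lambda>x. (v' x + ?T x * v x)\<^sup>2 - ?J x) has_integral 0) {a..b}" by simp
  have "continuous_on {a..b} v" using v by (rule DERIV_continuous_on)
  then have "(?J has_integral integral {a..b} ?J) {a..b}"
    using cont by (intro integrable_integral integrable_continuous_real continuous_intros)
  from has_integral_add[OF z this] have "((\<lambda>x. (v' x + ?T x * v x)\<^sup>2) has_integral integral {a..b} ?J) {a..b}"
    by simp
  then show ?thesis by (rule has_integral_nonneg) simp
qed

text \<open>
  The three zeros cut the interval into pieces on which the previous lemma applies, with \<open>e\<close> the free
  end or the midpoint between two zeros. Every point of a piece is within \<open>\<pi>/6\<close> of its \<open>e\<close>, so any
  \<open>k < 3\<close> is admissible; \<open>k = 5/2\<close> leaves room above the fifth eigenvalue.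
\<close>

lemma poincare_three_zeros:
  assumes v: "C1 v v'" and z: "v (-(pi/3)) = 0" "v 0 = 0" "v (pi/3) = 0"
  shows "25/4 * L2 v v \<le> L2 v' v'"
proof -
  let ?J = "\<lambda>x. (v' x)\<^sup>2 - (5/2)\<^sup>2 * (v x)\<^sup>2"
  have p: "0 < pi" by simp
  have piece: "0 \<le> integral {a..b} ?J"
    if ab: "a \<le> b" "-(pi/2) \<le> a" "b \<le> pi/2" "e - pi/6 \<le> a" "b \<le> e + pi/6"
      "v a = 0 \<or> a = e" "v b = 0 \<or> b = e" for a b e
  proof (rule picone_inequality[of _ _ _ _ _ e])
    have sub: "{a..b} \<subseteq> side" using ab(2,3) by auto
    show "(v has_real_derivative v' x) (at x within {a..b})" if "x \<in> {a..b}" for x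
      using v sub that DERIV_subset[of v "v' x" x side "{a..b}"] by (auto simp: C1_def)
    show "continuous_on {a..b} v'" using v continuous_on_subset[OF _ sub] by (auto simp: C1_def)
    show "\<bar>5/2 * (x - e)\<bar> < pi / 2" if "x \<in> {a..b}" for x
    proof -
      have "\<bar>x - e\<bar> \<le> pi / 6" unfolding abs_le_iff using ab(4,5) that by auto
      then have "5/2 * \<bar>x - e\<bar> \<le> 5/2 * (pi / 6)" by (rule mult_left_mono) simp
      also have "\<dots> < pi / 2" using p by simp
      finally have "5/2 * \<bar>x - e\<bar> < pi / 2" .
      then show ?thesis by (subst abs_mult) simp
    qed
  qed (use ab in auto)
  have cont: "continuous_on side ?J"
    using C1_continuous[OF v] C1_continuous_deriv[OF v] by (intro continuous_intros)
  have int: "?J integrable_on {a..b}" if "-(pi/2) \<le> a" "b \<le> pi/2" for a b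
    using that by (intro integrable_continuous_real continuous_on_subset[OF cont]) auto
  have "0 \<le> integral {-(pi/2)..-(pi/3)} ?J"
    by (rule piece[of _ _ "-(pi/2)"]) ((use z in simp; fail) | (use p in linarith))+
  moreover have "0 \<le> integral {-(pi/3)..0} ?J"
    by (rule piece[of _ _ "-(pi/6)"]) ((use z in simp; fail) | (use p in linarith))+
  moreover have "0 \<le> integral {0..pi/3} ?J"
    by (rule piece[of _ _ "pi/6"]) ((use z in simp; fail) | (use p in linarith))+
  moreover have "0 \<le> integral {pi/3..pi/2} ?J"
    by (rule piece[of _ _ "pi/2"]) ((use z in simp; fail) | (use p in linarith))+
  moreover have "integral {-(pi/2)..-(pi/3)} ?J + integral {-(pi/3)..pi/2} ?J = integral side ?J"
    by (rule Henstock_Kurzweil_Integration.integral_combine) (rule int | (use p in linarith))+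
  moreover have "integral {-(pi/3)..0} ?J + integral {0..pi/2} ?J = integral {-(pi/3)..pi/2} ?J"
    by (rule Henstock_Kurzweil_Integration.integral_combine) (rule int | (use p in linarith))+
  moreover have "integral {0..pi/3} ?J + integral {pi/3..pi/2} ?J = integral {0..pi/2} ?J"
    by (rule Henstock_Kurzweil_Integration.integral_combine) (rule int | (use p in linarith))+
  ultimately have "0 \<le> integral side ?J" by linarith
  also have "integral side ?J = L2 v' v' - (5/2)\<^sup>2 * L2 v v"
    unfolding L2_def power2_eq_square using C1_continuous[OF v] C1_continuous_deriv[OF v]
    by (subst integral_diff) (auto intro!: integrable_continuous_real continuous_intros)
  finally show ?thesis by (simp add: power2_eq_square)
qed

text \<open>
  The three conditions separate by parity: the odd mode corrects the difference of the values at
  \<open>\<plusminus>\<pi>/3\<close>, the two even modes correct their mean and the value at \<open>0\<close>. The resulting linear system is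
  regular because the cosine is injective on \<open>[0, \<pi>]\<close>.
\<close>

lemma add_modes_vanish:
  assumes "0 < h" "freq 2 h < 3"
  obtains a where "add_modes h f a 3 (-(pi/3)) = 0" "add_modes h f a 3 0 = 0" "add_modes h f a 3 (pi/3) = 0"
proof -
  define A B S where "A = cos (freq 0 h * (pi/3))" and "B = cos (freq 2 h * (pi/3))"
    and "S = sin (freq 1 h * (pi/3))"
  have fr: "0 < freq 0 h" "freq 0 h < freq 2 h" "0 < freq 1 h" "freq 1 h < 2"
    using freq_bounds[OF assms(1), of 0] freq_bounds[OF assms(1), of 1] freq_mono[OF assms(1), of 0 2] by auto
  have "freq 2 h * (pi/3) \<le> pi" "freq 1 h * (pi/3) < pi"
    using assms(2) fr by (simp_all add: field_simps)
  then have AB: "A \<noteq> B" and S: "S \<noteq> 0"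
    using fr cos_monotone_0_pi[of "freq 0 h * (pi/3)" "freq 2 h * (pi/3)"]
      sin_gt_zero[of "freq 1 h * (pi/3)"] unfolding A_def B_def S_def by auto
  define M where "M = (f (pi/3) + f (-(pi/3))) / 2"
  define c0 where "c0 = (f 0 * B - M) / (A - B)"
  define c1 where "c1 = - (f (pi/3) - f (-(pi/3))) / (2 * S)"
  define a where "a = (\<lambda>n::nat. if n = 0 then c0 else if n = 1 then c1 else f 0 + c0)"
  have m0: "mode 0 h x = cos (freq 0 h * x)" for x by (simp add: mode_def)
  have m1: "mode 1 h x = sin (freq 1 h * x)" for x
    using cos_sin_eq[of "freq 1 h * x - pi / 2"] by (simp add: mode_def cos_diff)
  have m2: "mode 2 h x = - cos (freq 2 h * x)" for x by (simp add: mode_def cos_diff)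
  have eq: "add_modes h f a 3 x = f x + c0 * cos (freq 0 h * x) + c1 * sin (freq 1 h * x)
      - (f 0 + c0) * cos (freq 2 h * x)" for x
    using m0 m1 m2 by (simp add: add_modes_def eval_nat_numeral a_def)
  have c0: "c0 * (A - B) = f 0 * B - M" using AB by (simp add: c0_def)
  have c1: "c1 * S = - (f (pi/3) - f (-(pi/3))) / 2" using S by (simp add: c1_def)
  show ?thesis
  proof (rule that)
    show "add_modes h f a 3 0 = 0" by (simp add: eq)
    have "f (pi/3) + c0 * A + c1 * S - (f 0 + c0) * B = f (pi/3) + c0 * (A - B) + c1 * S - f 0 * B"
      by (simp add: algebra_simps)
    also have "\<dots> = 0" unfolding c0 c1 by (simp add: M_def field_simps)
    finally show "add_modes h f a 3 (pi/3) = 0" by (simp add: eq A_def B_def S_def)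
    have "f (-(pi/3)) + c0 * A - c1 * S - (f 0 + c0) * B = f (-(pi/3)) + c0 * (A - B) - c1 * S - f 0 * B"
      by (simp add: algebra_simps)
    also have "\<dots> = 0" unfolding c0 c1 by (simp add: M_def field_simps)
    finally show "add_modes h f a 3 (-(pi/3)) = 0" by (simp add: eq A_def B_def S_def)
  qed
qed

text \<open>
  Nonnegativity of this quadratic form is the Poincare inequality with constant \<open>25/4\<close>. Modes of
  frequency below \<open>5/2\<close> are negative directions for it.
\<close>

definition excess :: "real \<Rightarrow> (real \<Rightarrow> real) \<Rightarrow> (real \<Rightarrow> real) \<Rightarrow> real"
  where "excess h f f' = robin_form h f f' f f' - 25/4 * L2 f f"

lemma excess_add_mode:
  assumes "0 < h" "C1 f f'"
  shows "excess h (\<lambda>x. f x + a * mode n h x) (\<lambda>x. f' x + a * dmode n h x) =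
    excess h f f' + ((freq n h)\<^sup>2 - 25/4) * (2 * a * L2 f (mode n h) + a\<^sup>2 * L2 (mode n h) (mode n h))"
proof -
  let ?g = "\<lambda>x. f x + a * mode n h x" and ?g' = "\<lambda>x. f' x + a * dmode n h x"
  have g: "C1 ?g ?g'" using assms(2) C1_mode by (rule C1_combination)
  note cont = C1_continuous[OF g] C1_continuous[OF assms(2)] continuous_on_mode[of side n h]
  have "L2 ?g ?g = L2 f ?g + a * L2 (mode n h) ?g" by (rule L2_combination) (use cont in auto)
  also have "L2 f ?g = L2 f f + a * L2 f (mode n h)"
    using L2_combination[of f "mode n h" f a] cont by (simp add: L2_commute)
  also have "L2 (mode n h) ?g = L2 f (mode n h) + a * L2 (mode n h) (mode n h)"
    using L2_combination[of f "mode n h" "mode n h" a] cont by (simp add: L2_commute)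
  finally have 1: "L2 ?g ?g = L2 f f + a * L2 f (mode n h) + a * (L2 f (mode n h) + a * L2 (mode n h) (mode n h))" .
  have "robin_form h ?g ?g' ?g ?g' = robin_form h f f' ?g ?g' + a * robin_form h (mode n h) (dmode n h) ?g ?g'"
    by (rule robin_form_combination[OF assms(2) C1_mode g])
  also have "robin_form h f f' ?g ?g' = robin_form h ?g ?g' f f'" by (rule robin_form_commute)
  also have "\<dots> = robin_form h f f' f f' + a * robin_form h (mode n h) (dmode n h) f f'"
    by (rule robin_form_combination[OF assms(2) C1_mode assms(2)])
  also have "robin_form h (mode n h) (dmode n h) f f' = (freq n h)\<^sup>2 * L2 f (mode n h)"
    using robin_form_mode[OF assms] robin_form_commute by metis
  also have "robin_form h (mode n h) (dmode n h) ?g ?g' = (freq n h)\<^sup>2 * L2 ?g (mode n h)"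
    using robin_form_mode[OF assms(1) g] robin_form_commute by metis
  also have "L2 ?g (mode n h) = L2 f (mode n h) + a * L2 (mode n h) (mode n h)"
    by (rule L2_combination) (use cont in auto)
  finally show ?thesis unfolding excess_def 1 by (simp add: power2_eq_square algebra_simps)
qed

text \<open>
  A function orthogonal to the modes is also orthogonal to them for the form, so adding modes to it can
  only decrease the excess. Choosing the sum to vanish at three points makes the decreased excess
  nonnegative, hence also the original one.
\<close>

lemma poincare_orthogonal:
  assumes h: "0 < h" and fr: "\<And>i. i < 3 \<Longrightarrow> freq i h < 5/2" and f: "C1 f f'"
    and orth: "\<And>i. i < 3 \<Longrightarrow> L2 f (mode i h) = 0"
  shows "25/4 * L2 f f \<le> robin_form h f f' f f'"
proof -
  have "freq 2 h < 3" using fr[of 2] by simp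
  then obtain a where a: "add_modes h f a 3 (-(pi/3)) = 0" "add_modes h f a 3 0 = 0"
      "add_modes h f a 3 (pi/3) = 0"
    using add_modes_vanish[OF h] by blast
  let ?v = "add_modes h f a" and ?v' = "add_dmodes h f' a"
  have "excess h (?v n) (?v' n) \<le> excess h f f'" if "n \<le> 3" for n
    using that
  proof (induction n)
    case 0
    show ?case by (simp add: add_modes_0)
  next
    case (Suc n)
    have "L2 (?v n) (mode n h) = 0"
      using L2_add_modes_mode[OF h f, of a n n] orth Suc.prems by simp
    then have "excess h (?v (Suc n)) (?v' (Suc n)) =
        excess h (?v n) (?v' n) + ((freq n h)\<^sup>2 - 25/4) * ((a n)\<^sup>2 * L2 (mode n h) (mode n h))"
      unfolding add_modes_Suc using excess_add_mode[OF h C1_add_modes[OF f]] by simp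
    moreover have "(freq n h)\<^sup>2 \<le> (5/2)\<^sup>2"
      using fr[of n] freq_bounds[OF h, of n] Suc.prems by (intro power_mono) auto
    then have "((freq n h)\<^sup>2 - 25/4) * ((a n)\<^sup>2 * L2 (mode n h) (mode n h)) \<le> 0"
      using L2_self_nonneg by (intro mult_nonpos_nonneg) (auto simp: power2_eq_square)
    ultimately show ?case using Suc by simp
  qed
  from this[of 3] have le: "excess h (?v 3) (?v' 3) \<le> excess h f f'" by simp
  have "25/4 * L2 (?v 3) (?v 3) \<le> L2 (?v' 3) (?v' 3)"
    using poincare_three_zeros[OF C1_add_modes[OF f]] a by blast
  moreover have "0 \<le> h * (?v 3 (pi/2) * ?v 3 (pi/2) + ?v 3 (-(pi/2)) * ?v 3 (-(pi/2)))"
    by (rule mult_nonneg_nonneg) (use h in auto)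
  ultimately have "0 \<le> excess h (?v 3) (?v' 3)" by (simp add: excess_def robin_form_def)
  with le show ?thesis by (simp add: excess_def)
qed

definition weak_solution :: "real \<Rightarrow> real \<Rightarrow> (real \<Rightarrow> real) \<Rightarrow> (real \<Rightarrow> real) \<Rightarrow> bool"
  where "weak_solution h \<kappa> f f' \<longleftrightarrow>
    C1 f f' \<and> (\<forall>g g'. C1 g g' \<longrightarrow> robin_form h f f' g g' = \<kappa> * L2 f g)"

lemma weak_solution_add_modes:
  assumes h: "0 < h" and f: "weak_solution h \<kappa> f f'"
    and a: "\<And>j. j < n \<Longrightarrow> a j \<noteq> 0 \<Longrightarrow> (freq j h)\<^sup>2 = \<kappa>"
  shows "weak_solution h \<kappa> (add_modes h f a n) (add_dmodes h f' a n)"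
  using a
proof (induction n)
  case 0
  show ?case using f by (simp add: add_modes_0)
next
  case (Suc n)
  then have w: "weak_solution h \<kappa> (add_modes h f a n) (add_dmodes h f' a n)" by simp
  show ?case unfolding weak_solution_def
  proof (intro conjI allI impI)
    show "C1 (add_modes h f a (Suc n)) (add_dmodes h f' a (Suc n))"
      using C1_add_modes f by (simp add: weak_solution_def)
    fix g g' assume g: "C1 g g'"
    have "robin_form h (mode n h) (dmode n h) g g' = (freq n h)\<^sup>2 * L2 (mode n h) g"
      using robin_form_mode[OF h g] by (simp add: robin_form_commute[of h g] L2_commute[of g])
    then have "a n * robin_form h (mode n h) (dmode n h) g g' = \<kappa> * (a n * L2 (mode n h) g)"
      using Suc.prems[of n] by (cases "a n = 0") auto
    moreover have w1: "C1 (add_modes h f a n) (add_dmodes h f' a n)"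
        "robin_form h (add_modes h f a n) (add_dmodes h f' a n) g g' = \<kappa> * L2 (add_modes h f a n) g"
      using w g by (simp_all add: weak_solution_def)
    ultimately show "robin_form h (add_modes h f a (Suc n)) (add_dmodes h f' a (Suc n)) g g' =
        \<kappa> * L2 (add_modes h f a (Suc n)) g"
      unfolding add_modes_Suc robin_form_combination[OF w1(1) C1_mode g]
        L2_combination[OF C1_continuous[OF w1(1)] continuous_on_mode C1_continuous[OF g]]
      by (simp add: distrib_left)
  qed
qed

text \<open>
  Subtracting its projection onto the modes turns a weak solution into one that is orthogonal to them,
  with energy \<open>\<kappa> \<parallel>\<cdot>\<parallel>\<^sup>2\<close>; by the Poincare inequality it vanishes.
\<close>

lemma weak_solution_modes:
  assumes h: "0 < h" and fr: "\<And>i. i < 3 \<Longrightarrow> freq i h < 5/2"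
    and f: "weak_solution h \<kappa> f f'" and \<kappa>: "\<kappa> < 25/4"
  obtains a where "\<And>x. x \<in> side \<Longrightarrow> f x = (\<Sum>j<3. a j * mode j h x)"
    "\<And>j. j < 3 \<Longrightarrow> a j \<noteq> 0 \<Longrightarrow> (freq j h)\<^sup>2 = \<kappa>"
proof -
  have f1: "C1 f f'" using f by (simp add: weak_solution_def)
  define a where "a j = L2 f (mode j h) / L2 (mode j h) (mode j h)" for j
  have freq: "(freq j h)\<^sup>2 = \<kappa>" if "a j \<noteq> 0" for j
  proof -
    have "(freq j h)\<^sup>2 * L2 f (mode j h) = \<kappa> * L2 f (mode j h)"
      using robin_form_mode[OF h f1, of j] f C1_mode[of j h] unfolding weak_solution_def by metis
    moreover have "L2 f (mode j h) \<noteq> 0" using that by (auto simp: a_def)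
    ultimately show ?thesis by simp
  qed
  let ?w = "add_modes h f (\<lambda>j. - a j) 3" and ?w' = "add_dmodes h f' (\<lambda>j. - a j) 3"
  have w: "weak_solution h \<kappa> ?w ?w'"
    by (rule weak_solution_add_modes[OF h f]) (use freq in auto)
  have w1: "C1 ?w ?w'" using w by (simp add: weak_solution_def)
  have "L2 ?w (mode i h) = 0" if "i < 3" for i
    using that mode_norm_pos[OF h, of i] by (simp add: L2_add_modes_mode[OF h f1] a_def)
  then have "25/4 * L2 ?w ?w \<le> robin_form h ?w ?w' ?w ?w'"
    by (intro poincare_orthogonal[OF h fr w1]) auto
  also have "\<dots> = \<kappa> * L2 ?w ?w" using w w1 by (simp add: weak_solution_def)
  finally have "(25/4 - \<kappa>) * L2 ?w ?w \<le> 0" by (simp add: algebra_simps)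
  then have "L2 ?w ?w \<le> 0" using \<kappa> by (simp add: mult_le_0_iff)
  then have "?w x = 0" if "x \<in> side" for x
    using L2_self_eq_0[OF C1_continuous[OF w1]] that by blast
  then show ?thesis using that[of a] freq by (simp add: add_modes_def sum_negf)
qed

section \<open>Green's identity for classical Robin solutions\<close>

abbreviation square :: "(real \<times> real) set"
  where "square \<equiv> side \<times> side"

lemma closure_Sq: "closure Sq = square"
  unfolding Sq_def by (simp add: closure_Times)

lemma Sq_subset_square: "Sq \<subseteq> square"
  using closure_subset[of Sq] by (simp add: closure_Sq)

definition I2 :: "(real \<times> real \<Rightarrow> real) \<Rightarrow> real"
  where "I2 F = integral side (\<lambda>y. integral side (\<lambda>x. F (x, y)))"

lemma continuous_on_slice:
  assumes "continuous_on square F"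
  shows "y \<in> side \<Longrightarrow> continuous_on side (\<lambda>x. F (x, y))"
    "x \<in> side \<Longrightarrow> continuous_on side (\<lambda>y. F (x, y))"
  by (rule continuous_on_compose2[OF assms]; auto intro!: continuous_intros)+

lemma continuous_on_slice_integral:
  fixes F :: "'a::topological_space \<Rightarrow> real \<times> real \<Rightarrow> real"
  assumes "continuous_on (U \<times> square) (\<lambda>(p, z). F p z)"
  shows "continuous_on (U \<times> side) (\<lambda>(p, y). integral side (\<lambda>x. F p (x, y)))"
proof -
  let ?m = "\<lambda>w. (fst (fst w), (snd w, snd (fst w)))" and ?D = "(U \<times> side) \<times> side"
  have "continuous_on ?D (\<lambda>w. (\<lambda>(p, z). F p z) (?m w))"
    by (rule continuous_on_compose2[OF assms]) (auto intro!: continuous_intros)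
  then have "continuous_on ((U \<times> side) \<times> cbox (-(pi/2)) (pi/2)) (\<lambda>(w, x). F (fst w) (x, snd w))"
    by (simp add: case_prod_unfold)
  from integral_continuous_on_param[of "U \<times> side" "-(pi/2)" "pi/2" "\<lambda>w x. F (fst w) (x, snd w)", OF this]
  show ?thesis by (simp add: case_prod_unfold)
qed

lemma continuous_on_I2_param:
  assumes "continuous_on (U \<times> square) (\<lambda>(p, z). F p z)"
  shows "continuous_on U (\<lambda>p. I2 (F p))"
  using integral_continuous_on_param[of U "-(pi/2)" "pi/2" "\<lambda>p y. integral side (\<lambda>x. F p (x, y))"]
    continuous_on_slice_integral[OF assms] by (simp add: I2_def)

lemma continuous_on_inner_integral:
  fixes F :: "real \<times> real \<Rightarrow> real"
  assumes "continuous_on square F"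
  shows "continuous_on side (\<lambda>y. integral side (\<lambda>x. F (x, y)))"
proof -
  have "continuous_on ({0 :: real} \<times> square) (\<lambda>w. F (snd w))"
    by (rule continuous_on_compose2[OF assms continuous_on_snd[OF continuous_on_id]]) auto
  then have "continuous_on ({0 :: real} \<times> square) (\<lambda>(p, z). F z)"
    by (simp add: case_prod_unfold)
  from continuous_on_slice_integral[OF this]
  have *: "continuous_on ({0 :: real} \<times> side) (\<lambda>z. integral side (\<lambda>x. F (x, snd z)))"
    by (simp add: case_prod_unfold)
  have "continuous_on side (\<lambda>y. integral side (\<lambda>x. F (x, snd (0 :: real, y))))"
    by (rule continuous_on_compose2[OF *]) (auto intro!: continuous_intros)
  then show ?thesis by simp
qed

lemma I2_cong: "(\<And>z. z \<in> square \<Longrightarrow> F z = G z) \<Longrightarrow> I2 F = I2 G"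
  unfolding I2_def by (intro integral_cong) auto

lemma I2_add:
  assumes "continuous_on square F" "continuous_on square G"
  shows "I2 (\<lambda>z. F z + G z) = I2 F + I2 G"
proof -
  have "I2 (\<lambda>z. F z + G z) =
      integral side (\<lambda>y. integral side (\<lambda>x. F (x, y)) + integral side (\<lambda>x. G (x, y)))"
    unfolding I2_def using assms
    by (intro integral_cong integral_add integrable_continuous_real continuous_on_slice) auto
  also have "\<dots> = I2 F + I2 G"
    unfolding I2_def using assms
    by (intro integral_add integrable_continuous_real continuous_on_inner_integral)
  finally show ?thesis .
qed

lemma I2_cmult: "I2 (\<lambda>z. c * F z) = c * I2 F"
  by (simp add: I2_def)

lemma I2_swap:
  assumes "continuous_on square F"
  shows "I2 F = integral side (\<lambda>x. integral side (\<lambda>y. F (x, y)))"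
proof -
  have "continuous_on (cbox (-(pi/2), -(pi/2)) (pi/2, pi/2)) (\<lambda>(x, y). F (x, y))"
    using assms by (simp add: cbox_Pair_eq)
  from integral_swap_continuous[OF this] show ?thesis by (simp add: I2_def)
qed

text \<open>
  The vanishing criterion for a continuous nonnegative function on an interval, applied to the outer and
  then to the inner integral.
\<close>

lemma I2_nonneg_eq_0:
  assumes F: "continuous_on square F" and nonneg: "\<And>z. z \<in> square \<Longrightarrow> 0 \<le> F z"
    and le: "I2 F \<le> 0" and z: "z \<in> square"
  shows "F z = 0"
proof -
  have inner: "0 \<le> integral side (\<lambda>x. F (x, y))" if "y \<in> side" for y
    using that continuous_on_slice(1)[OF F] nonneg
    by (intro integral_nonneg integrable_continuous_real) auto
  have "0 \<le> I2 F"
    unfolding I2_def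
    by (rule integral_nonneg[OF integrable_continuous_real[OF continuous_on_inner_integral[OF F]] inner])
  with le have "integral side (\<lambda>y. integral side (\<lambda>x. F (x, y))) = 0" by (simp add: I2_def)
  moreover have "snd z \<in> side" "fst z \<in> side" using z by (auto simp: mem_Times_iff)
  ultimately have "integral side (\<lambda>x. F (x, snd z)) = 0"
    using integral_eq_0_iff[OF continuous_on_inner_integral[OF F]] inner by simp
  moreover have "0 \<le> F (x, snd z)" if "x \<in> side" for x
    using nonneg that \<open>snd z \<in> side\<close> by simp
  ultimately have "\<forall>x\<in>side. F (x, snd z) = 0"
    using integral_eq_0_iff[OF continuous_on_slice(1)[OF F \<open>snd z \<in> side\<close>]] by simp
  then have "F (fst z, snd z) = 0" using \<open>fst z \<in> side\<close> by blast
  then show ?thesis by simp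
qed

definition C1_square :: "(real \<times> real \<Rightarrow> real) \<Rightarrow> (real \<times> real \<Rightarrow> real \<times> real) \<Rightarrow> bool"
  where "C1_square u g \<longleftrightarrow> continuous_on square g \<and>
    (\<forall>z\<in>square. (u has_derivative (\<lambda>v. g z \<bullet> v)) (at z within square))"

lemma C1_square_continuous:
  assumes "C1_square u g"
  shows "continuous_on square u" "continuous_on square g"
    "continuous_on square (\<lambda>z. fst (g z))" "continuous_on square (\<lambda>z. snd (g z))"
proof -
  show "continuous_on square u"
    using assms unfolding C1_square_def by (intro has_derivative_continuous_on) auto
  show g: "continuous_on square g" using assms by (simp add: C1_square_def)
  show "continuous_on square (\<lambda>z. fst (g z))" "continuous_on square (\<lambda>z. snd (g z))"
    by (intro continuous_on_fst continuous_on_snd g)+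
qed

lemma partial_derivatives:
  assumes "(u has_derivative (\<lambda>v. d \<bullet> v)) (at (x, y) within S \<times> T)"
  shows "y \<in> T \<Longrightarrow> ((\<lambda>x. u (x, y)) has_real_derivative fst d) (at x within S)"
    "x \<in> S \<Longrightarrow> ((\<lambda>y. u (x, y)) has_real_derivative snd d) (at y within T)"
proof -
  assume "y \<in> T"
  have "((\<lambda>x. (x, y)) has_derivative (\<lambda>v. (v, 0))) (at x within S)"
    by (auto intro!: derivative_eq_intros)
  moreover have "(u has_derivative (\<lambda>v. d \<bullet> v)) (at (x, y) within (\<lambda>x. (x, y)) ` S)"
    by (rule has_derivative_subset[OF assms]) (use \<open>y \<in> T\<close> in auto)
  ultimately have "((\<lambda>x. u (x, y)) has_derivative (\<lambda>v. d \<bullet> (v, 0))) (at x within S)"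
    by (rule has_derivative_in_compose)
  then show "((\<lambda>x. u (x, y)) has_real_derivative fst d) (at x within S)"
    by (simp add: has_field_derivative_def inner_prod_def)
next
  assume "x \<in> S"
  have "((\<lambda>y. (x, y)) has_derivative (\<lambda>v. (0, v))) (at y within T)"
    by (auto intro!: derivative_eq_intros)
  moreover have "(u has_derivative (\<lambda>v. d \<bullet> v)) (at (x, y) within (\<lambda>y. (x, y)) ` T)"
    by (rule has_derivative_subset[OF assms]) (use \<open>x \<in> S\<close> in auto)
  ultimately have "((\<lambda>y. u (x, y)) has_derivative (\<lambda>v. d \<bullet> (0, v))) (at y within T)"
    by (rule has_derivative_in_compose)
  then show "((\<lambda>y. u (x, y)) has_real_derivative snd d) (at y within T)"
    by (simp add: has_field_derivative_def inner_prod_def)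
qed

lemma C1_square_slices:
  assumes "C1_square u g"
  shows "y \<in> side \<Longrightarrow> C1 (\<lambda>x. u (x, y)) (\<lambda>x. fst (g (x, y)))"
    "x \<in> side \<Longrightarrow> C1 (\<lambda>y. u (x, y)) (\<lambda>y. snd (g (x, y)))"
  using assms partial_derivatives[of u] continuous_on_slice C1_square_continuous(3,4)[OF assms]
  unfolding C1_def C1_square_def by blast+

lemma C1_square_product:
  assumes f: "C1 f f'" and g: "C1 g g'"
  shows "C1_square (\<lambda>z. f (fst z) * g (snd z)) (\<lambda>z. (f' (fst z) * g (snd z), f (fst z) * g' (snd z)))"
proof -
  have der: "((\<lambda>z. f (fst z) * g (snd z)) has_derivative
      (\<lambda>v. (f' (fst z) * g (snd z), f (fst z) * g' (snd z)) \<bullet> v)) (at z within square)"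
    if z: "z \<in> square" for z
  proof -
    have "(f has_derivative (\<lambda>v. f' (fst z) * v)) (at (fst z) within fst ` square)"
      "(g has_derivative (\<lambda>v. g' (snd z) * v)) (at (snd z) within snd ` square)"
      using f g z by (auto simp: C1_def has_field_derivative_def)
    then have "((\<lambda>z. f (fst z)) has_derivative (\<lambda>v. f' (fst z) * fst v)) (at z within square)"
      "((\<lambda>z. g (snd z)) has_derivative (\<lambda>v. g' (snd z) * snd v)) (at z within square)"
      by (auto intro: has_derivative_in_compose[OF has_derivative_fst[OF has_derivative_ident]]
          has_derivative_in_compose[OF has_derivative_snd[OF has_derivative_ident]])
    from has_derivative_mult[OF this] show ?thesis
      by (rule has_derivative_eq_rhs) (auto simp: inner_prod_def algebra_simps)
  qed
  have "continuous_on square (\<lambda>z. k (fst z))" "continuous_on square (\<lambda>z. k (snd z))"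
    if "continuous_on side k" for k :: "real \<Rightarrow> real"
    by (rule continuous_on_compose2[OF that]; auto intro!: continuous_intros)+
  then show ?thesis
    unfolding C1_square_def using der C1_continuous[OF f] C1_continuous[OF g]
      C1_continuous_deriv[OF f] C1_continuous_deriv[OF g]
    by (auto intro!: continuous_intros)
qed

definition boundary_form :: "(real \<times> real \<Rightarrow> real) \<Rightarrow> real"
  where "boundary_form F =
    integral side (\<lambda>y. F (pi/2, y) + F (-(pi/2), y)) + integral side (\<lambda>x. F (x, pi/2) + F (x, -(pi/2)))"

lemma dilation_in_Sq:
  assumes z: "z \<in> square" and \<rho>: "0 \<le> \<rho>" "\<rho> < 1"
  shows "\<rho> *\<^sub>R z \<in> Sq"
proof -
  have "\<bar>\<rho> * t\<bar> < pi / 2" if "t \<in> side" for t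
  proof -
    have "\<bar>\<rho> * t\<bar> \<le> \<rho> * (pi / 2)" 
      unfolding abs_mult using that \<rho> by (intro mult_mono) auto
    also have "\<dots> < 1 * (pi / 2)" using \<rho> by (intro mult_strict_right_mono) auto
    finally show ?thesis by simp
  qed
  then have "\<bar>\<rho> * fst z\<bar> < pi / 2" "\<bar>\<rho> * snd z\<bar> < pi / 2" using z by (auto simp: mem_Times_iff)
  then show ?thesis by (auto simp: Sq_def mem_Times_iff abs_less_iff)
qed

text \<open>
  A classical solution has second derivatives in the open square only, and they may be unbounded near
  its boundary. The dilated gradient \<open>z \<mapsto> g (\<rho> z)\<close> with \<open>\<rho> < 1\<close> is continuously differentiable on the
  closed square, where integration by parts in each variable is legitimate.
\<close>

lemma divergence_dilated:
  assumes g: "continuous_on square g" "\<And>z. z \<in> Sq \<Longrightarrow> (g has_derivative blinfun_apply (H z)) (at z)"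
    and H: "continuous_on Sq H"
    and \<psi>: "C1_square \<psi> \<gamma>" and \<rho>: "0 < \<rho>" "\<rho> < 1"
  shows "I2 (\<lambda>z. g (\<rho> *\<^sub>R z) \<bullet> \<gamma> z + \<rho> * (\<Sum>b\<in>Basis. blinfun_apply (H (\<rho> *\<^sub>R z)) b \<bullet> b) * \<psi> z) =
    integral side (\<lambda>y. fst (g (\<rho> * (pi/2), \<rho> * y)) * \<psi> (pi/2, y)
      - fst (g (\<rho> * (-(pi/2)), \<rho> * y)) * \<psi> (-(pi/2), y)) +
    integral side (\<lambda>x. snd (g (\<rho> * x, \<rho> * (pi/2))) * \<psi> (x, pi/2)
      - snd (g (\<rho> * x, \<rho> * (-(pi/2)))) * \<psi> (x, -(pi/2)))"
proof -
  have \<rho>S: "\<rho> *\<^sub>R z \<in> Sq" if "z \<in> square" for z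
    using dilation_in_Sq[OF that] \<rho> by simp
  have sc: "continuous_on square (\<lambda>z. \<rho> *\<^sub>R z)" by (intro continuous_intros)
  have cg: "continuous_on square (\<lambda>z. g (\<rho> *\<^sub>R z))"
    by (rule continuous_on_compose2[OF g(1) sc]) (use \<rho>S Sq_subset_square in blast)
  have cH: "continuous_on square (\<lambda>z. H (\<rho> *\<^sub>R z))"
    by (rule continuous_on_compose2[OF H sc]) (use \<rho>S in blast)
  note c\<psi> = C1_square_continuous[OF \<psi>]
  define P where "P z = \<rho> * fst (blinfun_apply (H (\<rho> *\<^sub>R z)) (1, 0)) * \<psi> z + fst (g (\<rho> *\<^sub>R z)) * fst (\<gamma> z)" for z
  define Q where "Q z = \<rho> * snd (blinfun_apply (H (\<rho> *\<^sub>R z)) (0, 1)) * \<psi> z + snd (g (\<rho> *\<^sub>R z)) * snd (\<gamma> z)" for z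
  have cP: "continuous_on square P" and cQ: "continuous_on square Q"
    unfolding P_def Q_def by (intro continuous_intros cg cH c\<psi>)+
  have gder: "((\<lambda>z. g (\<rho> *\<^sub>R z)) has_derivative (\<lambda>v. blinfun_apply (H (\<rho> *\<^sub>R z)) (\<rho> *\<^sub>R v))) (at z within T)"
    if "z \<in> square" for z T
    by (rule has_derivative_compose[OF bounded_linear_imp_has_derivative[OF bounded_linear_scaleR_right]
          g(2)[OF \<rho>S[OF that]]])
  have fstD: "((\<lambda>x. fst (g (\<rho> * x, \<rho> * y))) has_real_derivative
      \<rho> * fst (blinfun_apply (H (\<rho> * x, \<rho> * y)) (1, 0))) (at x within side)"
    and sndD: "((\<lambda>y. snd (g (\<rho> * x, \<rho> * y))) has_real_derivative
      \<rho> * snd (blinfun_apply (H (\<rho> * x, \<rho> * y)) (0, 1))) (at y within side)"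
    if "x \<in> side" "y \<in> side" for x y
  proof -
    have "((\<lambda>x. (x, y)) has_derivative (\<lambda>v. (v, 0))) (at x within side)"
      "((\<lambda>y. (x, y)) has_derivative (\<lambda>v. (0, v))) (at y within side)"
      by (auto intro!: derivative_eq_intros)
    note * = has_derivative_in_compose[OF this(1) gder] has_derivative_in_compose[OF this(2) gder]
    have lin: "blinfun_apply (H (\<rho> * x, \<rho> * y)) (\<rho> * v, 0) = (\<rho> * v) *\<^sub>R blinfun_apply (H (\<rho> * x, \<rho> * y)) (1, 0)"
      "blinfun_apply (H (\<rho> * x, \<rho> * y)) (0, \<rho> * v) = (\<rho> * v) *\<^sub>R blinfun_apply (H (\<rho> * x, \<rho> * y)) (0, 1)" for v
      by (simp_all add: blinfun.scaleR_right[symmetric])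
    have 1: "((\<lambda>x. g (\<rho> * x, \<rho> * y)) has_derivative
        (\<lambda>v. (\<rho> * v) *\<^sub>R blinfun_apply (H (\<rho> * x, \<rho> * y)) (1, 0))) (at x within side)"
      using *(1) that by (simp add: lin)
    have 2: "((\<lambda>y. g (\<rho> * x, \<rho> * y)) has_derivative
        (\<lambda>v. (\<rho> * v) *\<^sub>R blinfun_apply (H (\<rho> * x, \<rho> * y)) (0, 1))) (at y within side)"
      using *(2) that by (simp add: lin)
    show "((\<lambda>x. fst (g (\<rho> * x, \<rho> * y))) has_real_derivative
        \<rho> * fst (blinfun_apply (H (\<rho> * x, \<rho> * y)) (1, 0))) (at x within side)"
      unfolding has_field_derivative_def
      by (rule has_derivative_eq_rhs[OF has_derivative_fst[OF 1]]) (simp add: fun_eq_iff)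
    show "((\<lambda>y. snd (g (\<rho> * x, \<rho> * y))) has_real_derivative
        \<rho> * snd (blinfun_apply (H (\<rho> * x, \<rho> * y)) (0, 1))) (at y within side)"
      unfolding has_field_derivative_def
      by (rule has_derivative_eq_rhs[OF has_derivative_snd[OF 2]]) (simp add: fun_eq_iff)
  qed
  have Pint: "integral side (\<lambda>x. P (x, y)) = fst (g (\<rho> * (pi/2), \<rho> * y)) * \<psi> (pi/2, y)
      - fst (g (\<rho> * (-(pi/2)), \<rho> * y)) * \<psi> (-(pi/2), y)" if y: "y \<in> side" for y
  proof (intro integral_unique fundamental_theorem_of_calculus)
    fix x assume x: "x \<in> side"
    have "((\<lambda>x. \<psi> (x, y)) has_real_derivative fst (\<gamma> (x, y))) (at x within side)"
      using C1_square_slices(1)[OF \<psi> y] x by (simp add: C1_def)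
    from DERIV_mult[OF fstD[OF x y] this]
    show "((\<lambda>x. fst (g (\<rho> * x, \<rho> * y)) * \<psi> (x, y)) has_vector_derivative P (x, y)) (at x within side)"
      by (simp add: has_real_derivative_iff_has_vector_derivative P_def mult_ac)
  qed simp
  have Qint: "integral side (\<lambda>y. Q (x, y)) = snd (g (\<rho> * x, \<rho> * (pi/2))) * \<psi> (x, pi/2)
      - snd (g (\<rho> * x, \<rho> * (-(pi/2)))) * \<psi> (x, -(pi/2))" if x: "x \<in> side" for x
  proof (intro integral_unique fundamental_theorem_of_calculus)
    fix y assume y: "y \<in> side"
    have "((\<lambda>y. \<psi> (x, y)) has_real_derivative snd (\<gamma> (x, y))) (at y within side)"
      using C1_square_slices(2)[OF \<psi> x] y by (simp add: C1_def)
    from DERIV_mult[OF sndD[OF x y] this]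
    show "((\<lambda>y. snd (g (\<rho> * x, \<rho> * y)) * \<psi> (x, y)) has_vector_derivative Q (x, y)) (at y within side)"
      by (simp add: has_real_derivative_iff_has_vector_derivative Q_def mult_ac)
  qed simp
  have "I2 (\<lambda>z. g (\<rho> *\<^sub>R z) \<bullet> \<gamma> z + \<rho> * (\<Sum>b\<in>Basis. blinfun_apply (H (\<rho> *\<^sub>R z)) b \<bullet> b) * \<psi> z) =
      I2 (\<lambda>z. P z + Q z)"
  proof (rule I2_cong)
    fix z
    have "(\<Sum>b\<in>Basis. blinfun_apply (H (\<rho> *\<^sub>R z)) b \<bullet> b) =
        fst (blinfun_apply (H (\<rho> *\<^sub>R z)) (1, 0)) + snd (blinfun_apply (H (\<rho> *\<^sub>R z)) (0, 1))"
      by (simp add: Basis_prod_def inner_prod_def)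
    then show "g (\<rho> *\<^sub>R z) \<bullet> \<gamma> z + \<rho> * (\<Sum>b\<in>Basis. blinfun_apply (H (\<rho> *\<^sub>R z)) b \<bullet> b) * \<psi> z = P z + Q z"
      by (simp add: P_def Q_def inner_prod_def algebra_simps)
  qed
  also have "\<dots> = I2 P + I2 Q" by (rule I2_add[OF cP cQ])
  also have "I2 Q = integral side (\<lambda>x. integral side (\<lambda>y. Q (x, y)))" by (rule I2_swap[OF cQ])
  also have "I2 P = integral side (\<lambda>y. fst (g (\<rho> * (pi/2), \<rho> * y)) * \<psi> (pi/2, y)
      - fst (g (\<rho> * (-(pi/2)), \<rho> * y)) * \<psi> (-(pi/2), y))"
    unfolding I2_def by (rule integral_cong) (rule Pint)
  also have "integral side (\<lambda>x. integral side (\<lambda>y. Q (x, y))) =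
      integral side (\<lambda>x. snd (g (\<rho> * x, \<rho> * (pi/2))) * \<psi> (x, pi/2)
        - snd (g (\<rho> * x, \<rho> * (-(pi/2)))) * \<psi> (x, -(pi/2)))"
    by (rule integral_cong) (rule Qint)
  finally show ?thesis .
qed

text \<open>
  Green's identity holds for the dilated solution, and both of its sides depend only on \<open>u\<close> and its
  gradient, which are continuous up to the boundary. They are therefore continuous in \<open>\<rho> \<in> [0, 1]\<close>,
  and the identity extends to \<open>\<rho> = 1\<close>.
\<close>

lemma robin_solution_weak:
  assumes "robin_solution h lam u"
  obtains g where "C1_square u g"
    "\<And>\<psi> \<gamma>. C1_square \<psi> \<gamma> \<Longrightarrow>
      I2 (\<lambda>z. g z \<bullet> \<gamma> z) + h * boundary_form (\<lambda>z. u z * \<psi> z) = lam * I2 (\<lambda>z. u z * \<psi> z)"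
proof -
  obtain g H where g: "continuous_on square g"
      "\<And>z. z \<in> square \<Longrightarrow> (u has_derivative (\<lambda>v. g z \<bullet> v)) (at z within square)"
    and H: "continuous_on Sq H" "\<And>z. z \<in> Sq \<Longrightarrow> (g has_derivative blinfun_apply (H z)) (at z)"
    and lap: "\<And>z. z \<in> Sq \<Longrightarrow> - (\<Sum>b\<in>Basis. blinfun_apply (H z) b \<bullet> b) = lam * u z"
    and bc: "\<And>z \<nu>. Sq_normal z \<nu> \<Longrightarrow> g z \<bullet> \<nu> + h * u z = 0"
    using assms unfolding robin_solution_def closure_Sq by blast
  have u: "C1_square u g" using g by (simp add: C1_square_def)
  note cu = C1_square_continuous[OF u]
  have cl: "closure {-(pi/2)<..<pi/2} = side" by simp
  have ends: "pi/2 \<in> side" "-(pi/2) \<in> side" by auto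
  \<comment> \<open>The boundary condition is given on the open sides; continuity extends it to the corners.\<close>
  have vertical: "fst (g (pi/2, y)) + h * u (pi/2, y) = 0 \<and> - fst (g (-(pi/2), y)) + h * u (-(pi/2), y) = 0"
    if "y \<in> side" for y
  proof (intro conjI)
    have c: "continuous_on side (\<lambda>y. fst (g (e, y)) + h * u (e, y))"
      "continuous_on side (\<lambda>y. - fst (g (e, y)) + h * u (e, y))" if "e \<in> side" for e
      using that cu(1,3) by (auto intro!: continuous_intros continuous_on_slice(2))
    show "fst (g (pi/2, y)) + h * u (pi/2, y) = 0"
      by (rule continuous_constant_on_closure[of "{-(pi/2)<..<pi/2}", unfolded cl, OF c(1)[OF ends(1)] _ that])
        (use bc[of _ "(1, 0)"] in \<open>auto simp: Sq_normal_def inner_prod_def\<close>)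
    show "- fst (g (-(pi/2), y)) + h * u (-(pi/2), y) = 0"
      by (rule continuous_constant_on_closure[of "{-(pi/2)<..<pi/2}", unfolded cl, OF c(2)[OF ends(2)] _ that])
        (use bc[of _ "(-1, 0)"] in \<open>auto simp: Sq_normal_def inner_prod_def\<close>)
  qed
  have horizontal: "snd (g (x, pi/2)) + h * u (x, pi/2) = 0 \<and> - snd (g (x, -(pi/2))) + h * u (x, -(pi/2)) = 0"
    if "x \<in> side" for x
  proof (intro conjI)
    have c: "continuous_on side (\<lambda>x. snd (g (x, e)) + h * u (x, e))"
      "continuous_on side (\<lambda>x. - snd (g (x, e)) + h * u (x, e))" if "e \<in> side" for e
      using that cu(1,4) by (auto intro!: continuous_intros continuous_on_slice(1))
    show "snd (g (x, pi/2)) + h * u (x, pi/2) = 0"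
      by (rule continuous_constant_on_closure[of "{-(pi/2)<..<pi/2}", unfolded cl, OF c(1)[OF ends(1)] _ that])
        (use bc[of _ "(0, 1)"] in \<open>auto simp: Sq_normal_def inner_prod_def\<close>)
    show "- snd (g (x, -(pi/2))) + h * u (x, -(pi/2)) = 0"
      by (rule continuous_constant_on_closure[of "{-(pi/2)<..<pi/2}", unfolded cl, OF c(2)[OF ends(2)] _ that])
        (use bc[of _ "(0, -1)"] in \<open>auto simp: Sq_normal_def inner_prod_def\<close>)
  qed
  have "I2 (\<lambda>z. g z \<bullet> \<gamma> z) + h * boundary_form (\<lambda>z. u z * \<psi> z) = lam * I2 (\<lambda>z. u z * \<psi> z)"
    if \<psi>: "C1_square \<psi> \<gamma>" for \<psi> \<gamma>
  proof -
    note c\<psi> = C1_square_continuous[OF \<psi>]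
    define V where "V \<rho> = I2 (\<lambda>z. g (\<rho> *\<^sub>R z) \<bullet> \<gamma> z - \<rho> * lam * u (\<rho> *\<^sub>R z) * \<psi> z)" for \<rho>
    define B where "B \<rho> =
      integral side (\<lambda>y. fst (g (\<rho> * (pi/2), \<rho> * y)) * \<psi> (pi/2, y)
        - fst (g (\<rho> * (-(pi/2)), \<rho> * y)) * \<psi> (-(pi/2), y)) +
      integral side (\<lambda>x. snd (g (\<rho> * x, \<rho> * (pi/2))) * \<psi> (x, pi/2)
        - snd (g (\<rho> * x, \<rho> * (-(pi/2)))) * \<psi> (x, -(pi/2)))" for \<rho>
    have scale: "\<rho> * t \<in> side" if "\<rho> \<in> {0..1}" "t \<in> side" for \<rho> t :: real
    proof -
      have "\<bar>\<rho> * t\<bar> \<le> 1 * (pi / 2)" unfolding abs_mult using that by (intro mult_mono) auto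
      then show ?thesis by (auto simp: abs_le_iff)
    qed
    have eq: "V \<rho> - B \<rho> = 0" if \<rho>: "\<rho> \<in> {0<..<1}" for \<rho>
    proof -
      have "V \<rho> = I2 (\<lambda>z. g (\<rho> *\<^sub>R z) \<bullet> \<gamma> z + \<rho> * (\<Sum>b\<in>Basis. blinfun_apply (H (\<rho> *\<^sub>R z)) b \<bullet> b) * \<psi> z)"
        unfolding V_def
      proof (rule I2_cong)
        fix z assume z: "z \<in> square"
        have "\<rho> *\<^sub>R z \<in> Sq" using dilation_in_Sq[OF z] \<rho> by simp
        from lap[OF this] have "(\<Sum>b\<in>Basis. blinfun_apply (H (\<rho> *\<^sub>R z)) b \<bullet> b) = - (lam * u (\<rho> *\<^sub>R z))"
          by linarith
        then show "g (\<rho> *\<^sub>R z) \<bullet> \<gamma> z - \<rho> * lam * u (\<rho> *\<^sub>R z) * \<psi> z =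
            g (\<rho> *\<^sub>R z) \<bullet> \<gamma> z + \<rho> * (\<Sum>b\<in>Basis. blinfun_apply (H (\<rho> *\<^sub>R z)) b \<bullet> b) * \<psi> z"
          by simp
      qed
      also have "\<dots> = B \<rho>"
        unfolding B_def by (rule divergence_dilated[OF g(1) H(2) H(1) \<psi>]) (use \<rho> in auto)
      finally show ?thesis by simp
    qed
    have cV: "continuous_on {0..1} V"
      unfolding V_def
    proof (rule continuous_on_I2_param)
      have s: "continuous_on ({0..1} \<times> square) (\<lambda>p. fst p *\<^sub>R snd p)" by (intro continuous_intros)
      have sub: "(\<lambda>p. fst p *\<^sub>R snd p) ` ({0..1} \<times> square) \<subseteq> square"
      proof
        fix w assume "w \<in> (\<lambda>p. fst p *\<^sub>R snd p) ` ({0..1} \<times> square)"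
        then obtain \<rho> x y where "\<rho> \<in> {0..1::real}" "x \<in> side" "y \<in> side" "w = \<rho> *\<^sub>R (x, y)" by auto
        then show "w \<in> square" using scale[of \<rho> x] scale[of \<rho> y] by simp
      qed
      have cs: "continuous_on ({0..1} \<times> square) (\<lambda>p. snd p)" by (intro continuous_intros)
      have css: "snd ` ({0..1::real} \<times> square) \<subseteq> square" by auto
      show "continuous_on ({0..1} \<times> square)
          (\<lambda>(\<rho>, z). g (\<rho> *\<^sub>R z) \<bullet> \<gamma> z - \<rho> * lam * u (\<rho> *\<^sub>R z) * \<psi> z)"
        unfolding case_prod_unfold
        by (intro continuous_on_diff continuous_on_inner continuous_on_mult continuous_on_const
          continuous_on_fst continuous_on_id
          continuous_on_compose2[OF cu(2) s sub] continuous_on_compose2[OF cu(1) s sub]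
          continuous_on_compose2[OF c\<psi>(1) cs css] continuous_on_compose2[OF c\<psi>(2) cs css])
    qed
    have edge: "continuous_on {0..1} (\<lambda>\<rho>. integral side (F \<rho>))"
      if "continuous_on ({0..1} \<times> side) (\<lambda>p. F (fst p) (snd p))" for F :: "real \<Rightarrow> real \<Rightarrow> real"
      using integral_continuous_on_param[of "{0..1}" "-(pi/2)" "pi/2" F] that by (simp add: case_prod_unfold)
    have side1: "continuous_on ({0..1} \<times> side) (\<lambda>p. k (fst p * e, fst p * snd p) * \<psi> (e, snd p))"
      and side2: "continuous_on ({0..1} \<times> side) (\<lambda>p. k (fst p * snd p, fst p * e) * \<psi> (snd p, e))"
      if k: "continuous_on square k" and e: "e \<in> side" for k :: "real \<times> real \<Rightarrow> real" and e
      by (intro continuous_on_mult continuous_on_compose2[OF k] continuous_on_compose2[OF c\<psi>(1)];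
          auto intro!: continuous_intros scale e simp del: atLeastAtMost_iff)+
    have cB: "continuous_on {0..1} B"
      unfolding B_def
      by (intro continuous_on_add edge continuous_on_diff side1[OF cu(3)] side2[OF cu(4)] ends)
    have "closure {0<..<1::real} = {0..1}" by simp
    then have "V 1 - B 1 = 0"
      using continuous_constant_on_closure[of "{0<..<1}" "\<lambda>\<rho>. V \<rho> - B \<rho>" 0 1] eq
        continuous_on_diff[OF cV cB] by simp
    moreover have "V 1 = I2 (\<lambda>z. g z \<bullet> \<gamma> z) + (- lam) * I2 (\<lambda>z. u z * \<psi> z)"
    proof -
      have "V 1 = I2 (\<lambda>z. g z \<bullet> \<gamma> z + (- lam) * (u z * \<psi> z))"
        unfolding V_def by (rule I2_cong) simp
      also have "\<dots> = I2 (\<lambda>z. g z \<bullet> \<gamma> z) + I2 (\<lambda>z. (- lam) * (u z * \<psi> z))"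
        by (intro I2_add continuous_intros cu c\<psi>)
      finally show ?thesis by (simp only: I2_cmult)
    qed
    moreover have "B 1 = - h * boundary_form (\<lambda>z. u z * \<psi> z)"
    proof -
      have "integral side (\<lambda>y. fst (g (pi/2, y)) * \<psi> (pi/2, y) - fst (g (-(pi/2), y)) * \<psi> (-(pi/2), y)) =
          integral side (\<lambda>y. - h * (u (pi/2, y) * \<psi> (pi/2, y) + u (-(pi/2), y) * \<psi> (-(pi/2), y)))"
      proof (rule integral_cong)
        fix y assume "y \<in> side"
        from vertical[OF this] have "fst (g (pi/2, y)) = - h * u (pi/2, y)" "fst (g (-(pi/2), y)) = h * u (-(pi/2), y)"
          by linarith+
        then show "fst (g (pi/2, y)) * \<psi> (pi/2, y) - fst (g (-(pi/2), y)) * \<psi> (-(pi/2), y) =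
            - h * (u (pi/2, y) * \<psi> (pi/2, y) + u (-(pi/2), y) * \<psi> (-(pi/2), y))"
          by (simp only: algebra_simps)
      qed
      moreover have "integral side (\<lambda>x. snd (g (x, pi/2)) * \<psi> (x, pi/2) - snd (g (x, -(pi/2))) * \<psi> (x, -(pi/2))) =
          integral side (\<lambda>x. - h * (u (x, pi/2) * \<psi> (x, pi/2) + u (x, -(pi/2)) * \<psi> (x, -(pi/2))))"
      proof (rule integral_cong)
        fix x assume "x \<in> side"
        from horizontal[OF this] have "snd (g (x, pi/2)) = - h * u (x, pi/2)" "snd (g (x, -(pi/2))) = h * u (x, -(pi/2))"
          by linarith+
        then show "snd (g (x, pi/2)) * \<psi> (x, pi/2) - snd (g (x, -(pi/2))) * \<psi> (x, -(pi/2)) =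
            - h * (u (x, pi/2) * \<psi> (x, pi/2) + u (x, -(pi/2)) * \<psi> (x, -(pi/2)))"
          by (simp only: algebra_simps)
      qed
      ultimately show ?thesis
        unfolding B_def boundary_form_def by (simp only: mult_1_left integral_mult_right) (simp only: distrib_left)
    qed
    ultimately show ?thesis by linarith
  qed
  with u show ?thesis by (rule that)
qed

section \<open>Expansion of low eigenfunctions in products of modes\<close>

lemma mode_coefficient_C1:
  assumes u: "C1_square u g"
  shows "C1 (\<lambda>y. L2 (\<lambda>x. u (x, y)) (mode i h)) (\<lambda>y. L2 (\<lambda>x. snd (g (x, y))) (mode i h))"
proof -
  note cu = C1_square_continuous[OF u]
  have cm: "continuous_on square (\<lambda>z. mode i h (fst z))"
    by (rule continuous_on_compose2[OF continuous_on_mode[of UNIV] continuous_on_fst[OF continuous_on_id]]) simp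
  have cf: "continuous_on square (\<lambda>z. snd (g z) * mode i h (fst z))"
    by (intro continuous_on_mult cu cm)
  have "((\<lambda>y. integral (cbox (-(pi/2)) (pi/2)) (\<lambda>x. u (x, y) * mode i h x)) has_real_derivative
      integral (cbox (-(pi/2)) (pi/2)) (\<lambda>x. snd (g (x, y)) * mode i h x)) (at y within side)"
    if y: "y \<in> side" for y
  proof (rule leibniz_rule_field_derivative)
    fix y x assume yx: "y \<in> side" "x \<in> cbox (-(pi/2)) (pi/2)"
    then have "((\<lambda>y. u (x, y)) has_real_derivative snd (g (x, y))) (at y within side)"
      using C1_square_slices(2)[OF u, of x] by (simp add: C1_def)
    then show "((\<lambda>y. u (x, y) * mode i h x) has_real_derivative snd (g (x, y)) * mode i h x) (at y within side)"
      by (rule DERIV_cmult_right)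
  next
    fix y assume "y \<in> side"
    then show "(\<lambda>x. u (x, y) * mode i h x) integrable_on cbox (-(pi/2)) (pi/2)"
      using continuous_on_slice(1)[OF cu(1)]
      by (auto intro!: integrable_continuous_real continuous_intros)
  next
    have "continuous_on (side \<times> side) (\<lambda>w. snd (g (snd w, fst w)) * mode i h (fst (snd w, fst w)))"
      by (rule continuous_on_compose2[OF cf]) (auto intro!: continuous_intros)
    then show "continuous_on (side \<times> cbox (-(pi/2)) (pi/2)) (\<lambda>(y, x). snd (g (x, y)) * mode i h x)"
      by (simp add: case_prod_unfold)
  qed (use y in auto)
  moreover have "continuous_on side (\<lambda>y. integral side (\<lambda>x. snd (g (x, y)) * mode i h x))"
    using continuous_on_inner_integral[OF cf] by simp
  ultimately show ?thesis by (simp add: C1_def L2_def)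
qed

text \<open>
  Testing Green's identity with \<open>\<phi>\<^sub>i(x) k(y)\<close> and integrating by parts in \<open>x\<close> moves the horizontal part of
  the energy onto the mode, where it contributes the multiple \<open>\<omega>\<^sub>i\<^sup>2\<close>. What remains is the weak equation
  in \<open>y\<close>. Differentiating the coefficient twice under the integral would need second derivatives up to
  the boundary.
\<close>

lemma mode_coefficient_weak_solution:
  assumes h: "0 < h" and u: "C1_square u g"
    and weak: "\<And>\<psi> \<gamma>. C1_square \<psi> \<gamma> \<Longrightarrow>
      I2 (\<lambda>z. g z \<bullet> \<gamma> z) + h * boundary_form (\<lambda>z. u z * \<psi> z) = lam * I2 (\<lambda>z. u z * \<psi> z)"
  shows "weak_solution h (lam - (freq i h)\<^sup>2)
    (\<lambda>y. L2 (\<lambda>x. u (x, y)) (mode i h)) (\<lambda>y. L2 (\<lambda>x. snd (g (x, y))) (mode i h))"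
  unfolding weak_solution_def
proof (intro conjI allI impI)
  let ?F = "\<lambda>y. L2 (\<lambda>x. u (x, y)) (mode i h)" and ?F' = "\<lambda>y. L2 (\<lambda>x. snd (g (x, y))) (mode i h)"
  show F: "C1 ?F ?F'" by (rule mode_coefficient_C1[OF u])
  fix k k' assume k: "C1 k k'"
  note cu = C1_square_continuous[OF u] and ck = C1_continuous[OF k] C1_continuous_deriv[OF k]
  let ?m = "mode i h" and ?d = "dmode i h"
  let ?b = "\<lambda>y. u (pi/2, y) * ?m (pi/2) + u (-(pi/2), y) * ?m (-(pi/2))"
  let ?\<psi> = "\<lambda>z. ?m (fst z) * k (snd z)"
  have cb: "continuous_on side ?b"
    by (intro continuous_intros continuous_on_slice(2)[OF cu(1)]) auto
  have cF: "continuous_on side ?F" "continuous_on side ?F'"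
    using C1_continuous[OF F] C1_continuous_deriv[OF F] by auto
  have 1: "I2 (\<lambda>z. g z \<bullet> (?d (fst z) * k (snd z), ?m (fst z) * k' (snd z))) =
      (freq i h)\<^sup>2 * L2 ?F k - h * integral side (\<lambda>y. ?b y * k y) + L2 ?F' k'"
  proof -
    have "I2 (\<lambda>z. g z \<bullet> (?d (fst z) * k (snd z), ?m (fst z) * k' (snd z))) =
        integral side (\<lambda>y. (freq i h)\<^sup>2 * (?F y * k y) - h * (?b y * k y) + ?F' y * k' y)"
      unfolding I2_def
    proof (rule integral_cong)
      fix y assume y: "y \<in> side"
      have "robin_form h (\<lambda>x. u (x, y)) (\<lambda>x. fst (g (x, y))) ?m ?d = (freq i h)\<^sup>2 * ?F y"
        by (rule robin_form_mode[OF h C1_square_slices(1)[OF u y]])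
      then have d: "L2 (\<lambda>x. fst (g (x, y))) ?d = (freq i h)\<^sup>2 * ?F y - h * ?b y"
        by (simp add: robin_form_def)
      have "integral side (\<lambda>x. g (x, y) \<bullet> (?d (fst (x, y)) * k (snd (x, y)), ?m (fst (x, y)) * k' (snd (x, y)))) =
          integral side (\<lambda>x. k y * (fst (g (x, y)) * ?d x) + k' y * (snd (g (x, y)) * ?m x))"
        by (intro integral_cong) (simp add: inner_prod_def algebra_simps)
      also have "\<dots> = integral side (\<lambda>x. k y * (fst (g (x, y)) * ?d x)) +
          integral side (\<lambda>x. k' y * (snd (g (x, y)) * ?m x))"
        by (intro integral_add integrable_continuous_real continuous_on_mult continuous_on_const
            continuous_on_mode continuous_on_dmode continuous_on_slice(1)[OF cu(3) y] continuous_on_slice(1)[OF cu(4) y])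
      also have "\<dots> = k y * L2 (\<lambda>x. fst (g (x, y))) ?d + k' y * ?F' y"
        by (simp add: L2_def)
      finally show "integral side (\<lambda>x. g (x, y) \<bullet> (?d (fst (x, y)) * k (snd (x, y)), ?m (fst (x, y)) * k' (snd (x, y)))) =
          (freq i h)\<^sup>2 * (?F y * k y) - h * (?b y * k y) + ?F' y * k' y"
        unfolding d by (simp add: algebra_simps)
    qed
    also have "\<dots> = integral side (\<lambda>y. (freq i h)\<^sup>2 * (?F y * k y) - h * (?b y * k y)) + integral side (\<lambda>y. ?F' y * k' y)"
      by (intro integral_add integrable_continuous_real continuous_intros cF ck cb)
    also have "integral side (\<lambda>y. (freq i h)\<^sup>2 * (?F y * k y) - h * (?b y * k y)) =
        integral side (\<lambda>y. (freq i h)\<^sup>2 * (?F y * k y)) - integral side (\<lambda>y. h * (?b y * k y))"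
      by (intro integral_diff integrable_continuous_real continuous_intros cF ck cb)
    finally show ?thesis by (simp add: L2_def)
  qed
  have 2: "boundary_form (\<lambda>z. u z * ?\<psi> z) =
      integral side (\<lambda>y. ?b y * k y) + (?F (pi/2) * k (pi/2) + ?F (-(pi/2)) * k (-(pi/2)))"
  proof -
    have "integral side (\<lambda>y. u (pi/2, y) * ?\<psi> (pi/2, y) + u (-(pi/2), y) * ?\<psi> (-(pi/2), y)) =
        integral side (\<lambda>y. ?b y * k y)"
      by (intro integral_cong) (simp add: algebra_simps)
    moreover have "integral side (\<lambda>x. u (x, pi/2) * ?\<psi> (x, pi/2) + u (x, -(pi/2)) * ?\<psi> (x, -(pi/2))) =
        ?F (pi/2) * k (pi/2) + ?F (-(pi/2)) * k (-(pi/2))"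
    proof -
      have "integral side (\<lambda>x. u (x, pi/2) * ?\<psi> (x, pi/2) + u (x, -(pi/2)) * ?\<psi> (x, -(pi/2))) =
          integral side (\<lambda>x. k (pi/2) * (u (x, pi/2) * ?m x) + k (-(pi/2)) * (u (x, -(pi/2)) * ?m x))"
        by (intro integral_cong) (simp add: algebra_simps)
      also have "\<dots> = integral side (\<lambda>x. k (pi/2) * (u (x, pi/2) * ?m x)) +
          integral side (\<lambda>x. k (-(pi/2)) * (u (x, -(pi/2)) * ?m x))"
        by (intro integral_add integrable_continuous_real continuous_on_mult continuous_on_const
              continuous_on_mode continuous_on_slice(1)[OF cu(1)]) auto
      also have "\<dots> = k (pi/2) * ?F (pi/2) + k (-(pi/2)) * ?F (-(pi/2))"
        by (simp only: L2_def integral_mult_right)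
      finally show ?thesis by (simp only: mult.commute)
    qed
    ultimately show ?thesis by (simp only: boundary_form_def)
  qed
  have 3: "I2 (\<lambda>z. u z * ?\<psi> z) = L2 ?F k"
  proof -
    have "I2 (\<lambda>z. u z * ?\<psi> z) = integral side (\<lambda>y. integral side (\<lambda>x. k y * (u (x, y) * ?m x)))"
      unfolding I2_def by (intro integral_cong) (simp add: mult_ac)
    then show ?thesis by (simp add: L2_def mult.commute)
  qed
  have "I2 (\<lambda>z. g z \<bullet> (?d (fst z) * k (snd z), ?m (fst z) * k' (snd z))) + h * boundary_form (\<lambda>z. u z * ?\<psi> z) =
      lam * I2 (\<lambda>z. u z * ?\<psi> z)"
    by (rule weak[OF C1_square_product[OF C1_mode k]])
  then show "robin_form h ?F ?F' k k' = (lam - (freq i h)\<^sup>2) * L2 ?F k"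
    unfolding 1 2 3 by (simp add: robin_form_def algebra_simps)
qed

lemma robin_solution_add_scaled:
  assumes "robin_solution h lam u" "robin_solution h lam v"
  shows "robin_solution h lam (\<lambda>z. u z + c * v z)"
proof -
  obtain g H where u: "continuous_on (closure Sq) g"
      "\<And>z. z \<in> closure Sq \<Longrightarrow> (u has_derivative (\<lambda>v. g z \<bullet> v)) (at z within closure Sq)"
      "continuous_on Sq H" "\<And>z. z \<in> Sq \<Longrightarrow> (g has_derivative blinfun_apply (H z)) (at z)"
      "\<And>z. z \<in> Sq \<Longrightarrow> - (\<Sum>b\<in>Basis. blinfun_apply (H z) b \<bullet> b) = lam * u z"
      "\<And>z \<nu>. Sq_normal z \<nu> \<Longrightarrow> g z \<bullet> \<nu> + h * u z = 0"
    using assms(1) unfolding robin_solution_def by blast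
  obtain g' H' where v: "continuous_on (closure Sq) g'"
      "\<And>z. z \<in> closure Sq \<Longrightarrow> (v has_derivative (\<lambda>v. g' z \<bullet> v)) (at z within closure Sq)"
      "continuous_on Sq H'" "\<And>z. z \<in> Sq \<Longrightarrow> (g' has_derivative blinfun_apply (H' z)) (at z)"
      "\<And>z. z \<in> Sq \<Longrightarrow> - (\<Sum>b\<in>Basis. blinfun_apply (H' z) b \<bullet> b) = lam * v z"
      "\<And>z \<nu>. Sq_normal z \<nu> \<Longrightarrow> g' z \<bullet> \<nu> + h * v z = 0"
    using assms(2) unfolding robin_solution_def by blast
  show ?thesis
    unfolding robin_solution_def
  proof (intro exI[of _ "\<lambda>z. g z + c *\<^sub>R g' z"] exI[of _ "\<lambda>z. H z + c *\<^sub>R H' z"] conjI ballI allI impI)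
    show "continuous_on (closure Sq) (\<lambda>z. g z + c *\<^sub>R g' z)" "continuous_on Sq (\<lambda>z. H z + c *\<^sub>R H' z)"
      by (intro continuous_intros u v)+
    show "((\<lambda>z. u z + c * v z) has_derivative (\<lambda>w. (g z + c *\<^sub>R g' z) \<bullet> w)) (at z within closure Sq)"
      if "z \<in> closure Sq" for z
      by (rule has_derivative_eq_rhs[OF has_derivative_add[OF u(2)[OF that] has_derivative_mult_right[OF v(2)[OF that]]]])
        (simp add: fun_eq_iff inner_add_left)
    show "((\<lambda>z. g z + c *\<^sub>R g' z) has_derivative blinfun_apply (H z + c *\<^sub>R H' z)) (at z)" if "z \<in> Sq" for z
      by (rule has_derivative_eq_rhs[OF has_derivative_add[OF u(4)[OF that] has_derivative_scaleR_right[OF v(4)[OF that]]]])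
        (simp add: fun_eq_iff blinfun.add_left blinfun.scaleR_left)
    show "- (\<Sum>b\<in>Basis. blinfun_apply (H z + c *\<^sub>R H' z) b \<bullet> b) = lam * (u z + c * v z)" if "z \<in> Sq" for z
    proof -
      have "(\<Sum>b\<in>Basis. blinfun_apply (H z + c *\<^sub>R H' z) b \<bullet> b) =
          (\<Sum>b\<in>Basis. blinfun_apply (H z) b \<bullet> b) + c * (\<Sum>b\<in>Basis. blinfun_apply (H' z) b \<bullet> b)"
        by (simp add: blinfun.add_left blinfun.scaleR_left inner_add_left sum.distrib sum_distrib_left)
      moreover have "(\<Sum>b\<in>Basis. blinfun_apply (H z) b \<bullet> b) = - (lam * u z)"
        "(\<Sum>b\<in>Basis. blinfun_apply (H' z) b \<bullet> b) = - (lam * v z)"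
        using u(5)[OF that] v(5)[OF that] by linarith+
      ultimately show ?thesis by (simp add: algebra_simps)
    qed
    show "(g z + c *\<^sub>R g' z) \<bullet> \<nu> + h * (u z + c * v z) = 0" if "Sq_normal z \<nu>" for z \<nu>
    proof -
      have "(g z + c *\<^sub>R g' z) \<bullet> \<nu> + h * (u z + c * v z) = (g z \<bullet> \<nu> + h * u z) + c * (g' z \<bullet> \<nu> + h * v z)"
        by (simp add: inner_add_left algebra_simps)
      then show ?thesis using u(6)[OF that] v(6)[OF that] by simp
    qed
  qed
qed

lemma Sq_normal_closure: "Sq_normal z \<nu> \<Longrightarrow> z \<in> closure Sq"
  unfolding Sq_normal_def closure_Sq by auto

lemma robin_solution_cong:
  assumes "robin_solution h lam u" "\<And>z. z \<in> closure Sq \<Longrightarrow> u z = v z"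
  shows "robin_solution h lam v"
proof -
  have der: "(v has_derivative D) (at z within closure Sq)"
    if "z \<in> closure Sq" "(u has_derivative D) (at z within closure Sq)" for z D
    by (rule has_derivative_transform[OF that(1) _ that(2)]) (simp add: assms(2))
  have inside: "u z = v z" if "z \<in> Sq" for z using assms(2) closure_subset[of Sq] that by blast
  have bd: "u z = v z" if "Sq_normal z \<nu>" for z \<nu> using assms(2)[OF Sq_normal_closure[OF that]] .
  obtain g H where u: "continuous_on (closure Sq) g"
      "\<And>z. z \<in> closure Sq \<Longrightarrow> (u has_derivative (\<lambda>v. g z \<bullet> v)) (at z within closure Sq)"
      "continuous_on Sq H" "\<And>z. z \<in> Sq \<Longrightarrow> (g has_derivative blinfun_apply (H z)) (at z)"
      "\<And>z. z \<in> Sq \<Longrightarrow> - (\<Sum>b\<in>Basis. blinfun_apply (H z) b \<bullet> b) = lam * u z"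
      "\<And>z \<nu>. Sq_normal z \<nu> \<Longrightarrow> g z \<bullet> \<nu> + h * u z = 0"
    using assms(1) unfolding robin_solution_def by blast
  show ?thesis
    unfolding robin_solution_def
  proof (intro exI[of _ g] exI[of _ H] conjI ballI allI impI)
    show "(v has_derivative (\<lambda>w. g z \<bullet> w)) (at z within closure Sq)" if "z \<in> closure Sq" for z
      by (rule der[OF that u(2)[OF that]])
    show "- (\<Sum>b\<in>Basis. blinfun_apply (H z) b \<bullet> b) = lam * v z" if "z \<in> Sq" for z
      using u(5)[OF that] inside[OF that] by simp
    show "g z \<bullet> \<nu> + h * v z = 0" if "Sq_normal z \<nu>" for z \<nu>
      using u(6)[OF that] bd[OF that] by simp
  qed (fact u)+
qed

lemma continuous_on_mode_compose [continuous_intros]: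
  "continuous_on S f \<Longrightarrow> continuous_on S (\<lambda>z. mode n h (f z))"
  "continuous_on S f \<Longrightarrow> continuous_on S (\<lambda>z. dmode n h (f z))"
  using continuous_on_compose2[OF continuous_on_mode[of UNIV]]
    continuous_on_compose2[OF continuous_on_dmode[of UNIV]] by auto

definition mode_product :: "real \<Rightarrow> nat \<times> nat \<Rightarrow> real \<times> real \<Rightarrow> real"
  where "mode_product h p z = mode (fst p) h (fst z) * mode (snd p) h (snd z)"

definition mode_energy :: "real \<Rightarrow> nat \<times> nat \<Rightarrow> real"
  where "mode_energy h p = (freq (fst p) h)\<^sup>2 + (freq (snd p) h)\<^sup>2"

lemma robin_solution_mode_product:
  assumes h: "0 < h"
  shows "robin_solution h (mode_energy h p) (mode_product h p)"
proof -
  obtain i j where p: "p = (i, j)" by force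
  let ?g = "\<lambda>z. (dmode i h (fst z) * mode j h (snd z), mode i h (fst z) * dmode j h (snd z))"
  let ?u = "\<lambda>z. mode i h (fst z) * mode j h (snd z)"
  let ?E11 = "Blinfun (\<lambda>v :: real \<times> real. (fst v, 0 :: real))"
  let ?E12 = "Blinfun (\<lambda>v :: real \<times> real. (snd v, fst v))"
  let ?E22 = "Blinfun (\<lambda>v :: real \<times> real. (0 :: real, snd v))"
  have E: "blinfun_apply ?E11 = (\<lambda>v. (fst v, 0))" "blinfun_apply ?E12 = (\<lambda>v. (snd v, fst v))"
    "blinfun_apply ?E22 = (\<lambda>v. (0, snd v))"
    by (rule bounded_linear_Blinfun_apply, intro bounded_linear_Pair bounded_linear_fst bounded_linear_snd
        bounded_linear_zero)+
  let ?H = "\<lambda>z. (- (freq i h)\<^sup>2 * ?u z) *\<^sub>R ?E11 + (dmode i h (fst z) * dmode j h (snd z)) *\<^sub>R ?E12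
    + (- (freq j h)\<^sup>2 * ?u z) *\<^sub>R ?E22"
  have Happ: "blinfun_apply (?H z) v =
      (- (freq i h)\<^sup>2 * ?u z * fst v + dmode i h (fst z) * dmode j h (snd z) * snd v,
       dmode i h (fst z) * dmode j h (snd z) * fst v - (freq j h)\<^sup>2 * ?u z * snd v)" for z v
    by (simp add: blinfun.add_left blinfun.diff_left blinfun.minus_left blinfun.scaleR_left E)
  have prod: "C1_square ?u ?g" by (rule C1_square_product[OF C1_mode C1_mode])
  have "robin_solution h ((freq i h)\<^sup>2 + (freq j h)\<^sup>2) ?u"
    unfolding robin_solution_def closure_Sq
  proof (intro exI[of _ ?g] exI[of _ ?H] conjI ballI allI impI)
    show "continuous_on square ?g" using prod by (simp add: C1_square_def)
    show "(?u has_derivative (\<lambda>v. ?g z \<bullet> v)) (at z within square)" if "z \<in> square" for z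
      using prod that unfolding C1_square_def by blast
    show "continuous_on Sq ?H" by (intro continuous_intros)
    show "(?g has_derivative blinfun_apply (?H z)) (at z)" for z
    proof -
      have m: "((\<lambda>z. mode i h (fst z)) has_derivative (\<lambda>v. fst v * dmode i h (fst z))) (at z)"
        "((\<lambda>z. mode j h (snd z)) has_derivative (\<lambda>v. snd v * dmode j h (snd z))) (at z)"
        "((\<lambda>z. dmode i h (fst z)) has_derivative (\<lambda>v. fst v * (- (freq i h)\<^sup>2 * mode i h (fst z)))) (at z)"
        "((\<lambda>z. dmode j h (snd z)) has_derivative (\<lambda>v. snd v * (- (freq j h)\<^sup>2 * mode j h (snd z)))) (at z)"
        by (rule DERIV_compose_FDERIV[OF mode_has_derivative has_derivative_fst[OF has_derivative_ident]]
          DERIV_compose_FDERIV[OF mode_has_derivative has_derivative_snd[OF has_derivative_ident]]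
          DERIV_compose_FDERIV[OF dmode_has_derivative has_derivative_fst[OF has_derivative_ident]]
          DERIV_compose_FDERIV[OF dmode_has_derivative has_derivative_snd[OF has_derivative_ident]])+
      show ?thesis
        by (rule has_derivative_eq_rhs[OF has_derivative_Pair[OF has_derivative_mult[OF m(3,2)] has_derivative_mult[OF m(1,4)]]])
          (simp only: fun_eq_iff Happ, simp add: algebra_simps)
    qed
    show "- (\<Sum>b\<in>Basis. blinfun_apply (?H z) b \<bullet> b) = ((freq i h)\<^sup>2 + (freq j h)\<^sup>2) * ?u z" for z
      unfolding Happ by (simp add: Basis_prod_def inner_prod_def algebra_simps)
    show "?g z \<bullet> \<nu> + h * ?u z = 0" if "Sq_normal z \<nu>" for z \<nu>
      using that mode_boundary[OF h] unfolding Sq_normal_def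
      by (auto simp: inner_prod_def)
  qed
  then show ?thesis by (simp add: p mode_energy_def mode_product_def[abs_def])
qed

lemma robin_solution_combination:
  assumes h: "0 < h" and u: "robin_solution h lam u" and fin: "finite P"
    and a: "\<And>p. p \<in> P \<Longrightarrow> a p \<noteq> 0 \<Longrightarrow> mode_energy h p = lam"
  shows "robin_solution h lam (\<lambda>z. u z + (\<Sum>p\<in>P. a p * mode_product h p z))"
  using fin a
proof (induction P rule: finite_induct)
  case empty
  then show ?case using u by simp
next
  case (insert p P)
  have IH: "robin_solution h lam (\<lambda>z. u z + (\<Sum>p\<in>P. a p * mode_product h p z))" using insert by simp
  show ?case
  proof (cases "a p = 0")
    case True
    then show ?thesis using IH insert.hyps by simp
  next
    case False
    then have "robin_solution h lam (mode_product h p)"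
      using robin_solution_mode_product[OF h, of p] insert.prems[of p] by simp
    from robin_solution_add_scaled[OF IH this, of "a p"] show ?thesis
      using insert.hyps by (simp add: algebra_simps)
  qed
qed

abbreviation low_pairs :: "(nat \<times> nat) set"
  where "low_pairs \<equiv> {..<3} \<times> {..<3}"

lemma sum_low_pairs:
  "(\<Sum>p\<in>low_pairs. a p * mode_product h p (x, y)) = (\<Sum>i<3. (\<Sum>j<3. a (i, j) * mode j h y) * mode i h x)"
proof -
  have "(\<Sum>p\<in>low_pairs. a p * mode_product h p (x, y)) =
      (\<Sum>i<3. \<Sum>j<3. a (i, j) * mode_product h (i, j) (x, y))"
    unfolding sum.cartesian_product by (simp add: case_prod_unfold)
  then show ?thesis by (simp add: mode_product_def sum_distrib_left mult_ac)
qed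

text \<open>
  On every horizontal line the Poincare inequality bounds the horizontal energy of \<open>w\<close> from below by
  \<open>25/4\<close> times its square integral; the vertical energy is nonnegative. The total energy is \<open>lam\<close> times
  the square integral, which is smaller unless \<open>w = 0\<close>.
\<close>

lemma robin_solution_orthogonal_eq_0:
  assumes h: "0 < h" and fr: "\<And>i. i < 3 \<Longrightarrow> freq i h < 5/2" and lam: "lam < 25/4"
    and w: "robin_solution h lam w"
    and orth: "\<And>i y. i < 3 \<Longrightarrow> y \<in> side \<Longrightarrow> L2 (\<lambda>x. w (x, y)) (mode i h) = 0"
    and z: "z \<in> square"
  shows "w z = 0"
proof -
  obtain g where g: "C1_square w g"
    and weak: "\<And>\<psi> \<gamma>. C1_square \<psi> \<gamma> \<Longrightarrow>
      I2 (\<lambda>z. g z \<bullet> \<gamma> z) + h * boundary_form (\<lambda>z. w z * \<psi> z) = lam * I2 (\<lambda>z. w z * \<psi> z)"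
    using robin_solution_weak[OF w] by blast
  note cw = C1_square_continuous[OF g]
  let ?X = "\<lambda>y. integral side (\<lambda>x. fst (g (x, y)) * fst (g (x, y)))"
  let ?W = "\<lambda>y. integral side (\<lambda>x. w (x, y) * w (x, y))"
  let ?b = "\<lambda>y. w (pi/2, y) * w (pi/2, y) + w (-(pi/2), y) * w (-(pi/2), y)"
  have cX: "continuous_on side ?X" "continuous_on side ?W"
    by (intro continuous_on_inner_integral[of "\<lambda>z. fst (g z) * fst (g z)"]
      continuous_on_inner_integral[of "\<lambda>z. w z * w z"] continuous_on_mult cw)+
  have cb: "continuous_on side ?b"
    by (intro continuous_intros continuous_on_slice(2)[OF cw(1)]) auto
  have "integral side (\<lambda>y. 25/4 * ?W y) \<le> integral side (\<lambda>y. ?X y + h * ?b y)"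
  proof (rule integral_le)
    show "(\<lambda>y. 25/4 * ?W y) integrable_on side" "(\<lambda>y. ?X y + h * ?b y) integrable_on side"
      by (intro integrable_continuous_real continuous_intros cX cb)+
    fix y assume y: "y \<in> side"
    have "25/4 * L2 (\<lambda>x. w (x, y)) (\<lambda>x. w (x, y)) \<le>
        robin_form h (\<lambda>x. w (x, y)) (\<lambda>x. fst (g (x, y))) (\<lambda>x. w (x, y)) (\<lambda>x. fst (g (x, y)))"
      by (rule poincare_orthogonal[OF h fr C1_square_slices(1)[OF g y] orth[OF _ y]])
    then show "25/4 * ?W y \<le> ?X y + h * ?b y" by (simp add: L2_def robin_form_def)
  qed
  also have "\<dots> = integral side ?X + integral side (\<lambda>y. h * ?b y)"
    by (intro integral_add integrable_continuous_real continuous_intros cX cb)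
  finally have x_part: "25/4 * I2 (\<lambda>z. w z * w z) \<le>
      I2 (\<lambda>z. fst (g z) * fst (g z)) + h * integral side ?b"
    by (simp add: I2_def)
  have "0 \<le> integral side (\<lambda>y. integral side (\<lambda>x. snd (g (x, y)) * snd (g (x, y))))"
  proof (rule integral_nonneg)
    show "(\<lambda>y. integral side (\<lambda>x. snd (g (x, y)) * snd (g (x, y)))) integrable_on side"
      by (intro integrable_continuous_real continuous_on_inner_integral[of "\<lambda>z. snd (g z) * snd (g z)"]
          continuous_on_mult cw)
    show "0 \<le> integral side (\<lambda>x. snd (g (x, y)) * snd (g (x, y)))" for y
      using L2_self_nonneg[of "\<lambda>x. snd (g (x, y))"] by (simp add: L2_def)
  qed
  then have y_part: "0 \<le> I2 (\<lambda>z. snd (g z) * snd (g z))" by (simp add: I2_def)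
  have "0 \<le> integral side (\<lambda>x. w (x, pi/2) * w (x, pi/2) + w (x, -(pi/2)) * w (x, -(pi/2)))"
    by (rule integral_nonneg) (auto intro!: integrable_continuous_real continuous_intros continuous_on_slice(1)[OF cw(1)])
  then have "h * integral side ?b \<le> h * boundary_form (\<lambda>z. w z * w z)"
    using h by (intro mult_left_mono) (auto simp: boundary_form_def)
  moreover have "I2 (\<lambda>z. g z \<bullet> g z) = I2 (\<lambda>z. fst (g z) * fst (g z)) + I2 (\<lambda>z. snd (g z) * snd (g z))"
    unfolding inner_prod_def inner_real_def by (intro I2_add continuous_on_mult cw)
  ultimately have "25/4 * I2 (\<lambda>z. w z * w z) \<le> lam * I2 (\<lambda>z. w z * w z)"
    using weak[OF g] x_part y_part by linarith
  then have "(25/4 - lam) * I2 (\<lambda>z. w z * w z) \<le> 0" by (simp add: algebra_simps)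
  then have "I2 (\<lambda>z. w z * w z) \<le> 0" using lam by (simp add: mult_le_0_iff)
  then have "w z * w z = 0" using z
    by (intro I2_nonneg_eq_0[of "\<lambda>z. w z * w z"]) (auto intro!: continuous_on_mult cw)
  then show ?thesis by simp
qed

text \<open>
  The coefficients of \<open>u\<close> along the modes in \<open>x\<close> are combinations of modes in \<open>y\<close> with the matching
  frequency, so subtracting the corresponding products leaves a solution with the same eigenvalue. It is
  orthogonal to the modes on every horizontal line and vanishes.
\<close>

lemma robin_solution_expansion:
  assumes h: "0 < h" and fr: "\<And>i. i < 3 \<Longrightarrow> freq i h < 5/2" and lam: "lam < 25/4"
    and u: "robin_solution h lam u"
  obtains a where "\<And>z. z \<in> square \<Longrightarrow> u z = (\<Sum>p\<in>low_pairs. a p * mode_product h p z)"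
    "\<And>p. p \<in> low_pairs \<Longrightarrow> a p \<noteq> 0 \<Longrightarrow> mode_energy h p = lam"
proof -
  obtain g where g: "C1_square u g"
    and weak: "\<And>\<psi> \<gamma>. C1_square \<psi> \<gamma> \<Longrightarrow>
      I2 (\<lambda>z. g z \<bullet> \<gamma> z) + h * boundary_form (\<lambda>z. u z * \<psi> z) = lam * I2 (\<lambda>z. u z * \<psi> z)"
    using robin_solution_weak[OF u] by blast
  have "\<exists>b. (\<forall>y\<in>side. L2 (\<lambda>x. u (x, y)) (mode i h) = (\<Sum>j<3. b j * mode j h y)) \<and>
      (\<forall>j<3. b j \<noteq> 0 \<longrightarrow> (freq j h)\<^sup>2 = lam - (freq i h)\<^sup>2)" for i
  proof -
    have "lam - (freq i h)\<^sup>2 < 25/4" using lam zero_le_power2[of "freq i h"] by linarith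
    from weak_solution_modes[OF h fr mode_coefficient_weak_solution[OF h g weak, where i = i] this]
    show ?thesis by metis
  qed
  then obtain b where b: "\<And>i y. y \<in> side \<Longrightarrow> L2 (\<lambda>x. u (x, y)) (mode i h) = (\<Sum>j<3. b i j * mode j h y)"
      "\<And>i j. j < 3 \<Longrightarrow> b i j \<noteq> 0 \<Longrightarrow> (freq j h)\<^sup>2 = lam - (freq i h)\<^sup>2"
    by metis
  define a where "a p = b (fst p) (snd p) / L2 (mode (fst p) h) (mode (fst p) h)" for p
  have energy: "mode_energy h p = lam" if "p \<in> low_pairs" "a p \<noteq> 0" for p
    using that b(2)[of "snd p" "fst p"] by (auto simp: a_def mode_energy_def)
  let ?w = "\<lambda>z. u z + (\<Sum>p\<in>low_pairs. - a p * mode_product h p z)"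
  have w: "robin_solution h lam ?w"
    by (rule robin_solution_combination[OF h u]) (use energy in auto)
  have "L2 (\<lambda>x. ?w (x, y)) (mode i h) = 0" if i: "i < 3" and y: "y \<in> side" for i y
  proof -
    have "(\<lambda>x. ?w (x, y)) = add_modes h (\<lambda>x. u (x, y)) (\<lambda>i. \<Sum>j<3. - a (i, j) * mode j h y) 3"
      unfolding sum_low_pairs add_modes_def ..
    then have "L2 (\<lambda>x. ?w (x, y)) (mode i h) = L2 (\<lambda>x. u (x, y)) (mode i h) +
        (\<Sum>j<3. - a (i, j) * mode j h y) * L2 (mode i h) (mode i h)"
      using L2_add_modes_mode[OF h C1_square_slices(1)[OF g y]] i by simp
    also have "(\<Sum>j<3. - a (i, j) * mode j h y) * L2 (mode i h) (mode i h) = - (\<Sum>j<3. b i j * mode j h y)"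
      using mode_norm_pos[OF h, of i] by (simp add: a_def sum_negf sum_distrib_right)
    finally show ?thesis using b(1)[OF y] by simp
  qed
  then have "?w z = 0" if "z \<in> square" for z
    using robin_solution_orthogonal_eq_0[OF h fr lam w _ that] by blast
  then have "u z = (\<Sum>p\<in>low_pairs. a p * mode_product h p z)" if "z \<in> square" for z
    using that by (simp add: sum_negf)
  then show ?thesis using that energy by blast
qed

text \<open>
  Orthogonality of the modes is used once in each variable.
\<close>

lemma mode_products_independent:
  assumes h: "0 < h" and eq: "\<And>z. z \<in> square \<Longrightarrow> (\<Sum>p\<in>low_pairs. a p * mode_product h p z) = 0"
    and p: "p \<in> low_pairs"
  shows "a p = 0"
proof -
  have zero: "c i = 0" if "\<And>x. x \<in> side \<Longrightarrow> (\<Sum>i<3. c i * mode i h x) = 0" "i < 3" for c i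
  proof -
    have 0: "C1 (\<lambda>x. 0) (\<lambda>x. 0)" by (simp add: C1_def)
    have "L2 (add_modes h (\<lambda>x. 0) c 3) (mode i h) = L2 (\<lambda>x. 0) (mode i h)"
      unfolding L2_def by (rule integral_cong) (simp add: that(1) add_modes_def)
    then have "c i * L2 (mode i h) (mode i h) = 0"
      using L2_add_modes_mode[OF h 0, of c 3 i] that(2) by simp
    then show ?thesis using mode_norm_pos[OF h, of i] by simp
  qed
  obtain i j where ij: "p = (i, j)" "i < 3" "j < 3" using p by auto
  have "(\<Sum>j<3. a (i, j) * mode j h y) = 0" if "y \<in> side" for y
    by (rule zero[OF _ ij(2)]) (use eq that in \<open>simp add: sum_low_pairs[symmetric]\<close>)
  then show ?thesis using zero[of "\<lambda>j. a (i, j)" j] ij by simp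
qed

section \<open>The fifth Robin eigenvalue\<close>

lemma sum_fun_apply: "(\<Sum>i\<in>A. f i) z = (\<Sum>i\<in>A. f i z)"
  for f :: "'a \<Rightarrow> 'b \<Rightarrow> 'c::comm_monoid_add"
  by (induction A rule: infinite_finite_induct) auto

text \<open>
  Extension by zero makes the products of modes elements of the eigenspaces.
\<close>

definition mode_ext :: "real \<Rightarrow> nat \<times> nat \<Rightarrow> real \<times> real \<Rightarrow> real"
  where "mode_ext h p z = (if z \<in> closure Sq then mode_product h p z else 0)"

lemma mode_ext_eigenspace:
  assumes "0 < h"
  shows "mode_ext h p \<in> robin_eigenspace h (mode_energy h p)"
  unfolding robin_eigenspace_def
  using robin_solution_cong[OF robin_solution_mode_product[OF assms, of p], of "mode_ext h p"]
  by (simp add: mode_ext_def)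

lemma mode_ext_inj:
  assumes h: "0 < h"
  shows "inj_on (mode_ext h) low_pairs"
proof (rule inj_onI, rule ccontr)
  fix p q assume p: "p \<in> low_pairs" and q: "q \<in> low_pairs" and eq: "mode_ext h p = mode_ext h q" and "p \<noteq> q"
  let ?a = "\<lambda>r. (if r = p then 1 else 0) - (if r = q then 1 else 0 :: real)"
  have "(\<Sum>r\<in>low_pairs. ?a r * mode_product h r z) = 0" if z: "z \<in> square" for z
  proof -
    have delta: "(\<Sum>r\<in>low_pairs. (if r = s then 1 else 0) * mode_product h r z) = mode_product h s z"
      if "s \<in> low_pairs" for s
      using that by (simp add: if_distrib[of "\<lambda>c. c * _"] cong: if_cong)
    have "mode_product h p z = mode_product h q z"
      using fun_cong[OF eq, of z] z by (simp add: mode_ext_def closure_Sq)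
    then show ?thesis using delta[OF p] delta[OF q] by (simp only: left_diff_distrib sum_subtractf)
  qed
  from mode_products_independent[OF h this p] show False using \<open>p \<noteq> q\<close> by simp
qed

context
  fixes h :: real
  assumes h: "0 < h" and fr: "\<And>i. i < 3 \<Longrightarrow> freq i h < 5/2"
begin

lemma eigenspace_combination:
  assumes "lam < 25/4" "u \<in> robin_eigenspace h lam"
  obtains a where "u = (\<Sum>p | p \<in> low_pairs \<and> mode_energy h p = lam. fun_scale (a p) (mode_ext h p))"
proof -
  have u: "robin_solution h lam u" "\<And>z. z \<notin> closure Sq \<Longrightarrow> u z = 0"
    using assms(2) by (auto simp: robin_eigenspace_def)
  obtain a where a: "\<And>z. z \<in> square \<Longrightarrow> u z = (\<Sum>p\<in>low_pairs. a p * mode_product h p z)"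
    "\<And>p. p \<in> low_pairs \<Longrightarrow> a p \<noteq> 0 \<Longrightarrow> mode_energy h p = lam"
    using robin_solution_expansion[OF h fr assms(1) u(1)] by blast
  have "u z = (\<Sum>p | p \<in> low_pairs \<and> mode_energy h p = lam. fun_scale (a p) (mode_ext h p)) z" for z
  proof (cases "z \<in> closure Sq")
    case True
    have "u z = (\<Sum>p\<in>low_pairs. a p * mode_product h p z)" using True a(1) by (simp add: closure_Sq)
    also have "\<dots> = (\<Sum>p | p \<in> low_pairs \<and> mode_energy h p = lam. a p * mode_product h p z)"
      using a(2) by (intro sum.mono_neutral_right) auto
    finally show ?thesis using True by (simp add: sum_fun_apply fun_scale_def mode_ext_def)
  next
    case False
    then show ?thesis using u(2) by (simp add: sum_fun_apply fun_scale_def mode_ext_def)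
  qed
  then show ?thesis using that by blast
qed

lemma robin_multiplicity_eq:
  assumes lam: "lam < 25/4"
  shows "robin_multiplicity h lam = card {p \<in> low_pairs. mode_energy h p = lam}"
proof -
  interpret fs: vector_space fun_scale by (rule vector_space_fun_scale)
  let ?P = "{p \<in> low_pairs. mode_energy h p = lam}"
  let ?B = "mode_ext h ` ?P"
  have fin: "finite ?P" by simp
  have inj: "inj_on (mode_ext h) ?P" by (rule inj_on_subset[OF mode_ext_inj[OF h]]) auto
  have "fs.span ?B = fs.span (robin_eigenspace h lam)"
    unfolding fs.span_eq
  proof
    show "?B \<subseteq> fs.span (robin_eigenspace h lam)"
      using mode_ext_eigenspace[OF h] by (auto intro!: fs.span_base)
    show "robin_eigenspace h lam \<subseteq> fs.span ?B"
    proof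
      fix u assume "u \<in> robin_eigenspace h lam"
      then obtain a where u: "u = (\<Sum>p | p \<in> low_pairs \<and> mode_energy h p = lam. fun_scale (a p) (mode_ext h p))"
        using eigenspace_combination[OF lam] by blast
      show "u \<in> fs.span ?B"
        unfolding u by (intro fs.span_sum fs.span_scale fs.span_base imageI)
    qed
  qed
  moreover have "fs.independent ?B"
  proof (rule fs.independent_if_scalars_zero)
    show "finite ?B" using fin by simp
    fix f b assume sum: "(\<Sum>b\<in>?B. fun_scale (f b) b) = 0" and b: "b \<in> ?B"
    let ?a = "\<lambda>p. if mode_energy h p = lam then f (mode_ext h p) else 0"
    have "(\<Sum>p\<in>low_pairs. ?a p * mode_product h p z) = 0" if z: "z \<in> square" for z
    proof -
      have "(\<Sum>p\<in>low_pairs. ?a p * mode_product h p z) =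
          (\<Sum>p\<in>low_pairs. if mode_energy h p = lam then f (mode_ext h p) * mode_product h p z else 0)"
        by (rule sum.cong) auto
      also have "\<dots> = (\<Sum>p\<in>?P. f (mode_ext h p) * mode_product h p z)"
        by (subst sum.inter_filter) auto
      also have "\<dots> = (\<Sum>p\<in>?P. fun_scale (f (mode_ext h p)) (mode_ext h p)) z"
        using z by (simp add: sum_fun_apply fun_scale_def mode_ext_def closure_Sq)
      also have "(\<Sum>p\<in>?P. fun_scale (f (mode_ext h p)) (mode_ext h p)) = (\<Sum>b\<in>?B. fun_scale (f b) b)"
        by (simp add: sum.reindex[OF inj])
      finally show ?thesis using sum by simp
    qed
    note zero = mode_products_independent[OF h this]
    obtain p where "p \<in> low_pairs" "mode_energy h p = lam" "b = mode_ext h p" using b by blast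
    with zero[of p] show "f b = 0" by simp
  qed
  ultimately have "fs.dim (robin_eigenspace h lam) = card ?B" by (rule fs.dim_eq_card)
  then show ?thesis unfolding robin_multiplicity_def by (simp add: card_image[OF inj])
qed

lemma is_robin_eigenvalue_iff:
  assumes lam: "lam < 25/4"
  shows "is_robin_eigenvalue h lam \<longleftrightarrow> lam \<in> mode_energy h ` low_pairs"
proof
  assume "is_robin_eigenvalue h lam"
  then obtain u z where u: "u \<in> robin_eigenspace h lam" and "u z \<noteq> 0"
    unfolding is_robin_eigenvalue_def robin_eigenfunction_def by blast
  obtain a where a: "u = (\<Sum>p | p \<in> low_pairs \<and> mode_energy h p = lam. fun_scale (a p) (mode_ext h p))"
    using eigenspace_combination[OF lam u] by blast
  have "{p \<in> low_pairs. mode_energy h p = lam} \<noteq> {}"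
  proof
    assume "{p \<in> low_pairs. mode_energy h p = lam} = {}"
    then have "u = 0" unfolding a by (simp only: sum.empty)
    then show False using \<open>u z \<noteq> 0\<close> by simp
  qed
  then show "lam \<in> mode_energy h ` low_pairs" by blast
next
  assume "lam \<in> mode_energy h ` low_pairs"
  then obtain p where "lam = mode_energy h p" by blast
  moreover have "mode_ext h p (pi/2, pi/2) \<noteq> 0"
    using mode_right_end_pos[OF h, of "fst p"] mode_right_end_pos[OF h, of "snd p"]
    by (simp add: mode_ext_def closure_Sq mode_product_def)
  ultimately show "is_robin_eigenvalue h lam"
    unfolding is_robin_eigenvalue_def robin_eigenfunction_def using mode_ext_eigenspace[OF h] by blast
qed

text \<open>
  Grouping the index pairs by their energy turns a sum of multiplicities into a number of pairs.
\<close>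

lemma eigenvalue_count:
  assumes "\<And>\<mu>. Q \<mu> \<Longrightarrow> \<mu> < 25/4"
  shows "finite {\<mu>. is_robin_eigenvalue h \<mu> \<and> Q \<mu>}"
    "(\<Sum>\<mu> | is_robin_eigenvalue h \<mu> \<and> Q \<mu>. robin_multiplicity h \<mu>) = card {p \<in> low_pairs. Q (mode_energy h p)}"
proof -
  let ?A = "{p \<in> low_pairs. Q (mode_energy h p)}"
  have fin: "finite ?A" by simp
  have eq: "{\<mu>. is_robin_eigenvalue h \<mu> \<and> Q \<mu>} = mode_energy h ` ?A"
    using is_robin_eigenvalue_iff assms by auto
  show "finite {\<mu>. is_robin_eigenvalue h \<mu> \<and> Q \<mu>}" unfolding eq by simp
  have "(\<Sum>\<mu> | is_robin_eigenvalue h \<mu> \<and> Q \<mu>. robin_multiplicity h \<mu>) =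
      (\<Sum>\<mu>\<in>mode_energy h ` ?A. \<Sum>p | p \<in> ?A \<and> mode_energy h p = \<mu>. 1)"
    unfolding eq
  proof (rule sum.cong)
    fix \<mu> assume "\<mu> \<in> mode_energy h ` ?A"
    then have Q: "Q \<mu>" by blast
    then have "{p \<in> low_pairs. mode_energy h p = \<mu>} = {p \<in> ?A. mode_energy h p = \<mu>}" by auto
    then show "robin_multiplicity h \<mu> = (\<Sum>p | p \<in> ?A \<and> mode_energy h p = \<mu>. 1)"
      using robin_multiplicity_eq[OF assms[OF Q]] by simp
  qed simp
  also have "\<dots> = card ?A"
    using sum.image_gen[OF fin, of "\<lambda>p. 1 :: nat" "mode_energy h"] by simp
  finally show "(\<Sum>\<mu> | is_robin_eigenvalue h \<mu> \<and> Q \<mu>. robin_multiplicity h \<mu>) = card ?A" .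
qed

end

text \<open>
  The frequencies lie in \<open>(i, i + 1/6)\<close>.
\<close>

lemma freq_squared_bounds:
  assumes "0 < h" "h < sin (pi / 12) / 6"
  shows "0 < (freq 0 h)\<^sup>2" "(freq 0 h)\<^sup>2 < 1" "1 < (freq 1 h)\<^sup>2" "(freq 1 h)\<^sup>2 < 2"
    "4 < (freq 2 h)\<^sup>2" "(freq 2 h)\<^sup>2 < 5" "\<And>i. i < 3 \<Longrightarrow> freq i h < 5/2"
proof -
  have b: "real i < freq i h" "freq i h < i + 1/6" for i
    using phase_props(1)[OF assms(1), of i] phase_small[OF assms, of i] by (simp_all add: freq_def)
  show "freq i h < 5/2" if "i < 3" for i
  proof -
    have "real i \<le> 2" using that by simp
    then show ?thesis using b(2)[of i] by linarith
  qed
  show "0 < (freq 0 h)\<^sup>2" using b(1)[of 0] by simp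
  have "(freq 0 h)\<^sup>2 < (1/6)\<^sup>2" using b[of 0] by (intro power_strict_mono) auto
  then show "(freq 0 h)\<^sup>2 < 1" by (simp add: power2_eq_square)
  have "1\<^sup>2 < (freq 1 h)\<^sup>2" using b[of 1] by (intro power_strict_mono) auto
  then show "1 < (freq 1 h)\<^sup>2" by simp
  have "(freq 1 h)\<^sup>2 < (7/6)\<^sup>2" using b[of 1] by (intro power_strict_mono) auto
  then show "(freq 1 h)\<^sup>2 < 2" by (simp add: power2_eq_square)
  have "2\<^sup>2 < (freq 2 h)\<^sup>2" using b[of 2] by (intro power_strict_mono) auto
  then show "4 < (freq 2 h)\<^sup>2" by simp
  have "(freq 2 h)\<^sup>2 < (13/6)\<^sup>2" using b[of 2] by (intro power_strict_mono) auto
  then show "(freq 2 h)\<^sup>2 < 5" by (simp add: power2_eq_square)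
qed

lemma low_pairs_cases:
  assumes "p \<in> low_pairs"
  shows "p \<in> {(0,0), (0,1), (1,0), (1,1), (0,2), (2,0), (1,2), (2,1), (2,2)}"
proof -
  obtain i j where p: "p = (i, j)" "i < 3" "j < 3" using assms by auto
  then have "i = 0 \<or> i = 1 \<or> i = 2" "j = 0 \<or> j = 1 \<or> j = 2" by linarith+
  then show ?thesis unfolding p(1) by auto
qed

lemma pairs_below_fifth:
  assumes "0 < h" "h < sin (pi / 12) / 6"
  shows "{p \<in> low_pairs. mode_energy h p < mode_energy h (0, 2)} = {(0,0), (0,1), (1,0), (1,1)}"
    "{p \<in> low_pairs. mode_energy h p \<le> mode_energy h (0, 2)} = {(0,0), (0,1), (1,0), (1,1), (0,2), (2,0)}"
    "{p \<in> low_pairs. mode_energy h p = mode_energy h (0, 2)} = {(0,2), (2,0)}"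
proof -
  note b = freq_squared_bounds(1-6)[OF assms]
  have e: "mode_energy h (0,0) < mode_energy h (0,2)" "mode_energy h (0,1) < mode_energy h (0,2)"
    "mode_energy h (1,0) < mode_energy h (0,2)" "mode_energy h (1,1) < mode_energy h (0,2)"
    "mode_energy h (2,0) = mode_energy h (0,2)" "mode_energy h (0,2) < mode_energy h (1,2)"
    "mode_energy h (0,2) < mode_energy h (2,1)" "mode_energy h (0,2) < mode_energy h (2,2)"
    unfolding mode_energy_def fst_conv snd_conv using b by linarith+
  have mem: "(0,0) \<in> low_pairs" "(0,1) \<in> low_pairs" "(1,0) \<in> low_pairs" "(1,1) \<in> low_pairs"
    "(0,2) \<in> low_pairs" "(2,0) \<in> low_pairs" by auto
  show "{p \<in> low_pairs. mode_energy h p < mode_energy h (0, 2)} = {(0,0), (0,1), (1,0), (1,1)}"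
  proof (intro equalityI subsetI)
    fix p assume p: "p \<in> {p \<in> low_pairs. mode_energy h p < mode_energy h (0, 2)}"
    then have "p \<in> low_pairs" and le: "mode_energy h p < mode_energy h (0, 2)" by simp_all
    from low_pairs_cases[OF this(1)] e le show "p \<in> {(0,0), (0,1), (1,0), (1,1)}"
      by (elim insertE emptyE) (simp_all del: One_nat_def)
  next
    fix p assume "p \<in> {(0,0), (0,1), (1,0), (1,1) :: nat \<times> nat}"
    with e mem show "p \<in> {p \<in> low_pairs. mode_energy h p < mode_energy h (0, 2)}"
      by (elim insertE emptyE) (simp_all del: One_nat_def mem_Sigma_iff)
  qed
  show "{p \<in> low_pairs. mode_energy h p \<le> mode_energy h (0, 2)} = {(0,0), (0,1), (1,0), (1,1), (0,2), (2,0)}"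
  proof (intro equalityI subsetI)
    fix p assume p: "p \<in> {p \<in> low_pairs. mode_energy h p \<le> mode_energy h (0, 2)}"
    then have "p \<in> low_pairs" and le: "mode_energy h p \<le> mode_energy h (0, 2)" by simp_all
    from low_pairs_cases[OF this(1)] e le show "p \<in> {(0,0), (0,1), (1,0), (1,1), (0,2), (2,0)}"
      by (elim insertE emptyE) (simp_all del: One_nat_def)
  next
    fix p assume "p \<in> {(0,0), (0,1), (1,0), (1,1), (0,2), (2,0) :: nat \<times> nat}"
    with e mem show "p \<in> {p \<in> low_pairs. mode_energy h p \<le> mode_energy h (0, 2)}"
      by (elim insertE emptyE) (simp_all del: One_nat_def mem_Sigma_iff add: less_imp_le)
  qed
  show "{p \<in> low_pairs. mode_energy h p = mode_energy h (0, 2)} = {(0,2), (2,0)}"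
  proof (intro equalityI subsetI)
    fix p assume p: "p \<in> {p \<in> low_pairs. mode_energy h p = mode_energy h (0, 2)}"
    then have "p \<in> low_pairs" and le: "mode_energy h p = mode_energy h (0, 2)" by simp_all
    from low_pairs_cases[OF this(1)] e le show "p \<in> {(0,2), (2,0)}"
      by (elim insertE emptyE) (simp_all del: One_nat_def)
  next
    fix p assume "p \<in> {(0,2), (2,0) :: nat \<times> nat}"
    with e mem show "p \<in> {p \<in> low_pairs. mode_energy h p = mode_energy h (0, 2)}"
      by (elim insertE emptyE) (simp_all del: One_nat_def mem_Sigma_iff)
  qed
qed

lemma fifth_energy_small:
  assumes "0 < h" "h < sin (pi / 12) / 6"
  shows "mode_energy h (0, 2) < 25/4"
  using freq_squared_bounds[OF assms] by (simp add: mode_energy_def)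

text \<open>
  Four index pairs have energy below that of \<open>(0, 2)\<close> and six have energy at most that. An
  eigenvalue smaller than this energy has at most four eigenvalues up to and including it, a larger one
  has at least six below it.
\<close>

lemma robin_eigenvalue_5:
  assumes h: "0 < h" "h < sin (pi / 12) / 6"
  shows "robin_eigenvalue h 5 = mode_energy h (0, 2)"
proof -
  let ?L = "mode_energy h (0, 2)"
  note fr = freq_squared_bounds(7)[OF h] and small = fifth_energy_small[OF h] and pairs = pairs_below_fifth[OF h]
  note count = eigenvalue_count[OF h(1) fr]
  have le: "finite {\<mu>. is_robin_eigenvalue h \<mu> \<and> \<mu> \<le> ?L}"
    "(\<Sum>\<mu> | is_robin_eigenvalue h \<mu> \<and> \<mu> \<le> ?L. robin_multiplicity h \<mu>) = 6"
    using count[of "\<lambda>\<mu>. \<mu> \<le> ?L"] small pairs(2) by auto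
  have lt: "(\<Sum>\<mu> | is_robin_eigenvalue h \<mu> \<and> \<mu> < ?L. robin_multiplicity h \<mu>) = 4"
    using count(2)[of "\<lambda>\<mu>. \<mu> < ?L"] small pairs(1) by auto
  have ev: "is_robin_eigenvalue h ?L"
    using is_robin_eigenvalue_iff[OF h(1) fr small] by auto
  show ?thesis
    unfolding robin_eigenvalue_def
  proof (rule the_equality)
    show "is_robin_eigenvalue h ?L \<and> finite {\<mu>. is_robin_eigenvalue h \<mu> \<and> \<mu> \<le> ?L} \<and>
      (\<Sum>\<mu> | is_robin_eigenvalue h \<mu> \<and> \<mu> < ?L. robin_multiplicity h \<mu>) < 5 \<and>
      5 \<le> (\<Sum>\<mu> | is_robin_eigenvalue h \<mu> \<and> \<mu> \<le> ?L. robin_multiplicity h \<mu>)"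
      using ev le lt by simp
  next
    fix l
    assume l: "is_robin_eigenvalue h l \<and> finite {\<mu>. is_robin_eigenvalue h \<mu> \<and> \<mu> \<le> l} \<and>
      (\<Sum>\<mu> | is_robin_eigenvalue h \<mu> \<and> \<mu> < l. robin_multiplicity h \<mu>) < 5 \<and>
      5 \<le> (\<Sum>\<mu> | is_robin_eigenvalue h \<mu> \<and> \<mu> \<le> l. robin_multiplicity h \<mu>)"
    show "l = ?L"
    proof (rule linorder_cases[of l ?L])
      assume "l < ?L"
      then have "card {p \<in> low_pairs. mode_energy h p \<le> l} \<le> card {p \<in> low_pairs. mode_energy h p < ?L}"
        by (intro card_mono) auto
      also have "\<dots> = 4" using pairs(1) by simp
      finally show ?thesis using l count(2)[of "\<lambda>\<mu>. \<mu> \<le> l"] \<open>l < ?L\<close> small by simp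
    next
      assume gt: "?L < l"
      have "finite {\<mu>. is_robin_eigenvalue h \<mu> \<and> \<mu> < l}"
        by (rule finite_subset[of _ "{\<mu>. is_robin_eigenvalue h \<mu> \<and> \<mu> \<le> l}"]) (use l in auto)
      then have "(\<Sum>\<mu> | is_robin_eigenvalue h \<mu> \<and> \<mu> \<le> ?L. robin_multiplicity h \<mu>) \<le>
          (\<Sum>\<mu> | is_robin_eigenvalue h \<mu> \<and> \<mu> < l. robin_multiplicity h \<mu>)"
        by (rule sum_mono2) (use gt in auto)
      then show ?thesis using le(2) l by simp
    qed
  qed
qed

section \<open>Nodal domains of superpositions of an even monotone profile\<close>

text \<open>
  Including openness makes the count additive over disjoint unions.
\<close>

definition open_count :: "(real \<times> real) set \<Rightarrow> nat \<Rightarrow> bool"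
  where "open_count U k \<longleftrightarrow> open U \<and> finite (components U) \<and> card (components U) = k"

lemma open_count_connected:
  assumes "open U" "connected U" "U \<noteq> {}"
  shows "open_count U 1"
proof -
  have "components U = {U}" using assms(2,3) by (simp add: components_eq_sing_iff)
  then show ?thesis using assms(1) by (simp add: open_count_def)
qed

lemma open_count_Un:
  assumes U: "open_count U j" and V: "open_count V k" and disj: "U \<inter> V = {}"
  shows "open_count (U \<union> V) (j + k)"
proof -
  have op: "open U" "open V" using U V by (auto simp: open_count_def)
  have sub: "X \<subseteq> U" if "X \<in> components U" for X using that in_components_subset by blast
  have sub': "X \<subseteq> V" if "X \<in> components V" for X using that in_components_subset by blast
  have ne: "X \<noteq> {}" if "X \<in> components U \<union> components V" for X
    using that in_components_nonempty by blast
  have eq: "components (U \<union> V) = components U \<union> components V"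
  proof (rule components_open_unique)
    show "pairwise disjnt (components U \<union> components V)"
    proof (rule pairwiseI)
      fix X Y assume X: "X \<in> components U \<union> components V" and Y: "Y \<in> components U \<union> components V" and "X \<noteq> Y"
      consider "X \<in> components U" "Y \<in> components U" | "X \<in> components V" "Y \<in> components V"
        | "X \<in> components U" "Y \<in> components V" | "X \<in> components V" "Y \<in> components U"
        using X Y by blast
      then show "disjnt X Y"
      proof cases
        case 1 then show ?thesis using \<open>X \<noteq> Y\<close> components_nonoverlap by (auto simp: disjnt_def)
      next
        case 2 then show ?thesis using \<open>X \<noteq> Y\<close> components_nonoverlap by (auto simp: disjnt_def)
      next
        case 3 then show ?thesis using sub[of X] sub'[of Y] disj unfolding disjnt_def by blast
      next
        case 4 then show ?thesis using sub'[of X] sub[of Y] disj unfolding disjnt_def by blast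
      qed
    qed
    show "\<Union> (components U \<union> components V) = U \<union> V"
      using Union_components[of U] Union_components[of V] by auto
    show "open X \<and> connected X \<and> X \<noteq> {}" if "X \<in> components U \<union> components V" for X
      using that op ne[OF that] open_components[of U X] open_components[of V X] in_components_connected[of X]
      by auto
  qed
  have "components U \<inter> components V = {}"
  proof (rule equals0I)
    fix X assume "X \<in> components U \<inter> components V"
    then have "X \<subseteq> U \<inter> V" "X \<noteq> {}" using sub[of X] sub'[of X] ne[of X] by simp_all
    then show False using disj by simp
  qed
  then show ?thesis using U V op eq by (simp add: open_count_def card_Un_disjoint open_Un)
qed

lemma open_swap: 
  assumes "open (U :: (real \<times> real) set)" shows "open (prod.swap ` U)"
proof -
  have "prod.swap ` U = prod.swap -` U"
  proof (intro equalityI subsetI)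
    show "z \<in> prod.swap ` U" if "z \<in> prod.swap -` U" for z
      using that by (intro image_eqI[of _ _ "prod.swap z"]) auto
  qed auto
  moreover have "open (prod.swap -` U)"
    using assms by (intro open_vimage) (auto simp: prod.swap_def[abs_def] intro!: continuous_intros)
  ultimately show ?thesis by simp
qed

lemma open_count_swap:
  assumes U: "open_count U k"
  shows "open_count (prod.swap ` U) k"
proof -
  have inj: "inj (prod.swap :: real \<times> real \<Rightarrow> real \<times> real)" by (rule injI) auto
  have "components (prod.swap ` U) = (image prod.swap) ` components U"
  proof (rule components_open_unique)
    show "pairwise disjnt ((`) prod.swap ` components U)"
    proof (rule pairwiseI)
      fix X Y assume "X \<in> (`) prod.swap ` components U" "Y \<in> (`) prod.swap ` components U" "X \<noteq> Y"
      then obtain X' Y' where "X' \<in> components U" "Y' \<in> components U" "X = prod.swap ` X'" "Y = prod.swap ` Y'"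
        "X' \<noteq> Y'" by blast
      then show "disjnt X Y" using components_nonoverlap[of X' U Y'] inj
        by (auto simp: disjnt_def)
    qed
    show "\<Union> ((`) prod.swap ` components U) = prod.swap ` U"
      using Union_components[of U] by (metis image_Union)
    show "open X \<and> connected X \<and> X \<noteq> {}" if X: "X \<in> (`) prod.swap ` components U" for X
    proof -
      obtain X' where X': "X' \<in> components U" "X = prod.swap ` X'" using X by blast
      then have "open X'" "connected X'" "X' \<noteq> {}" 
        using U open_components in_components_connected in_components_nonempty unfolding open_count_def by blast+
      then show ?thesis unfolding X'(2)
        by (intro conjI open_swap connected_continuous_image)
           (auto simp: prod.swap_def[abs_def] intro!: continuous_intros)
    qed
  qed
  moreover have "card ((image prod.swap) ` components U) = card (components U)"
    using inj by (intro card_image) (auto simp: inj_on_def inj_image_eq_iff)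
  ultimately show ?thesis using U open_swap by (auto simp: open_count_def)
qed

text \<open>
  If every point can be joined inside \<open>U\<close> to one connected set, then \<open>U\<close> is connected. In the
  applications the hub is a point, a segment or a cross of segments.
\<close>

lemma connected_through_hub:
  assumes C: "connected C" "C \<subseteq> U"
    and T: "\<And>z. z \<in> U \<Longrightarrow> \<exists>T. connected T \<and> T \<subseteq> U \<and> z \<in> T \<and> T \<inter> C \<noteq> {}"
  shows "connected U"
proof (cases "U = {}")
  case False
  have *: "\<exists>T. connected T \<and> T \<subseteq> U \<and> z \<in> T \<and> C \<subseteq> T" if z: "z \<in> U" for z
  proof -
    obtain T where "connected T" "T \<subseteq> U" "z \<in> T" "T \<inter> C \<noteq> {}" using T[OF z] by blast
    then show ?thesis using C by (intro exI[of _ "T \<union> C"]) (simp add: connected_Un)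
  qed
  have "C \<noteq> {}" using False T by blast
  have "connected_component U z w" if zw: "z \<in> U" "w \<in> U" for z w
  proof -
    obtain T T' where "connected T" "T \<subseteq> U" "z \<in> T" "C \<subseteq> T" "connected T'" "T' \<subseteq> U" "w \<in> T'" "C \<subseteq> T'"
      using *[OF zw(1)] *[OF zw(2)] by blast
    moreover from this have "T \<inter> T' \<noteq> {}" using \<open>C \<noteq> {}\<close> by blast
    ultimately show ?thesis
      unfolding connected_component_def by (intro exI[of _ "T \<union> T'"]) (simp add: connected_Un)
  qed
  then show ?thesis by (simp add: connected_iff_connected_component)
qed simp

text \<open>
  The properties of the quotient of the two modes that determine the topology of the nodal sets. The
  values \<open>1\<close> at the centre and \<open>-m\<close> at the end enter through the critical ratios \<open>1/m\<close>, \<open>m\<close> and \<open>-1\<close>.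
\<close>

locale even_profile =
  fixes q :: "real \<Rightarrow> real" and R m :: real
  assumes R_pos: "0 < R"
    and continuous_q: "continuous_on {-R..R} q"
    and even_q: "q (- t) = q t"
    and decreasing_q: "\<lbrakk>0 \<le> s; s < t; t \<le> R\<rbrakk> \<Longrightarrow> q t < q s"
    and q_0: "q 0 = 1"
    and q_R: "q R = - m"
    and m_gt_1: "1 < m"
begin

definition pos_set :: "real \<Rightarrow> real \<Rightarrow> (real \<times> real) set"
  where "pos_set c s = {(x, y). \<bar>x\<bar> < R \<and> \<bar>y\<bar> < R \<and> 0 < c * q y + s * q x}"

lemma q_abs: "q \<bar>t\<bar> = q t"
  using even_q by (simp add: abs_if)

lemma q_antimono: "\<lbrakk>\<bar>s\<bar> \<le> \<bar>t\<bar>; \<bar>t\<bar> < R\<rbrakk> \<Longrightarrow> q t \<le> q s"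
  using decreasing_q[of "\<bar>s\<bar>" "\<bar>t\<bar>"] q_abs[of s] q_abs[of t] by (cases "\<bar>s\<bar> = \<bar>t\<bar>") (auto simp: less_le)

lemma q_le_1: "\<bar>t\<bar> < R \<Longrightarrow> q t \<le> 1"
  using q_antimono[of 0 t] q_0 by simp

lemma q_gt: "\<bar>t\<bar> < R \<Longrightarrow> - m < q t"
  using decreasing_q[of "\<bar>t\<bar>" R] q_abs[of t] q_R by simp

lemma q_attains_below:
  assumes "- m < v"
  obtains t where "0 < t" "t < R" "q t < v"
proof -
  \<comment> \<open>A value in \<open>(-m, v)\<close> which is also below \<open>q 0\<close>.\<close>
  let ?w = "(min v 1 - m) / 2"
  have w: "- m < ?w" "?w < v" "?w < 1" using assms m_gt_1 by (auto simp: min_def)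
  have "\<exists>t\<ge>0. t \<le> R \<and> q t = ?w"
    using w q_0 q_R R_pos by (intro IVT2') (auto intro: continuous_on_subset[OF continuous_q])
  then obtain t where t: "0 \<le> t" "t \<le> R" "q t = ?w" by blast
  moreover have "t \<noteq> 0" "t \<noteq> R" using t w q_0 q_R by auto
  ultimately show ?thesis using that[of t] w by auto
qed

lemma pos_set_swap: "prod.swap ` pos_set c s = pos_set s c"
  by (auto simp: pos_set_def prod.swap_def image_iff add.commute)

lemma open_pos_set: "open (pos_set c s)"
proof -
  let ?f = "\<lambda>z. c * q (snd z) + s * q (fst z)" and ?S = "{-R<..<R} \<times> {-R<..<R}"
  have cq: "continuous_on {-R<..<R} q" by (rule continuous_on_subset[OF continuous_q]) auto
  have "continuous_on ?S (\<lambda>z. q (snd z))"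
    by (rule continuous_on_compose2[OF cq continuous_on_snd[OF continuous_on_id]]) auto
  moreover have "continuous_on ?S (\<lambda>z. q (fst z))"
    by (rule continuous_on_compose2[OF cq continuous_on_fst[OF continuous_on_id]]) auto
  ultimately have "continuous_on ?S ?f"
    by (intro continuous_intros)
  moreover have "open ?S" by (intro open_Times) auto
  ultimately have "open (?f -` {0<..} \<inter> ?S)"
    by (simp add: continuous_on_open_vimage)
  also have "?f -` {0<..} \<inter> ?S = pos_set c s"
    by (auto simp: pos_set_def)
  finally show ?thesis .
qed

lemma pos_set_disjoint: "pos_set c s \<inter> pos_set (- c) (- s) = {}"
  by (auto simp: pos_set_def)

text \<open>
  Moving either coordinate towards \<open>0\<close> increases the function, so the set is star-shaped about the
  centre in the sense that it contains the rectangle spanned by the centre and any of its points.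
\<close>

lemma count_pos_pos:
  assumes "0 \<le> c" "0 \<le> s" "0 < c + s"
  shows "open_count (pos_set c s) 1"
proof (rule open_count_connected)
  have 0: "(0, 0) \<in> pos_set c s" using assms R_pos q_0 by (simp add: pos_set_def)
  show "connected (pos_set c s)"
  proof (rule connected_through_hub)
    show "connected {(0, 0)}" "{(0, 0)} \<subseteq> pos_set c s" using 0 by auto
    fix z assume z: "z \<in> pos_set c s"
    obtain x y where xy: "z = (x, y)" by force
    let ?T = "{-\<bar>x\<bar>..\<bar>x\<bar>} \<times> {-\<bar>y\<bar>..\<bar>y\<bar>}"
    have "connected ?T" by (intro connected_Times) auto
    moreover have "?T \<subseteq> pos_set c s"
    proof clarify
      fix x' y' assume "x' \<in> {-\<bar>x\<bar>..\<bar>x\<bar>}" "y' \<in> {-\<bar>y\<bar>..\<bar>y\<bar>}"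
      then have le: "\<bar>x'\<bar> \<le> \<bar>x\<bar>" "\<bar>y'\<bar> \<le> \<bar>y\<bar>" by auto
      with z xy have "q x \<le> q x'" "q y \<le> q y'" by (auto simp: pos_set_def intro!: q_antimono)
      then have "s * q x \<le> s * q x'" "c * q y \<le> c * q y'" using assms by (auto intro: mult_left_mono)
      then show "(x', y') \<in> pos_set c s" using z xy le by (auto simp: pos_set_def)
    qed
    moreover have "z \<in> ?T" "(0, 0) \<in> ?T" using xy by auto
    ultimately show "\<exists>T. connected T \<and> T \<subseteq> pos_set c s \<and> z \<in> T \<and> T \<inter> {(0, 0)} \<noteq> {}"
      by blast
  qed
  show "pos_set c s \<noteq> {}" using 0 by blast
qed (rule open_pos_set)

lemma horizontal_inward:
  assumes "0 \<le> s" "(x, y) \<in> pos_set c s" "\<bar>x'\<bar> \<le> \<bar>x\<bar>"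
  shows "(x', y) \<in> pos_set c s"
proof -
  have "s * q x \<le> s * q x'" using assms by (intro mult_left_mono q_antimono) (auto simp: pos_set_def)
  then show ?thesis using assms by (auto simp: pos_set_def)
qed

lemma vertical_outward:
  assumes "c \<le> 0" "(x, y) \<in> pos_set c s" "\<bar>y\<bar> \<le> \<bar>y'\<bar>" "\<bar>y'\<bar> < R"
  shows "(x, y') \<in> pos_set c s"
proof -
  have "c * q y \<le> c * q y'" using assms by (intro mult_left_mono_neg q_antimono) (auto simp: pos_set_def)
  then show ?thesis using assms by (auto simp: pos_set_def)
qed

text \<open>
  The reflection in the horizontal axis exchanges the two halves.
\<close>

lemma count_halves:
  assumes conn: "connected {z \<in> pos_set c s. 0 < snd z}"
    and axis: "\<And>x. (x, 0) \<notin> pos_set c s" and ne: "pos_set c s \<noteq> {}"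
  shows "open_count (pos_set c s) 2"
proof -
  let ?U = "{z \<in> pos_set c s. 0 < snd z}" and ?V = "{z \<in> pos_set c s. snd z < 0}"
  have V: "?V = (\<lambda>z. (fst z, - snd z)) ` ?U"
  proof (intro equalityI subsetI)
    fix z assume "z \<in> ?V"
    then have "(fst z, - snd z) \<in> ?U" by (auto simp: pos_set_def even_q)
    then show "z \<in> (\<lambda>z. (fst z, - snd z)) ` ?U" by (intro image_eqI[of _ _ "(fst z, - snd z)"]) auto
  qed (auto simp: pos_set_def even_q)
  have UV: "pos_set c s = ?U \<union> ?V"
  proof (intro equalityI subsetI)
    fix z assume z: "z \<in> pos_set c s"
    then have "snd z \<noteq> 0" using axis[of "fst z"] by (metis prod.collapse)
    then show "z \<in> ?U \<union> ?V" using z by auto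
  qed auto
  have nU: "?U \<noteq> {}" using ne UV V by (metis (no_types, lifting) Un_empty image_empty)
  have op: "open ?U" "open ?V"
    using open_Int[OF open_pos_set[of c s] open_vimage[OF open_greaterThan[of 0] continuous_on_snd[OF continuous_on_id]]]
     open_Int[OF open_pos_set[of c s] open_vimage[OF open_lessThan[of 0] continuous_on_snd[OF continuous_on_id]]]
    by (auto simp: vimage_def Int_def id_def)
  have "connected ?V" unfolding V by (intro connected_continuous_image conn continuous_intros)
  moreover have "?V \<noteq> {}" using nU unfolding V by simp
  ultimately have "open_count (?U \<union> ?V) (1 + 1)"
    using op nU conn by (intro open_count_Un open_count_connected) auto
  then show ?thesis unfolding one_add_one by (subst UV)
qed

text \<open>
  The function increases as \<open>x\<close> tends to \<open>0\<close> and as \<open>\<bar>y\<bar>\<close> grows. It is positive at the centre, hence on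
  the whole vertical axis, to which every point is joined horizontally.
\<close>

lemma count_mixed_joined:
  assumes "0 < s" "c < 0" "- c < s"
  shows "open_count (pos_set c s) 1"
proof (rule open_count_connected)
  have axis: "(0, y) \<in> pos_set c s" if "\<bar>y\<bar> < R" for y
  proof -
    have "c * 1 \<le> c * q y" using that assms by (intro mult_left_mono_neg q_le_1) auto
    then have "0 < c * q y + s * 1" using assms by linarith
    then show ?thesis using that R_pos q_0 by (simp add: pos_set_def)
  qed
  show "connected (pos_set c s)"
  proof (rule connected_through_hub)
    show "connected ({0} \<times> {-R<..<R})" by (intro connected_Times) auto
    show "{0} \<times> {-R<..<R} \<subseteq> pos_set c s" using axis by auto
    fix z assume z: "z \<in> pos_set c s"
    obtain x y where xy: "z = (x, y)" by force
    let ?T = "{-\<bar>x\<bar>..\<bar>x\<bar>} \<times> {y}"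
    have "connected ?T" by (intro connected_Times) auto
    moreover have "?T \<subseteq> pos_set c s"
    proof clarify
      fix x' assume "x' \<in> {-\<bar>x\<bar>..\<bar>x\<bar>}"
      then show "(x', y) \<in> pos_set c s"
        using horizontal_inward[of s x y c x'] z xy assms(1) by (auto simp: abs_le_iff)
    qed
    moreover have "(0, y) \<in> ?T \<inter> {0} \<times> {-R<..<R}" using z xy by (auto simp: pos_set_def)
    moreover have "z \<in> ?T" using xy by auto
    ultimately show "\<exists>T. connected T \<and> T \<subseteq> pos_set c s \<and> z \<in> T \<and> T \<inter> {0} \<times> {-R<..<R} \<noteq> {}"
      by blast
  qed
  have "(0, 0) \<in> pos_set c s" using axis R_pos by simp
  then show "pos_set c s \<noteq> {}" by blast
qed (rule open_pos_set)

text \<open>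
  The function is largest at the centre among the points of the horizontal axis and is not positive
  there, so the axis separates the two halves. Each half retracts horizontally to an interval of the
  vertical axis.
\<close>

lemma count_mixed_split:
  assumes "0 < s" "c < 0" "s \<le> - c"
  shows "open_count (pos_set c s) 2"
proof (rule count_halves)
  show "(x, 0) \<notin> pos_set c s" for x
  proof
    assume x: "(x, 0) \<in> pos_set c s"
    then have "s * q x \<le> s * 1" using assms by (intro mult_left_mono q_le_1) (auto simp: pos_set_def)
    moreover have "0 < c * 1 + s * q x" using x by (simp add: pos_set_def q_0)
    ultimately show False using assms by linarith
  qed
  obtain t where t: "0 < t" "t < R" "q t < 0" using q_attains_below[of 0] m_gt_1 by auto
  have "0 < c * q t" using t assms by (simp add: mult_neg_neg)
  then have "(0, t) \<in> pos_set c s" using t assms R_pos by (simp add: pos_set_def q_0)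
  then show "pos_set c s \<noteq> {}" by blast
  let ?U = "{z \<in> pos_set c s. 0 < snd z}"
  let ?C = "{0} \<times> {y. (0, y) \<in> pos_set c s \<and> 0 < y}"
  show "connected ?U"
  proof (rule connected_through_hub)
    have "is_interval {y. (0, y) \<in> pos_set c s \<and> 0 < y}"
      unfolding is_interval_1
    proof clarify
      fix a b y assume *: "(0, a) \<in> pos_set c s" "0 < a" "(0, b) \<in> pos_set c s" "a \<le> y" "y \<le> b"
      then have "\<bar>y\<bar> < R" by (auto simp: pos_set_def)
      then show "(0, y) \<in> pos_set c s \<and> 0 < y"
        using * vertical_outward[of c 0 a s y] assms by auto
    qed
    then show "connected ?C" by (intro connected_Times) (auto simp: is_interval_connected)
    show "?C \<subseteq> ?U" by auto
    fix z assume z: "z \<in> ?U"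
    obtain x y where xy: "z = (x, y)" by force
    let ?T = "{-\<bar>x\<bar>..\<bar>x\<bar>} \<times> {y}"
    have "connected ?T" by (intro connected_Times) auto
    moreover have "?T \<subseteq> ?U"
    proof clarify
      fix x' assume "x' \<in> {-\<bar>x\<bar>..\<bar>x\<bar>}"
      then show "(x', y) \<in> pos_set c s \<and> 0 < snd (x', y)"
        using horizontal_inward[of s x y c x'] z xy assms(1) by (auto simp: abs_le_iff)
    qed
    moreover have "(0, y) \<in> ?T \<inter> ?C"
      using z xy horizontal_inward[of s x y c 0] assms(1) by (auto simp del: Int_iff intro!: IntI)
    moreover have "z \<in> ?T" using xy by auto
    ultimately show "\<exists>T. connected T \<and> T \<subseteq> ?U \<and> z \<in> T \<and> T \<inter> ?C \<noteq> {}"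
      by blast
  qed
qed

text \<open>
  As neither coefficient is positive, \<open>x = 0\<close> is the worst point of a horizontal line, and near
  the top side the function there is close to \<open>s - c m\<close>. If this is positive, a whole horizontal line
  lies in the set and joins the left corners to the right ones.
\<close>

lemma horizontal_line:
  assumes "c < 0" "s \<le> 0" "- s < - c * m"
  obtains t where "0 < t" "t < R" "\<And>x. \<bar>x\<bar> < R \<Longrightarrow> (x, t) \<in> pos_set c s"
proof -
  have "- m < - s / c" using assms by (simp add: field_simps)
  then obtain t where t: "0 < t" "t < R" "q t < - s / c" using q_attains_below by blast
  show ?thesis
  proof (rule that[OF t(1,2)])
    fix x assume x: "\<bar>x\<bar> < R"
    have "s * 1 \<le> s * q x" using x assms by (intro mult_left_mono_neg q_le_1) auto
    moreover have "- s < c * q t" using t(3) assms by (simp add: field_simps)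
    ultimately show "(x, t) \<in> pos_set c s" using x t by (simp add: pos_set_def)
  qed
qed

text \<open>
  On a vertical line the function increases with \<open>\<bar>y\<bar>\<close>, so its minimum on a segment in the upper half is
  attained at one of the end points.
\<close>

lemma vertical_to_line:
  assumes "c \<le> 0" "(x, y) \<in> pos_set c s" "(x, t) \<in> pos_set c s" "0 \<le> y" "0 < t"
  shows "{x} \<times> closed_segment y t \<subseteq> pos_set c s"
proof clarify
  fix y' assume y': "y' \<in> closed_segment y t"
  have "(y \<le> y' \<and> y' \<le> t) \<or> (t \<le> y' \<and> y' \<le> y)"
    using y' by (auto simp: closed_segment_eq_real_ivl split: if_splits)
  then show "(x, y') \<in> pos_set c s"
    using vertical_outward[of c x y s y'] vertical_outward[of c x t s y'] assms by (auto simp: pos_set_def)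
qed

text \<open>
  On the horizontal axis the function is at most \<open>c - s m \<le> 0\<close>, so the axis separates the two
  halves. Within a half a horizontal line joins the two corners, since \<open>m > 1\<close> implies the hypothesis of
  the lemma on such lines.
\<close>

lemma count_neg_split:
  assumes "c < 0" "s \<le> 0" "- s * m \<le> - c"
  shows "open_count (pos_set c s) 2"
proof (rule count_halves)
  show "(x, 0) \<notin> pos_set c s" for x
  proof
    assume x: "(x, 0) \<in> pos_set c s"
    then have "s * q x \<le> s * (- m)"
      using assms q_gt[of x] by (intro mult_left_mono_neg) (auto simp: pos_set_def)
    moreover have "0 < c * 1 + s * q x" using x by (simp add: pos_set_def q_0)
    ultimately show False using assms by linarith
  qed
  have "- s * 1 \<le> - s * m" using assms m_gt_1 by (intro mult_left_mono) auto
  moreover have "- c * 1 < - c * m" using assms m_gt_1 by (intro mult_strict_left_mono) auto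
  ultimately have "- s < - c * m" using assms by linarith
  then obtain t where t: "0 < t" "t < R" "\<And>x. \<bar>x\<bar> < R \<Longrightarrow> (x, t) \<in> pos_set c s"
    using horizontal_line[of c s] assms by blast
  then have "(0, t) \<in> pos_set c s" using R_pos by simp
  then show "pos_set c s \<noteq> {}" by blast
  let ?U = "{z \<in> pos_set c s. 0 < snd z}" and ?C = "{-R<..<R} \<times> {t}"
  show "connected ?U"
  proof (rule connected_through_hub)
    show "connected ?C" by (intro connected_Times) auto
    show "?C \<subseteq> ?U" using t by auto
    fix z assume z: "z \<in> ?U"
    obtain x y where xy: "z = (x, y)" by force
    have x: "\<bar>x\<bar> < R" using z xy by (auto simp: pos_set_def)
    let ?T = "{x} \<times> closed_segment y t"
    have "connected ?T" by (intro connected_Times) auto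
    moreover have "?T \<subseteq> ?U"
    proof -
      have "?T \<subseteq> pos_set c s"
        using vertical_to_line[of c x y s t] t(1) t(3)[OF x] z xy assms(1) by simp
      moreover have "closed_segment y t \<subseteq> {0<..}"
        using z xy t(1) by (intro closed_segment_subset) auto
      ultimately show ?thesis by auto
    qed
    moreover have "(x, t) \<in> ?T \<inter> ?C" using x by auto
    moreover have "z \<in> ?T" using xy by auto
    ultimately show "\<exists>T. connected T \<and> T \<subseteq> ?U \<and> z \<in> T \<and> T \<inter> ?C \<noteq> {}"
      by blast
  qed
qed

text \<open>
  There are such lines in both directions. Two horizontal lines and a vertical one that crosses them
  form a connected hub, which every point reaches vertically.
\<close>

lemma count_neg_joined:
  assumes "c < 0" "s < 0" "- s < - c * m" "- c < - s * m"
  shows "open_count (pos_set c s) 1"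
proof (rule open_count_connected)
  obtain t where t: "0 < t" "t < R" "\<And>x. \<bar>x\<bar> < R \<Longrightarrow> (x, t) \<in> pos_set c s"
    using horizontal_line[of c s] assms by auto
  obtain r where r: "0 < r" "r < R" "\<And>x. \<bar>x\<bar> < R \<Longrightarrow> (x, r) \<in> pos_set s c"
    using horizontal_line[of s c] assms by auto
  have t': "(x, - t) \<in> pos_set c s" if "\<bar>x\<bar> < R" for x
    using t(3)[OF that] by (simp add: pos_set_def even_q)
  have r': "(r, y) \<in> pos_set c s" if "\<bar>y\<bar> < R" for y
    using r(3)[OF that] by (simp add: pos_set_def add.commute)
  let ?C = "({-R<..<R} \<times> {t} \<union> {r} \<times> {-R<..<R}) \<union> {-R<..<R} \<times> {-t}"
  show "connected (pos_set c s)"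
  proof (rule connected_through_hub)
    have "(r, t) \<in> ({-R<..<R} \<times> {t}) \<inter> ({r} \<times> {-R<..<R})"
      "(r, - t) \<in> ({-R<..<R} \<times> {t} \<union> {r} \<times> {-R<..<R}) \<inter> ({-R<..<R} \<times> {-t})"
      using r t by auto
    then show "connected ?C"
      by (intro connected_Un connected_Times) (auto simp del: Int_iff)
    show "?C \<subseteq> pos_set c s" using t t' r' by auto
    fix z assume z: "z \<in> pos_set c s"
    obtain x y where xy: "z = (x, y)" by force
    have x: "\<bar>x\<bar> < R" using z xy by (auto simp: pos_set_def)
    let ?t = "if 0 \<le> y then t else - t"
    let ?T = "{x} \<times> closed_segment y ?t"
    have "connected ?T" by (intro connected_Times) auto
    moreover have "?T \<subseteq> pos_set c s"
    proof (cases "0 \<le> y")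
      case True
      then show ?thesis using vertical_to_line[of c x y s t] z xy t x assms by auto
    next
      case False
      have "(x, - y) \<in> pos_set c s" using z xy by (simp add: pos_set_def even_q)
      then have sub: "{x} \<times> closed_segment (- y) t \<subseteq> pos_set c s"
        using vertical_to_line[of c x "- y" s t] t x assms False by auto
      show ?thesis
      proof clarify
        fix y' assume "y' \<in> closed_segment y ?t"
        then have "- y' \<in> closed_segment (- y) t"
          using False by (auto simp: closed_segment_eq_real_ivl split: if_splits)
        then have "(x, - y') \<in> pos_set c s" using sub by blast
        then show "(x, y') \<in> pos_set c s" by (simp add: pos_set_def even_q)
      qed
    qed
    moreover have "(x, ?t) \<in> ?T \<inter> ?C" using x by auto
    moreover have "z \<in> ?T" using xy by auto
    ultimately show "\<exists>T. connected T \<and> T \<subseteq> pos_set c s \<and> z \<in> T \<and> T \<inter> ?C \<noteq> {}"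
      by blast
  qed
  have "(0, t) \<in> pos_set c s" using R_pos t by simp
  then show "pos_set c s \<noteq> {}" by blast
qed (rule open_pos_set)

definition nonzero_set :: "real \<Rightarrow> real \<Rightarrow> (real \<times> real) set"
  where "nonzero_set c s = {(x, y). \<bar>x\<bar> < R \<and> \<bar>y\<bar> < R \<and> c * q y + s * q x \<noteq> 0}"

lemma nodal_count_add:
  assumes "open_count (pos_set c s) j" "open_count (pos_set (- c) (- s)) k" "n = j + k"
  shows "open_count (nonzero_set c s) n"
proof -
  have "nonzero_set c s = pos_set c s \<union> pos_set (- c) (- s)"
    by (auto simp: nonzero_set_def pos_set_def)
  then show ?thesis using open_count_Un[OF assms(1,2) pos_set_disjoint] assms(3) by simp
qed

lemma nonzero_set_swap: "prod.swap ` nonzero_set c s = nonzero_set s c"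
  by (auto simp: nonzero_set_def prod.swap_def image_iff add.commute)

text \<open>
  One positive domain around the centre and two negative ones, along the top and the bottom side.
\<close>

lemma nodal_count_c_dominant:
  assumes "0 < c" "0 \<le> s" "s * m \<le> c"
  shows "open_count (nonzero_set c s) 3"
  by (rule nodal_count_add[OF count_pos_pos count_neg_split]) (use assms in auto)

lemma nodal_count_s_dominant:
  assumes "0 < s" "0 \<le> c" "c * m \<le> s"
  shows "open_count (nonzero_set c s) 3"
  using open_count_swap[OF nodal_count_c_dominant[of s c]] nonzero_set_swap assms by simp

text \<open>
  The negative domain surrounds the central positive one and reaches all four corners.
\<close>

lemma nodal_count_balanced:
  assumes "0 < c" "0 < s" "s < c * m" "c < s * m"
  shows "open_count (nonzero_set c s) 2"
  by (rule nodal_count_add[OF count_pos_pos count_neg_joined]) (use assms in auto)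

lemma count_mixed_swap:
  assumes "open_count (pos_set (- s) (- c)) k"
  shows "open_count (pos_set (- c) (- s)) k"
  using open_count_swap[OF assms] pos_set_swap by simp

lemma nodal_count_mixed_s_larger:
  assumes "0 < s" "c < 0" "- c < s"
  shows "open_count (nonzero_set c s) 3"
  by (rule nodal_count_add[OF count_mixed_joined count_mixed_swap[OF count_mixed_split]]) (use assms in auto)

lemma nodal_count_mixed_c_larger:
  assumes "0 < s" "c < 0" "s < - c"
  shows "open_count (nonzero_set c s) 3"
  by (rule nodal_count_add[OF count_mixed_split count_mixed_swap[OF count_mixed_joined]]) (use assms in auto)

text \<open>
  The function vanishes exactly on the two diagonals, which cut the square into four domains.
\<close>

lemma nodal_count_mixed_equal:
  assumes "0 < s"
  shows "open_count (nonzero_set (- s) s) 4"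
  by (rule nodal_count_add[OF count_mixed_split count_mixed_swap[OF count_mixed_split]]) (use assms in auto)

text \<open>
  A change of sign of the function does not affect its nodal domains, so the coefficient \<open>s\<close> may be
  assumed nonnegative, and the cases above are exhaustive.
\<close>

lemma nodal_count_at_most_4:
  assumes "c \<noteq> 0 \<or> s \<noteq> 0"
  shows "\<exists>k\<le>4. open_count (nonzero_set c s) k"
proof -
  have *: "\<exists>k\<le>4. open_count (nonzero_set c s) k" if cs: "0 < s \<or> (s = 0 \<and> 0 < c)" for c s
  proof -
    consider "0 < c" "s * m \<le> c" | "0 < s" "0 \<le> c" "c * m \<le> s" | "0 < c" "c < s * m" "s < c * m"
      | "c < 0" "- c < s" | "c < 0" "s < - c" | "c = - s" "0 < s"
    proof -
      have "s * m = 0" if "s = 0" using that by simp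
      moreover have "c * m = 0" if "c = 0" using that by simp
      ultimately show ?thesis using cs that by (smt (verit))
    qed
    then show ?thesis
    proof cases
      case 1 then show ?thesis using nodal_count_c_dominant[of c s] cs by (intro exI[of _ 3]) auto
    next
      case 2 then show ?thesis using nodal_count_s_dominant[of s c] by (intro exI[of _ 3]) auto
    next
      case 3
      then have "0 < s" using cs by auto
      with 3 show ?thesis using nodal_count_balanced[of c s] by (intro exI[of _ 2]) auto
    next
      case 4 then show ?thesis using nodal_count_mixed_s_larger[of s c] by (intro exI[of _ 3]) auto
    next
      case 5 then show ?thesis using nodal_count_mixed_c_larger[of s c] cs by (intro exI[of _ 3]) auto
    next
      case 6 then show ?thesis using nodal_count_mixed_equal[of s] by (intro exI[of _ 4]) auto
    qed
  qed
  have neg: "nonzero_set (- c) (- s) = nonzero_set c s" by (auto simp: nonzero_set_def)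
  show ?thesis
  proof (cases "0 < s \<or> (s = 0 \<and> 0 < c)")
    case True
    then show ?thesis by (rule *)
  next
    case False
    then have "0 < - s \<or> (- s = 0 \<and> 0 < - c)" using assms by auto
    from *[OF this] show ?thesis unfolding neg .
  qed
qed

end

section \<open>Nodal domains in the fifth eigenspace\<close>

text \<open>
  The quotient of the two even modes, up to sign.
\<close>

definition ratio :: "real \<Rightarrow> real \<Rightarrow> real"
  where "ratio h t = cos (freq 2 h * t) / cos (freq 0 h * t)"

lemma cos_freq_0_pos:
  assumes "0 < h" "\<bar>t\<bar> \<le> pi/2"
  shows "0 < cos (freq 0 h * t)"
proof -
  have f: "0 < freq 0 h" "freq 0 h < 1" using freq_bounds[OF assms(1), of 0] by auto
  have "\<bar>freq 0 h * t\<bar> \<le> freq 0 h * (pi/2)" unfolding abs_mult using f assms by (intro mult_mono) auto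
  also have "\<dots> < 1 * (pi/2)" using f by (intro mult_strict_right_mono) auto
  finally show ?thesis by (intro cos_gt_zero_pi) (auto simp: abs_less_iff)
qed

text \<open>
  The Wronskian has derivative \<open>(\<omega>\<^sub>0\<^sup>2 - \<omega>\<^sub>2\<^sup>2) cos (\<omega>\<^sub>0 x) cos (\<omega>\<^sub>2 x)\<close>, which changes sign once, from
  negative to positive. It vanishes at \<open>0\<close> by parity and at \<open>\<pi>/2\<close> because both modes satisfy the same
  Robin condition, so it is negative in between.
\<close>

lemma wronskian_neg:
  assumes h: "0 < h" and x: "0 < x" "x < pi/2"
  shows "freq 0 h * cos (freq 2 h * x) * sin (freq 0 h * x) - freq 2 h * sin (freq 2 h * x) * cos (freq 0 h * x) < 0"
proof -
  let ?a = "freq 0 h" and ?b = "freq 2 h"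
  let ?W = "\<lambda>x. ?a * cos (?b * x) * sin (?a * x) - ?b * sin (?b * x) * cos (?a * x)"
  let ?W' = "\<lambda>x. (?a\<^sup>2 - ?b\<^sup>2) * (cos (?b * x) * cos (?a * x))"
  have f: "0 < ?a" "?a < 1" "2 < ?b" "?b < 3"
    using freq_bounds[OF h, of 0] freq_bounds[OF h, of 2] by auto
  then have ab: "?a\<^sup>2 - ?b\<^sup>2 < 0" by (simp add: power_strict_mono)
  have D: "(?W has_real_derivative ?W' x) (at x)" for x
    by (auto intro!: derivative_eq_intros simp: power2_eq_square algebra_simps)
  have cont: "continuous_on S ?W" for S by (intro continuous_intros)
  have W0: "?W 0 = 0" by simp
  have W1: "?W (pi/2) = 0"
  proof -
    have 0: "?a * sin (?a * (pi/2)) = h * cos (?a * (pi/2))"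
      using mode_boundary(1)[OF h, of 0] by (simp add: mode_def dmode_def)
    have 2: "?b * sin (?b * (pi/2)) = h * cos (?b * (pi/2))"
      using mode_boundary(1)[OF h, of 2] by (simp add: mode_def dmode_def cos_diff sin_diff)
    have "?W (pi/2) = cos (?b * (pi/2)) * (?a * sin (?a * (pi/2))) - (?b * sin (?b * (pi/2))) * cos (?a * (pi/2))"
      by (simp add: mult_ac)
    then show ?thesis unfolding 0 2 by simp
  qed
  show ?thesis
  proof (cases "?b * x \<le> pi/2")
    case True
    have "?W x < ?W 0"
    proof (rule DERIV_neg_imp_decreasing_open[OF x(1) _ cont])
      fix t assume t: "0 < t" "t < x"
      have "?b * t < ?b * x" "0 < ?b * t" using t f by auto
      then have "0 < cos (?b * t)" using True by (intro cos_gt_zero_pi) auto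
      moreover have "0 < cos (?a * t)" using t x by (intro cos_freq_0_pos[OF h]) auto
      ultimately have "?W' t < 0" using ab by (simp add: mult_neg_pos)
      then show "\<exists>y. (?W has_real_derivative y) (at t) \<and> y < 0" using D by blast
    qed
    then show ?thesis using W0 by linarith
  next
    case False
    have "?W x < ?W (pi/2)"
    proof (rule DERIV_pos_imp_increasing_open[OF x(2) _ cont])
      fix t assume t: "x < t" "t < pi/2"
      have "?b * x < ?b * t" using t f by simp
      moreover have "?b * t < 3 * (pi/2)" using t f x by (intro mult_strict_mono) auto
      \<comment> \<open>Here \<open>\<omega>\<^sub>2 t\<close> lies in \<open>(\<pi>/2, 3\<pi>/2)\<close>, as \<open>\<omega>\<^sub>2 < 3\<close>.\<close>
      ultimately have "0 < cos (?b * t - pi)" using False by (intro cos_gt_zero_pi) auto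
      then have "cos (?b * t) < 0" by (simp add: cos_diff)
      moreover have "0 < cos (?a * t)" using t x by (intro cos_freq_0_pos[OF h]) auto
      ultimately have "0 < ?W' t" using ab by (intro mult_neg_neg mult_neg_pos) auto
      then show "\<exists>y. (?W has_real_derivative y) (at t) \<and> 0 < y" using D by blast
    qed
    then show ?thesis using W1 by linarith
  qed
qed

lemma ratio_decreasing:
  assumes h: "0 < h" and st: "0 \<le> s" "s < t" "t \<le> pi/2"
  shows "ratio h t < ratio h s"
proof (rule DERIV_neg_imp_decreasing_open[OF st(2)])
  fix x assume x: "s < x" "x < t"
  then have x': "0 < x" "x < pi/2" using st by auto
  let ?a = "freq 0 h" and ?b = "freq 2 h"
  have c: "0 < cos (?a * x)" using x' by (intro cos_freq_0_pos[OF h]) auto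
  have "(ratio h has_real_derivative
      (?a * cos (?b * x) * sin (?a * x) - ?b * sin (?b * x) * cos (?a * x)) / (cos (?a * x))\<^sup>2) (at x)"
    unfolding ratio_def[abs_def] using c
    by (auto intro!: derivative_eq_intros simp: power2_eq_square algebra_simps)
  moreover have "(?a * cos (?b * x) * sin (?a * x) - ?b * sin (?b * x) * cos (?a * x)) / (cos (?a * x))\<^sup>2 < 0"
    using wronskian_neg[OF h x'] c by (intro divide_neg_pos) auto
  ultimately show "\<exists>y. (ratio h has_real_derivative y) (at x) \<and> y < 0" by blast
next
  have "cos (freq 0 h * x) \<noteq> 0" if "x \<in> {s..t}" for x
    using that st cos_freq_0_pos[OF h, of x] by auto
  then show "continuous_on {s..t} (ratio h)"
    unfolding ratio_def[abs_def] by (intro continuous_intros) auto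
qed

text \<open>
  The quotient at the end point is \<open>-cos (s\<^sub>2 \<pi>/2) / cos (s\<^sub>0 \<pi>/2)\<close> with the phases \<open>s\<^sub>2 < s\<^sub>0\<close>.
\<close>

lemma ratio_end_less:
  assumes h: "0 < h"
  shows "ratio h (pi/2) < - 1"
proof -
  have r: "freq 0 h * (pi/2) = phase 0 h * pi / 2" "freq 2 h * (pi/2) = phase 2 h * pi / 2 + pi"
    by (simp_all add: freq_def algebra_simps)
  have "cos (phase 0 h * pi / 2) < cos (phase 2 h * pi / 2)"
    using phase_props(1,2)[OF h, of 0] phase_props(1,2)[OF h, of 2] phase_decreasing[OF h, of 0 2]
    by (intro cos_monotone_0_pi) (auto simp: field_simps intro: order_trans[of _ 1])
  moreover have "0 < cos (phase 0 h * pi / 2)"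
    using phase_props(1,2)[OF h, of 0] by (intro cos_gt_zero) auto
  ultimately show ?thesis unfolding ratio_def r cos_periodic_pi by (simp add: pos_divide_less_eq)
qed

lemma ratio_profile:
  assumes h: "0 < h"
  shows "even_profile (ratio h) (pi/2) (- ratio h (pi/2))"
proof
  have "cos (freq 0 h * x) \<noteq> 0" if "x \<in> {-(pi/2)..pi/2}" for x
  proof -
    have "\<bar>x\<bar> \<le> pi/2" by (rule abs_leI) (use that in auto)
    then show ?thesis using cos_freq_0_pos[OF h, of x] by simp
  qed
  then show "continuous_on {-(pi/2)..pi/2} (ratio h)"
    unfolding ratio_def[abs_def] by (intro continuous_intros) auto
qed (use ratio_decreasing[OF h] ratio_end_less[OF h] in \<open>auto simp: ratio_def\<close>)

lemma Sq_iff: "(x, y) \<in> Sq \<longleftrightarrow> \<bar>x\<bar> < pi/2 \<and> \<bar>y\<bar> < pi/2"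
  by (auto simp: Sq_def abs_less_iff)

text \<open>
  Dividing by the positive function \<open>cos (\<omega>\<^sub>0 x) cos (\<omega>\<^sub>0 y)\<close> does not change the nodal domains.
\<close>

lemma nodal_count_of_product_combination:
  assumes h: "0 < h"
    and u: "\<And>x y. (x, y) \<in> Sq \<Longrightarrow>
      u (x, y) = c * cos (freq 0 h * x) * cos (freq 2 h * y) + s * cos (freq 2 h * x) * cos (freq 0 h * y)"
    and count: "open_count (even_profile.nonzero_set (ratio h) (pi/2) c s) k"
  shows "has_nodal_count u k"
proof -
  interpret even_profile "ratio h" "pi/2" "- ratio h (pi/2)" by (rule ratio_profile[OF h])
  have "u (x, y) \<noteq> 0 \<longleftrightarrow> c * ratio h y + s * ratio h x \<noteq> 0" if "(x, y) \<in> Sq" for x y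
  proof -
    have "0 < cos (freq 0 h * x)" "0 < cos (freq 0 h * y)"
      using that by (auto simp: Sq_iff intro!: cos_freq_0_pos[OF h])
    moreover from this have "u (x, y) = cos (freq 0 h * x) * cos (freq 0 h * y) * (c * ratio h y + s * ratio h x)"
      unfolding u[OF that] ratio_def by (simp add: field_simps)
    ultimately show ?thesis by simp
  qed
  then have "{z \<in> Sq. u z \<noteq> 0} = nonzero_set c s"
    unfolding nonzero_set_def using Sq_iff by fastforce
  then show ?thesis using count by (simp add: has_nodal_count_def nodal_domains_def open_count_def)
qed

lemma nodal_count_Phi02:
  assumes h: "0 < h" and count: "open_count (even_profile.nonzero_set (ratio h) (pi/2) (cos \<theta>) (sin \<theta>)) k"
  shows "has_nodal_count (Phi02 h \<theta>) k"
  by (rule nodal_count_of_product_combination[OF h _ count])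
    (simp add: Phi02_def robin_alpha_eq[OF h] mult.commute[of pi])

text \<open>
  The eigenfunctions are the nonzero superpositions of the two products, which have at most four
  nodal domains.
\<close>

lemma fifth_not_courant_sharp:
  assumes h: "0 < h" "h < sin (pi / 12) / 6"
  shows "\<not> courant_sharp h 5"
proof
  interpret even_profile "ratio h" "pi/2" "- ratio h (pi/2)" by (rule ratio_profile[OF h(1)])
  assume "courant_sharp h 5"
  then obtain u z where u: "u \<in> robin_eigenspace h (mode_energy h (0, 2))" and "u z \<noteq> 0"
      and five: "has_nodal_count u 5"
    unfolding courant_sharp_def robin_eigenvalue_5[OF h] robin_eigenfunction_def by blast
  obtain a where "u = (\<Sum>p | p \<in> low_pairs \<and> mode_energy h p = mode_energy h (0, 2). fun_scale (a p) (mode_ext h p))"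
    using eigenspace_combination[OF h(1) freq_squared_bounds(7)[OF h] fifth_energy_small[OF h] u] by blast
  then have eq: "u = fun_scale (a (0, 2)) (mode_ext h (0, 2)) + fun_scale (a (2, 0)) (mode_ext h (2, 0))"
    unfolding pairs_below_fifth(3)[OF h] by simp
  have "a (0, 2) \<noteq> 0 \<or> a (2, 0) \<noteq> 0"
    using \<open>u z \<noteq> 0\<close> unfolding eq by (auto simp: fun_scale_def)
  then obtain k where k: "k \<le> 4" "open_count (nonzero_set (- a (0, 2)) (- a (2, 0))) k"
    using nodal_count_at_most_4[of "- a (0, 2)" "- a (2, 0)"] by auto
  have "has_nodal_count u k"
  proof (rule nodal_count_of_product_combination[OF h(1) _ k(2)])
    fix x y assume xy: "(x, y) \<in> Sq"
    then have "(x, y) \<in> closure Sq" using closure_subset by blast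
    then show "u (x, y) = - a (0, 2) * cos (freq 0 h * x) * cos (freq 2 h * y) +
        - a (2, 0) * cos (freq 2 h * x) * cos (freq 0 h * y)"
      by (simp add: eq fun_scale_def mode_ext_def mode_product_def mode_def cos_diff)
  qed
  then show False using five k(1) by (simp add: has_nodal_count_def)
qed

section \<open>The critical angles\<close>

lemma theta1_eq:
  assumes h: "0 < h"
  shows "theta1 h = arctan (1 / - ratio h (pi/2))"
  by (simp add: theta1_def ratio_def robin_alpha_eq[OF h] mult.commute)

lemma theta1_bounds:
  assumes h: "0 < h"
  shows "0 < theta1 h" "theta1 h < pi/4"
proof -
  have r: "0 < 1 / - ratio h (pi/2)" "1 / - ratio h (pi/2) < 1"
    using ratio_end_less[OF h] by (simp_all add: field_simps)
  then show "0 < theta1 h" unfolding theta1_eq[OF h] by simp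
  show "theta1 h < pi/4"
    unfolding theta1_eq[OF h] using arctan_monotone[OF r(2)] arctan_one by simp
qed

lemma tan_theta1:
  assumes h: "0 < h"
  shows "tan (theta1 h) = 1 / - ratio h (pi/2)"
  unfolding theta1_eq[OF h] by (rule tan_arctan)

lemma below_theta1:
  assumes h: "0 < h" and \<theta>: "0 \<le> \<theta>" "\<theta> \<le> theta1 h"
  shows "0 < cos \<theta>" "0 \<le> sin \<theta>" "sin \<theta> * (- ratio h (pi/2)) \<le> cos \<theta>"
proof -
  note b = theta1_bounds[OF h]
  show c: "0 < cos \<theta>" using b \<theta> by (intro cos_gt_zero_pi) auto
  show "0 \<le> sin \<theta>" using b \<theta> by (intro sin_ge_zero) auto
  have "tan \<theta> \<le> tan (theta1 h)" using b \<theta> by (intro tan_mono_le) auto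
  then show "sin \<theta> * (- ratio h (pi/2)) \<le> cos \<theta>"
    using c ratio_end_less[OF h] unfolding tan_theta1[OF h] by (simp add: tan_def field_simps)
qed

text \<open>
  The critical angles are where \<open>tan \<theta>\<close> equals \<open>1/m\<close>, \<open>m\<close> and \<open>-1\<close>; the interval
  \<open>[\<theta>\<^sub>2, \<pi>/2]\<close> is the mirror image of \<open>[0, \<theta>\<^sub>1]\<close> under \<open>\<theta> \<mapsto> \<pi>/2 - \<theta>\<close>, and beyond \<open>\<pi>/2\<close> the comparison of \<open>-cos \<theta>\<close> and \<open>sin \<theta>\<close> is that of
  \<open>sin (\<theta> - \<pi>/2)\<close> and \<open>sin (\<pi> - \<theta>)\<close>.
\<close>

theorem proposition10p1:
  shows "\<exists>h0>0. \<forall>h::real. 0 < h \<and> h < h0 \<longrightarrow>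
    \<not> courant_sharp h 5 \<and>
    (0 \<le> theta1 h \<and> theta1 h < theta2 h \<and> theta2 h < theta3 \<and> theta3 < pi) \<and>
    (\<forall>\<theta>\<in>{0..theta1 h}. has_nodal_count (Phi02 h \<theta>) 3) \<and>
    (\<forall>\<theta>\<in>{theta1 h<..<theta2 h}. has_nodal_count (Phi02 h \<theta>) 2) \<and>
    (\<forall>\<theta>\<in>{theta2 h..<theta3}. has_nodal_count (Phi02 h \<theta>) 3) \<and>
    has_nodal_count (Phi02 h theta3) 4 \<and>
    (\<forall>\<theta>\<in>{theta3<..<pi}. has_nodal_count (Phi02 h \<theta>) 3)"
proof (intro exI[of _ "sin (pi / 12) / 6"] conjI allI impI ballI)
  show "0 < sin (pi / 12) / 6" by (simp add: sin_gt_zero)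
  fix h :: real assume hh: "0 < h \<and> h < sin (pi / 12) / 6"
  then have h: "0 < h" by simp
  interpret even_profile "ratio h" "pi/2" "- ratio h (pi/2)" by (rule ratio_profile[OF h])
  note b = theta1_bounds[OF h] and Phi = nodal_count_Phi02[OF h]
  have cos_sin: "cos \<theta> = - sin (\<theta> - pi/2)" "sin \<theta> = sin (pi - \<theta>)" for \<theta> :: real
    by (simp_all add: sin_diff)
  show "\<not> courant_sharp h 5" using fifth_not_courant_sharp hh by blast
  show "0 \<le> theta1 h" "theta1 h < theta2 h" "theta2 h < theta3" "theta3 < pi"
    using b by (simp_all add: theta2_def theta3_def)
  show "has_nodal_count (Phi02 h \<theta>) 3" if "\<theta> \<in> {0..theta1 h}" for \<theta>
    using that below_theta1[OF h, of \<theta>] by (intro Phi nodal_count_c_dominant) auto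
  show "has_nodal_count (Phi02 h \<theta>) 2" if \<theta>: "\<theta> \<in> {theta1 h<..<theta2 h}" for \<theta>
  proof -
    have cs: "0 < cos \<theta>" "0 < sin \<theta>"
      using \<theta> b by (auto simp: theta2_def intro!: cos_gt_zero_pi sin_gt_zero)
    have "tan (theta1 h) < tan \<theta>" "tan \<theta> < tan (pi/2 - theta1 h)"
      using \<theta> b by (auto simp: theta2_def intro!: tan_monotone)
    then have t: "1 / - ratio h (pi/2) < tan \<theta>" "tan \<theta> < - ratio h (pi/2)"
      unfolding tan_cot tan_theta1[OF h] by simp_all
    have "sin \<theta> < cos \<theta> * (- ratio h (pi/2))"
      using t(2) cs by (simp add: tan_def field_simps)
    moreover have "cos \<theta> < sin \<theta> * (- ratio h (pi/2))"
      using t(1) cs ratio_end_less[OF h] by (simp add: tan_def field_simps)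
    ultimately show ?thesis using cs by (intro Phi nodal_count_balanced) auto
  qed
  show "has_nodal_count (Phi02 h \<theta>) 3" if \<theta>: "\<theta> \<in> {theta2 h..<theta3}" for \<theta>
  proof (cases "\<theta> \<le> pi/2")
    case True
    then show ?thesis
      using \<theta> below_theta1[OF h, of "pi/2 - \<theta>"]
      by (intro Phi nodal_count_s_dominant) (auto simp: theta2_def cos_diff sin_diff)
  next
    case False
    then have r: "pi/2 < \<theta>" "\<theta> < 3 * pi / 4" using \<theta> by (auto simp: theta3_def)
    have "0 < sin (\<theta> - pi/2)" "0 < sin (pi - \<theta>)"
      by (rule sin_gt_zero; use r pi_gt_zero in linarith)+
    moreover have "sin (\<theta> - pi/2) < sin (pi - \<theta>)"
      by (rule sin_monotone_2pi; use r pi_gt_zero in linarith)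
    ultimately show ?thesis
      by (intro Phi nodal_count_mixed_s_larger) (simp_all only: cos_sin[of \<theta>] minus_minus neg_less_0_iff_less)
  qed
  show "has_nodal_count (Phi02 h theta3) 4"
  proof -
    have a: "theta3 - pi/2 = pi/4" "pi - theta3 = pi/4" by (simp_all add: theta3_def)
    have cs: "cos theta3 = - sin (pi/4)" "sin theta3 = sin (pi/4)"
      using cos_sin[of theta3] unfolding a by simp_all
    have "0 < sin (pi/4)" by (intro sin_gt_zero) auto
    then show ?thesis using nodal_count_mixed_equal[of "sin (pi/4)"] by (intro Phi) (simp only: cs)
  qed
  show "has_nodal_count (Phi02 h \<theta>) 3" if \<theta>: "\<theta> \<in> {theta3<..<pi}" for \<theta>
  proof -
    have r: "3 * pi / 4 < \<theta>" "\<theta> < pi" using \<theta> by (auto simp: theta3_def)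
    have "0 < sin (\<theta> - pi/2)" "0 < sin (pi - \<theta>)"
      by (rule sin_gt_zero; use r pi_gt_zero in linarith)+
    moreover have "sin (pi - \<theta>) < sin (\<theta> - pi/2)"
      by (rule sin_monotone_2pi; use r pi_gt_zero in linarith)
    ultimately show ?thesis
      by (intro Phi nodal_count_mixed_c_larger) (simp_all only: cos_sin[of \<theta>] minus_minus neg_less_0_iff_less)
  qed
qed

end
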